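(* Let $q$ be a prime power and let $\mathcal{T}$ be a triangle in $\mathrm{PG}(2,q)$, i.e. the union of the point sets of three non-concurrent lines (so $|\mathcal{T}|=3q$). There do not exist a set $H\subseteq\mathcal{T}$ with $|H|=6$ and a set $M$ of points of $\mathrm{PG}(2,q)$ with $M\cap\mathcal{T}=\emptyset$ and $|M|=5$ such that $(\mathcal{T}\setminus H)\cup M$ (a set of $3q-1$ points) is a double blocking set of $\mathrm{PG}(2,q)$.
   Context: A double blocking set of $\mathrm{PG}(2,q)$ is a set of points meeting every line in at least two points. *)

theory Defs
  imports "HOL-Analysis.Cartesian_Space"
begin

text \<open>
  The plane \<open>PG(2,q)\<close> is the projective plane of the vector space \<open>'a ^ 3\<close> over a finite field
  \<open>'a\<close> with \<open>q = CARD('a)\<close> elements: points are the subspaces of dimension 1, and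
  a line is identified with the set of points contained in a subspace of dimension 2.
\<close>

definition pg_points :: "('a::{field,finite} ^ 3) set set" where
  "pg_points = {P. vec.subspace P \<and> vec.dim P = 1}"

definition pg_lines :: "('a::{field,finite} ^ 3) set set set" where
  "pg_lines = {{P \<in> pg_points. P \<subseteq> W} | W. vec.subspace W \<and> vec.dim W = 2}"

definition is_triangle :: "('a::{field,finite} ^ 3) set set \<Rightarrow> bool" where
  "is_triangle T \<longleftrightarrow>
     (\<exists>l1\<in>pg_lines. \<exists>l2\<in>pg_lines. \<exists>l3\<in>pg_lines.
        l1 \<noteq> l2 \<and> l1 \<noteq> l3 \<and> l2 \<noteq> l3 \<and> l1 \<inter> l2 \<inter> l3 = {} \<and> T = l1 \<union> l2 \<union> l3)"

definition double_blocking_set :: "('a::{field,finite} ^ 3) set set \<Rightarrow> bool" where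
  "double_blocking_set B \<longleftrightarrow> B \<subseteq> pg_points \<and> (\<forall>l\<in>pg_lines. 2 \<le> card (B \<inter> l))"

end

theory Submission
  imports Defs "HOL-Computational_Algebra.Polynomial"
begin

text \<open>
  Choose coordinates in which the triangle is \<open>xyz = 0\<close>. Let \<open>H\<close> contain the points
  \<open>(0 : 1 : -a)\<close>, \<open>(-b : 0 : 1)\<close>, \<open>(1 : -c : 0)\<close> for \<open>a \<in> A\<close>, \<open>b \<in> B\<close>, \<open>c \<in> C\<close>, and possibly some
  vertices, and write \<open>\<alpha> = -z/y\<close>, \<open>\<beta> = -x/z\<close>, \<open>\<gamma> = -y/x\<close> for a point of \<open>M\<close>, so that \<open>\<alpha>\<beta>\<gamma> = -1\<close>.
  Projecting \<open>M\<close> from a point \<open>a \<in> A\<close>, the double blocking property says that the multiset of the values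
  \<open>1/\<beta> + a\<gamma>\<close> contains \<open>0\<close>, all \<open>1/b\<close> and all \<open>ac\<close>; the same holds cyclically.

  If \<open>H\<close> contains no vertex, counting gives \<open>(|A|,|B|,|C|) = (0,2,4)\<close>, \<open>(0,3,3)\<close> or \<open>(2,2,2)\<close> up to symmetry.
  The first two are excluded by comparing elementary symmetric functions of degree 1 and 2 as polynomials
  in the centre of projection. In the third the multisets coincide. Degree 1 shows that the three values
  of \<open>\<alpha>\<close> outside \<open>A\<close> have vanishing first and second symmetric function, so they
  are the cube roots of a constant, and likewise for \<open>\<beta>\<close>, \<open>\<gamma>\<close>; as \<open>\<alpha>\<beta>\<gamma> = -1\<close>, only three incidence
  patterns between \<open>M\<close> and \<open>A, B, C\<close> survive. Degrees 2 and 3 give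
  \<open>\<Sum>\<alpha>\<gamma>\<^sup>2 = 0\<close> and a cubic equation for the elements of \<open>A\<close>; with the incidences these are inconsistent for each pattern.

  If \<open>H\<close> contains a vertex, then \<open>q - 1 \<le> 5\<close>. For \<open>q = 5\<close> symmetric functions decide again, and for \<open>q = 4\<close> the
  number of 2-secants of an 11-point double blocking set would be \<open>40/3\<close>.
\<close>

section \<open>Symmetric functions and polynomial systems\<close>

text \<open>The argument has to work in every characteristic. For this reason elementary symmetric
  functions are compared, not power sums, which lose information in characteristics 2 and 3; and the
  eliminations are done over the integers, where only the factors 2 and 3 survive and are treated
  separately. The hard case has two removed points on each side. Its pencils have no slack: 1 + 2 +
  2 required values for five points of \<open>M\<close>. The k-th symmetric function of
  \<open>inverse (be m) + a * ga m\<close> is a polynomial of degree at most k in \<open>a\<close>,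
  whose constant coefficient depends on \<open>be\<close> only and whose coefficient of degree k
  depends on \<open>ga\<close> only. In degree 1 nothing else occurs, and two centres fix both. In
  degree 2 one mixed coefficient is left, and a single centre makes it vanish. In degree 3 two mixed
  sums remain, which are evaluated from explicit coordinates of \<open>M\<close>. The bound q - 1
  \<le> 5 comes from the q - 1 lines through a removed vertex that are not sides: each has at most
  one other point on the triangle, hence needs its own point of \<open>M\<close>.\<close>

lemma symmetric_functions_5:
  fixes x1 :: "'a::field"
  assumes "{#x1,x2,x3,x4,x5#} = {#y1,y2,y3,y4,y5#}"
  shows "x1+x2+x3+x4+x5 = y1+y2+y3+y4+y5"
    and "x1*x2+x1*x3+x1*x4+x1*x5+x2*x3+x2*x4+x2*x5+x3*x4+x3*x5+x4*x5
       = y1*y2+y1*y3+y1*y4+y1*y5+y2*y3+y2*y4+y2*y5+y3*y4+y3*y5+y4*y5"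
    and "x1*x2*x3+x1*x2*x4+x1*x2*x5+x1*x3*x4+x1*x3*x5+x1*x4*x5+x2*x3*x4+x2*x3*x5+x2*x4*x5+x3*x4*x5
       = y1*y2*y3+y1*y2*y4+y1*y2*y5+y1*y3*y4+y1*y3*y5+y1*y4*y5+y2*y3*y4+y2*y3*y5+y2*y4*y5+y3*y4*y5"
proof -
  \<comment> \<open>The coefficients of a product of polynomials \<open>1 + x X\<close> are the
    elementary symmetric functions of the \<open>x\<close>.\<close>
  have "prod_mset (image_mset (\<lambda>x. [:1, x:]) {#x1,x2,x3,x4,x5#})
      = prod_mset (image_mset (\<lambda>x. [:1, x:]) {#y1,y2,y3,y4,y5#})"
    by (simp only: assms)
  note * = this[unfolded image_mset_add_mset image_mset_empty prod_mset.add_mset prod_mset.empty]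
  have "coeff ([:1,x1:]*([:1,x2:]*([:1,x3:]*([:1,x4:]*([:1,x5:]*1))))) k
      = coeff ([:1,y1:]*([:1,y2:]*([:1,y3:]*([:1,y4:]*([:1,y5:]*1))))) k" for k
    by (simp only: *)
  from this[of 1] this[of 2] this[of 3]
  show "x1+x2+x3+x4+x5 = y1+y2+y3+y4+y5"
    and "x1*x2+x1*x3+x1*x4+x1*x5+x2*x3+x2*x4+x2*x5+x3*x4+x3*x5+x4*x5
       = y1*y2+y1*y3+y1*y4+y1*y5+y2*y3+y2*y4+y2*y5+y3*y4+y3*y5+y4*y5"
    and "x1*x2*x3+x1*x2*x4+x1*x2*x5+x1*x3*x4+x1*x3*x5+x1*x4*x5+x2*x3*x4+x2*x3*x5+x2*x4*x5+x3*x4*x5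
       = y1*y2*y3+y1*y2*y4+y1*y2*y5+y1*y3*y4+y1*y3*y5+y1*y4*y5+y2*y3*y4+y2*y3*y5+y2*y4*y5+y3*y4*y5"
    by (simp_all add: numeral_eq_Suc algebra_simps)
qed

text \<open>Of a polynomial in the centre of projection often only the constant term is known; hence
  the conclusion concerns \<open>U\<close>, and the other coefficients stay arbitrary.\<close>

lemma linear_two_roots:
  fixes U :: "'a::field"
  assumes "U + k*t = 0" "U + k*t' = 0" "t \<noteq> t'"
  shows "U = 0"
proof -
  have "k * (t - t') = 0" using assms(1,2) by algebra
  then show ?thesis using assms by auto
qed

lemma quadratic_three_roots:
  fixes U :: "'a::field"
  assumes "U + k*t + l*t\<^sup>2 = 0" "U + k*t' + l*t'\<^sup>2 = 0" "U + k*t'' + l*t''\<^sup>2 = 0"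
    and "t \<noteq> t'" "t \<noteq> t''" "t' \<noteq> t''"
  shows "U = 0"
proof -
  have "(t - t') * (k + l*(t+t')) = 0" using assms(1,2) by algebra
  then have 1: "k + l*(t+t') = 0" using assms by auto
  have "(t - t'') * (k + l*(t+t'')) = 0" using assms(1,3) by algebra
  then have 2: "k + l*(t+t'') = 0" using assms by auto
  have "l * (t' - t'') = 0" using 1 2 by algebra
  then have "l = 0" using assms by auto
  then show ?thesis using 1 assms(1) by auto
qed

section \<open>Polynomial system of the cyclic pattern\<close>

text \<open>The two equations are one condition, imposed on \<open>p\<close> and on
  \<open>r\<close>, with \<open>w\<close> standing for the inverse cube of the third parameter. Two
  combinations of them are divisible by \<open>p - r\<close>; both quotients are linear in
  \<open>w\<close>, and eliminating \<open>w\<close> leaves the factor \<open>p*r - 1\<close> times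
  the claimed relation.\<close>

lemma cyclic_system_pair:
  fixes p r w :: "'a::field"
  assumes "(p-1)*((p+1)\<^sup>2 - p*w) = p*r*(p*r-1)" "(r-1)*((r+1)\<^sup>2 - r*w) = p*r*(p*r-1)"
    and "p \<noteq> r" "p*r \<noteq> 1" "p \<noteq> 0" "r \<noteq> 0"
  shows "(p+r)*(1-p*r) = 1"
proof -
  have "(p - r) * (p^2+p*r+r^2+p+r-1-w*(p+r-1)) = 0" using assms(1,2) by algebra
  then have 1: "w*(p+r-1) = p^2+p*r+r^2+p+r-1" using assms by auto
  have "(p - r) * (w*p*r - ((p*r)^2 + p*r*(p+r) + 1)) = 0" using assms(1,2) by algebra
  then have 2: "w*p*r = (p*r)^2 + p*r*(p+r) + 1" using assms by auto
  have "(p*r-1) * ((p+r)*(p*r-1)+1) = 0" using 1 2 by algebra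
  then have "(p+r)*(p*r-1)+1 = 0" using assms by auto
  then show ?thesis by algebra
qed

lemma cyclic_system_all_equal:
  fixes p :: "'a::field"
  assumes E: "p\<^sup>2*(2+p+p) = -1"
    and F: "p^3*(p-1)*(p+1)\<^sup>2 - p*(p-1) = p^3*(p*p*(p*p-1))"
    and "p \<noteq> 1" "p \<noteq> 0"
  shows False
proof -
  have "p*(p-1)*(p\<^sup>2*(p+1)\<^sup>2 - 1 - p^4*(p+1)) = 0" using F by algebra
  then have 1: "p\<^sup>2*(p+1)\<^sup>2 - 1 - p^4*(p+1) = 0" using assms by auto
  have "p^2*(p^3 - (4*p+3)) = 0" using 1 E by algebra
  then have 2: "p^3 = 4*p+3" using assms by auto
  have a: "2*p^2+8*p+7 = 0" using 2 E by algebra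
  have b: "17*p+22 = 0" using a 2 by algebra
  \<comment> \<open>The two polynomials \<open>a\<close> and \<open>b\<close> have resultant -1, so
    no characteristic is exceptional.\<close>
  have "(1::'a) = 0" using a b by algebra
  then show False by simp
qed

text \<open>Two of the three parameters share the value \<open>r\<close>, and \<open>S1\<close> is
  the relation of \<open>cyclic_system_pair\<close> for \<open>p\<close> and \<open>r\<close>. Since
  \<open>E1\<close> is linear in \<open>p\<close>, this parameter can be eliminated; the polynomials
  in \<open>r\<close> are then reduced against each other until \<open>r = 13\<close> and 72 = 0
  remain.\<close>

lemma cyclic_system_two_equal:
  fixes p r :: "'a::field"
  assumes E1: "r\<^sup>2*(2+p+r) = -1"
    and E3: "p\<^sup>2*(2+r+r) = -1"
    and S1: "(p+r)*(1-p*r) = 1"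
    and F: "p^3*(r-1)*(r+1)\<^sup>2 - r*(r-1) = p^3*(r*r*(r*r-1))"
    and nz: "p \<noteq> 0" "r \<noteq> 0" "r \<noteq> 1" and three: "(3::'a) \<noteq> 0"
  shows False
proof -
  have "(r-1)*(p^3*(r+1)\<^sup>2 - r - p^3*(r^2*(r+1))) = 0" using F by algebra
  then have "p^3*(r+1)\<^sup>2 - r - p^3*(r^2*(r+1)) = 0" using nz by auto
  then have 5: "p*(r^2-r-1) = 2*r" using E3 by algebra
  \<comment> \<open>Characteristic 2 is excluded by \<open>E3\<close> itself, characteristic 3 by
    the hypothesis \<open>three\<close>.\<close>
  have two: "(2::'a) \<noteq> 0"
  proof -
    have "(2::'a) * (p\<^sup>2*(1+r)) = -1" using E3 by algebra
    then show ?thesis by auto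
  qed
  have r1: "r + 1 \<noteq> 0"
  proof -
    have "(r+1) * (2*p\<^sup>2) = -1" using E3 by algebra
    then show ?thesis by auto
  qed
  have "(r+1)*(r^4-r^2-1) = 0" using 5 E1 by algebra
  then have "r^4-r^2-1 = 0" using r1 by (metis mult_eq_0_iff)
  then have a: "r^4 = r^2+1" by algebra
  \<comment> \<open>\<open>H\<close> is \<open>S1\<close>, and \<open>J\<close> below is
    \<open>E3\<close>, after elimination of \<open>p\<close> by \<open>E1\<close>.\<close>
  have H: "2*r^5+4*r^4+4*r^3+4*r^2+r+1 = 0"
  proof -
    have "r^3 * ((p+r)*(1-p*r) - 1) = - (2*r^5+4*r^4+4*r^3+4*r^2+r+1)" using E1 by algebra
    then show ?thesis using S1 by algebra
  qed
  have J: "2*r^7+10*r^6+16*r^5+13*r^4+12*r^3+8*r^2+2*r+2 = 0"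
  proof -
    have N: "r\<^sup>2*p = -(r^3+2*r\<^sup>2+1)" using E1 by algebra
    have "(r\<^sup>2*p)\<^sup>2*(2+r+r) = -(r^4)" using E3 by algebra
    then have "(-(r^3+2*r\<^sup>2+1))\<^sup>2*(2+r+r) = -(r^4)" unfolding N .
    then show ?thesis by algebra
  qed
  have J1: "3*r^4+r^3-4*r^2+r-2 = 0" using H J by algebra
  have b: "r^3 = r^2-r-1" using J1 unfolding a by algebra
  have "r^3 = 2*r^2+r+1"
  proof -
    have "r*r^3 = r^2+1" using a by algebra
    then have "r*(r^2-r-1) = r^2+1" unfolding b .
    then show ?thesis by algebra
  qed
  then have c: "r^2+2*r+2 = 0" unfolding b by algebra
  have c2: "r^2 = -2*r-2" using c by algebra
  have c3: "r^3 = 2*r+4"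
  proof -
    have "r^3 = r*r^2" by algebra
    also have "\<dots> = r*(-2*r-2)" unfolding c2 ..
    also have "\<dots> = -2*r^2-2*r" by algebra
    finally show ?thesis unfolding c2 by algebra
  qed
  have c4: "r^4 = -2*r-1" using a unfolding c2 by simp
  have c5: "r^5 = 3*r+4"
  proof -
    have "r^5 = r*r^4" by algebra
    also have "\<dots> = r*(-2*r-1)" unfolding c4 ..
    also have "\<dots> = -2*r^2-r" by algebra
    finally show ?thesis unfolding c2 by algebra
  qed
  have d: "5*r+7 = 0" using b unfolding c2 c3 by algebra
  have H2: "r = 13" using H unfolding c2 c3 c4 c5 by algebra
  have "(72::'a) = 0" using d unfolding H2 by simp
  then have "(2::'a)*2*2*3*3 = 0" by simp
  then show False using two three by (metis mult_eq_0_iff)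
qed

text \<open>\<open>E1\<close> to \<open>E3\<close> are the degree 2 equations of the three sides;
  \<open>F1\<close> to \<open>F3\<close> are the degree 3 equations, two per side because each side
  has two removed points. Distinct parameters obey the pair relation, three distinct ones would obey
  too many, and so two parameters coincide.\<close>

lemma cyclic_system_inconsistent:
  fixes p q r :: "'a::field"
  assumes E1: "q\<^sup>2*(2+p+r) = -1" and E2: "r\<^sup>2*(2+p+q) = -1" and E3: "p\<^sup>2*(2+q+r) = -1"
    and F1: "q^3*(p-1)*(p+1)\<^sup>2 - p*(p-1) = q^3*(p*r*(p*r-1))"
            "q^3*(r-1)*(r+1)\<^sup>2 - r*(r-1) = q^3*(p*r*(p*r-1))"
    and F2: "r^3*(q-1)*(q+1)\<^sup>2 - q*(q-1) = r^3*(q*p*(q*p-1))"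
            "r^3*(p-1)*(p+1)\<^sup>2 - p*(p-1) = r^3*(q*p*(q*p-1))"
    and F3: "p^3*(r-1)*(r+1)\<^sup>2 - r*(r-1) = p^3*(r*q*(r*q-1))"
            "p^3*(q-1)*(q+1)\<^sup>2 - q*(q-1) = p^3*(r*q*(r*q-1))"
    and nz: "p \<noteq> 0" "q \<noteq> 0" "r \<noteq> 0" and n1: "p \<noteq> 1" "q \<noteq> 1" "r \<noteq> 1"
    and inv: "p*r \<noteq> 1" "q*p \<noteq> 1" "r*q \<noteq> 1" and three: "(3::'a) \<noteq> 0"
  shows False
proof -
  have pair: "(x+y)*(1-x*y) = 1" if "x \<noteq> y" "x*y \<noteq> 1" "x \<noteq> 0" "y \<noteq> 0" "z \<noteq> 0"
    "z^3*(x-1)*(x+1)\<^sup>2 - x*(x-1) = z^3*(x*y*(x*y-1))"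
    "z^3*(y-1)*(y+1)\<^sup>2 - y*(y-1) = z^3*(x*y*(x*y-1))" for x y z :: 'a
  proof (rule cyclic_system_pair[where w = "1/z^3"])
    show "(x-1)*((x+1)\<^sup>2 - x*(1/z^3)) = x*y*(x*y-1)" "(y-1)*((y+1)\<^sup>2 - y*(1/z^3)) = x*y*(x*y-1)"
      using that by (simp_all add: field_simps)
  qed (use that in auto)
  have pr: "p \<noteq> r \<Longrightarrow> (p+r)*(1-p*r) = 1" using pair[of p r q] F1 nz inv by auto
  have qp: "q \<noteq> p \<Longrightarrow> (q+p)*(1-q*p) = 1" using pair[of q p r] F2 nz inv by auto
  have rq: "r \<noteq> q \<Longrightarrow> (r+q)*(1-r*q) = 1" using pair[of r q p] F3 nz inv by auto
  have "p = r \<or> q = p \<or> r = q"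
  proof (rule ccontr)
    assume *: "\<not> ?thesis"
    have s: "(p+r)*(1-p*r) = 1" "(q+p)*(1-q*p) = 1" "(r+q)*(1-r*q) = 1" using pr qp rq * by auto
    \<comment> \<open>Differences of pair relations show that \<open>p\<close> and \<open>q\<close>
      are both inverse to \<open>p + q + r\<close>, contrary to \<open>p \<noteq> q\<close>.\<close>
    have "(r - q)*(1 - p*(p+q+r)) = 0" using s(1,2) by algebra
    then have 1: "1 - p*(p+q+r) = 0" using * by auto
    have "(r - p)*(1 - q*(p+q+r)) = 0" using s(2,3) by algebra
    then have 2: "1 - q*(p+q+r) = 0" using * by auto
    have 3: "(p - q)*(p+q+r) = 0" using 1 2 by algebra
    then have "p+q+r = 0" using * by auto
    then show False using 1 by auto
  qed
  moreover have False if "p = q" "q = r" using cyclic_system_all_equal[of r] that E1 F1 nz n1 by auto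
  moreover have False if "r = q" "p \<noteq> r" using cyclic_system_two_equal[of r p] that E1 E2 E3 F3 pr nz n1 three by auto
  moreover have False if "p = r" "q \<noteq> p" using cyclic_system_two_equal[of p q] that E1 E2 E3 F1 qp nz n1 three
    by (auto simp: algebra_simps)
  moreover have False if "q = p" "r \<noteq> q" using cyclic_system_two_equal[of q r] that E1 E2 E3 F2 rq nz n1 three
    by (auto simp: algebra_simps)
  ultimately show False by blast
qed

section \<open>Polynomial system of the overlap pattern\<close>

text \<open>\<open>E1\<close> to \<open>E3\<close> are the degree 2 equations of the three sides
  after normalization. Eliminating \<open>a1\<close> from the first two gives
  \<open>2 * (g^3 + 1) = 0\<close>. In characteristic 2 this is void, but there \<open>E3\<close> is
  the square of a linear relation, which replaces it.\<close>

lemma overlap_system_cube: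
  fixes w g a1 b1 a2 b2 :: "'a::field"
  assumes w: "w\<^sup>2 + w + 1 = 0" and k: "k = w \<or> k = w\<^sup>2"
    and p1: "a1*b1*g = -1" and p2: "a2*w\<^sup>2*(g*k) = -1" and p3: "w\<^sup>2*b2*(g*k\<^sup>2) = -1"
    and E1: "a1*g\<^sup>2 + a2*(g*k)\<^sup>2 + w\<^sup>2*(g*k\<^sup>2)\<^sup>2 + 1 + w*w\<^sup>2 = 0"
    and E2: "b1*a1\<^sup>2 + w\<^sup>2*a2\<^sup>2 + b2*(w\<^sup>2)\<^sup>2 + 1 + w*w\<^sup>2 = 0"
    and E3: "g*b1\<^sup>2 + g*k*(w\<^sup>2)\<^sup>2 + g*k\<^sup>2*b2\<^sup>2 - 1 - w*w\<^sup>2 = 0"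
  shows "g^3 = -1"
proof -
  have w3: "w^3 = 1" using w by algebra
  have "(w\<^sup>2)^3 = 1" using w3 by algebra
  then have k3: "k^3 = 1" using k w3 by blast
  have q2: "a2*g = -w*k\<^sup>2" using p2 w3 k3 by algebra
  have q3: "b2*g = -w*k" using p3 w3 k3 by algebra
  have F1: "a1*g\<^sup>2 - w*g*k + w\<^sup>2*k*g\<^sup>2 + 2 = 0"
  proof -
    have "a2*(g*k)\<^sup>2 = -(w*g*k)" using q2 k3 by algebra
    moreover have "w\<^sup>2*(g*k\<^sup>2)\<^sup>2 = w\<^sup>2*k*g\<^sup>2" using k3 by algebra
    moreover have "w*w\<^sup>2 = 1" using w3 by algebra
    ultimately show ?thesis using E1 by algebra
  qed
  have F2: "a1*g = w*k - w\<^sup>2*k*g + 2*g\<^sup>2"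
  proof -
    have "g\<^sup>2*(b1*a1\<^sup>2) = -(a1*g)" using p1 by algebra
    moreover have "g\<^sup>2*(w\<^sup>2*a2\<^sup>2) = w*k" using q2 w3 k3 by algebra
    moreover have "g\<^sup>2*(b2*(w\<^sup>2)\<^sup>2) = -(w\<^sup>2*k*g)" using q3 w3 by algebra
    moreover have "w*w\<^sup>2 = 1" using w3 by algebra
    moreover have "g\<^sup>2*(b1*a1\<^sup>2) + g\<^sup>2*(w\<^sup>2*a2\<^sup>2) + g\<^sup>2*(b2*(w\<^sup>2)\<^sup>2) + g\<^sup>2 + g\<^sup>2*(w*w\<^sup>2) = 0"
      using E2 by algebra
    ultimately show ?thesis by algebra
  qed
  have "2*(g^3+1) = 0" using F1 F2 by algebra
  then consider "g^3+1 = 0" | "(2::'a) = 0" by (metis mult_eq_0_iff)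
  then show ?thesis
  proof cases
    case 1 then show ?thesis by (simp add: eq_neg_iff_add_eq_0)
  next
    case 2
    define i where "i = b1*g"
    have i: "a1*i = -1" using p1 by (simp add: i_def algebra_simps)
    have sq: "(x + y + z)\<^sup>2 = x\<^sup>2 + y\<^sup>2 + z\<^sup>2" for x y z :: 'a
    proof -
      have "(x + y + z)\<^sup>2 = x\<^sup>2 + y\<^sup>2 + z\<^sup>2 + 2*(x*y+x*z+y*z)" by algebra
      then show ?thesis using 2 by simp
    qed
    have F3: "i\<^sup>2 + k*w*g\<^sup>2 + w\<^sup>2*k = 2*g"
    proof -
      have "g*(g*b1\<^sup>2) = i\<^sup>2" by (simp add: i_def power2_eq_square)
      moreover have "g*(g*k*(w\<^sup>2)\<^sup>2) = k*w*g\<^sup>2" using w3 by algebra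
      moreover have "g*(g*k\<^sup>2*b2\<^sup>2) = w\<^sup>2*k" using q3 k3 by algebra
      moreover have "w*w\<^sup>2 = 1" using w3 by algebra
      moreover have "g*(g*b1\<^sup>2) + g*(g*k*(w\<^sup>2)\<^sup>2) + g*(g*k\<^sup>2*b2\<^sup>2) - g - g*(w*w\<^sup>2) = 0"
        using E3 by algebra
      ultimately show ?thesis by algebra
    qed
    have "g\<^sup>2*w + g + w\<^sup>2 = 0" using k
    proof
      assume k: "k = w"
      have "i\<^sup>2 + 1 + (g*w)\<^sup>2 = 2*g" using w3 F3 unfolding k by algebra
      then have j: "i + 1 + g*w = 0" using 2 sq[of i 1 "g*w"] by simp
      have "a1*g = w\<^sup>2 - g + 2*g\<^sup>2" using w3 F2 unfolding k by algebra
      then have l: "a1*g = w\<^sup>2 - g" using 2 by simp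
      have "(w\<^sup>2 - g)*(1+g*w) = g" using j i l by algebra
      then have "w\<^sup>2 + g*w^3 - g - g\<^sup>2*w = g"
        by (simp add: algebra_simps power2_eq_square power3_eq_cube)
      then have "g\<^sup>2*w + g - w\<^sup>2 = 0" unfolding w3 by (simp add: algebra_simps)
      moreover have "g\<^sup>2*w + g + w\<^sup>2 = (g\<^sup>2*w + g - w\<^sup>2) + 2*w\<^sup>2" by algebra
      ultimately show ?thesis using 2 by simp
    next
      assume k: "k = w\<^sup>2"
      have "i\<^sup>2 + (w\<^sup>2)\<^sup>2 + g\<^sup>2 = 2*g" using w3 F3 unfolding k by algebra
      then have j: "i + w\<^sup>2 + g = 0" using 2 sq[of i "w\<^sup>2" g] by simp
      have "a1*g = 1 - w*g + 2*g\<^sup>2" using w3 F2 unfolding k by algebra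
      then have l: "a1*g = 1 - w*g" using 2 by simp
      have "(1 - w*g)*(w\<^sup>2+g) = g" using j i l by algebra
      then have "w\<^sup>2 + g - w^3*g - w*g\<^sup>2 = g"
        by (simp add: algebra_simps power2_eq_square power3_eq_cube)
      then have "g\<^sup>2*w + g - w\<^sup>2 = 0" unfolding w3 by (simp add: algebra_simps)
      moreover have "g\<^sup>2*w + g + w\<^sup>2 = (g\<^sup>2*w + g - w\<^sup>2) + 2*w\<^sup>2" by algebra
      ultimately show ?thesis using 2 by simp
    qed
    \<comment> \<open>Divided by \<open>w\<^sup>2\<close>, the equation says that \<open>g*w\<close>
      is a root of \<open>t\<^sup>2 + t + 1\<close>, hence has cube 1.\<close>
    then have "g^3 = 1" using w3 w by algebra
    then show ?thesis using 2 by (simp add: eq_neg_iff_add_eq_0)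
  qed
qed

section \<open>Ratio equations of the equal pattern\<close>

text \<open>Seen from the removed point with parameter \<open>a2\<close>, the point
  \<open>(a1, b1, c1)\<close> has one of the five required values. Three of them would force
  \<open>a1 = a2\<close> or a zero coordinate; the remaining two differ only by a sign when
  expressed in ratios.\<close>

lemma ratio_relation:
  fixes a1 :: "'a::field"
  assumes "a1*b1*c1 = -1" "a2*b2*c2 = -1" "a1 \<noteq> a2"
    and "inverse b1 + a2*c1 \<in> {0, inverse b1, inverse b2, a2*c1, a2*c2}"
  shows "a1/a2 - 1 = a1/a2 * (b1/b2) \<or> a1/a2 - 1 = - (a1/a2 * (b1/b2))"
proof -
  have nz: "a1 \<noteq> 0" "b1 \<noteq> 0" "c1 \<noteq> 0" "a2 \<noteq> 0" "b2 \<noteq> 0" "c2 \<noteq> 0" using assms(1,2) by auto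
  have c: "c1 = - 1/(a1*b1)" "c2 = - 1/(a2*b2)" using assms(1,2) nz by (simp_all add: field_simps)
  have x: "inverse b1 + a2*c1 = (a1 - a2)/(a1*b1)" using nz by (simp add: c field_simps)
  consider "(a1-a2)/(a1*b1) = 0" | "inverse b1 + a2*c1 = inverse b1" | "(a1-a2)/(a1*b1) = inverse b2"
    | "inverse b1 + a2*c1 = a2*c1" | "(a1-a2)/(a1*b1) = a2*c2" using assms(4) x by auto
  then show ?thesis
  proof cases
    case 3
    then show ?thesis using nz by (simp add: field_simps)
  next
    case 5
    then have "(a1-a2)*b2 = -(a1*b1)" using nz by (simp add: c field_simps)
    moreover have "a1/a2 - 1 = ((a1-a2)*b2)/(a2*b2)" using nz by (simp add: field_simps)
    ultimately have "a1/a2 - 1 = - (a1/a2 * (b1/b2))" by simp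
    then show ?thesis by blast
  qed (use nz assms(3) in auto)
qed

text \<open>Squaring removes the undetermined signs and shows that the three ratios agree up to
  sign. In odd characteristic each ratio would satisfy \<open>x\<^sup>2 = x - 1\<close>, hence have
  cube -1; but then all three are equal, and their product 1 gives cube 1.\<close>

lemma ratio_system_char_2:
  fixes t f u :: "'a::field"
  assumes prod: "t*f*u = 1"
    and 1: "t - 1 = t*f \<or> t - 1 = -(t*f)" "f - 1 = f*u \<or> f - 1 = -(f*u)" "u - 1 = u*t \<or> u - 1 = -(u*t)"
    and 2: "f*(t-1) = 1 \<or> f*(t-1) = -1" "u*(f-1) = 1 \<or> u*(f-1) = -1" "t*(u-1) = 1 \<or> t*(u-1) = -1"
    and ne: "t \<noteq> 1" "f \<noteq> 1" "u \<noteq> 1"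
  shows "(2::'a) = 0 \<and> t = f \<and> f = u"
proof -
  have nz: "t \<noteq> 0" "f \<noteq> 0" "u \<noteq> 0" using prod by auto
  have s: "y = z \<or> y = -z" if "x*y*z = 1" "x - 1 = x*y \<or> x - 1 = -(x*y)" "y*(x-1) = 1 \<or> y*(x-1) = -1"
    for x y z :: 'a
  proof -
    have "(x-1)\<^sup>2 = (x*y)\<^sup>2" using that(2) by (metis power2_minus)
    moreover have "(y*(x-1))\<^sup>2 = 1" using that(3) by (metis one_power2 power2_minus)
    ultimately have "(x*y*y)\<^sup>2 = 1" by algebra
    then have "x*y*y = 1 \<or> x*y*y = -1" by (simp add: power2_eq_1_iff)
    then have "x*y*(y - z) = 0 \<or> x*y*(y+z) = 0" using that(1) by (auto simp: algebra_simps)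
    then show ?thesis using that(1) by (auto simp: eq_neg_iff_add_eq_0)
  qed
  have 3: "f = u \<or> f = -u" using s[of t f u] prod 1 2 by auto
  have 4: "u = t \<or> u = -t" using s[of f u t] prod 1 2 by (auto simp: algebra_simps)
  have sq: "x\<^sup>2 = x - 1 \<or> (2::'a) = 0" if "x \<noteq> 1" "x \<noteq> 0" "y = x \<or> y = -x" "z = x \<or> z = -x"
     "x*y*z = 1" "x - 1 = x*y \<or> x - 1 = -(x*y)" for x y z :: 'a
  proof -
    have "x - 1 = x\<^sup>2 \<or> x - 1 = -x\<^sup>2" using that(3,6) by (auto simp: power2_eq_square)
    moreover have "x^3 = 1 \<or> x^3 = -1" using that(3,4,5) by (auto simp: power3_eq_cube minus_equation_iff)
    moreover have ?thesis if a: "x - 1 = -x\<^sup>2" "x^3 = 1"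
    proof -
      have "2*(x-1) = 0" using a by algebra
      then show ?thesis using \<open>x \<noteq> 1\<close> by auto
    qed
    moreover have ?thesis if a: "x - 1 = -x\<^sup>2" "x^3 = -1"
    proof -
      have "2*x = 0" using a by algebra
      then show ?thesis using \<open>x \<noteq> 0\<close> by auto
    qed
    ultimately show ?thesis by metis
  qed
  have two: "(2::'a) = 0"
  proof (rule ccontr)
    assume n: "(2::'a) \<noteq> 0"
    have r: "f = t \<or> f = -t" "u = f \<or> u = -f" "t = f \<or> t = -f" "t = u \<or> t = -u"
      using 3 4 by (metis minus_minus)+
    have c: "f*u*t = 1" "u*t*f = 1" using prod by (auto simp: algebra_simps)
    have a: "t\<^sup>2 = t - 1" using sq[OF ne(1) nz(1) r(1) 4 prod 1(1)] n by blast
    have b: "f\<^sup>2 = f - 1" using sq[OF ne(2) nz(2) r(2,3) c(1) 1(2)] n by blast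
    have c: "u\<^sup>2 = u - 1" using sq[OF ne(3) nz(3) r(4) 3 c(2) 1(3)] n by blast
    have "f = u" using 3 b c by (metis add_diff_cancel_right' diff_add_cancel power2_minus)
    moreover have "u = t" using 4 a c by (metis add_diff_cancel_right' diff_add_cancel power2_minus)
    ultimately have "t^3 = 1" using prod by (simp add: power3_eq_cube)
    moreover have "t^3 = -1" using a by algebra
    ultimately have "(1::'a) + 1 = 0" by simp
    then show False using n by simp
  qed
  have neg: "- x = x" for x :: 'a
    using two by (metis add_eq_0_iff mult_2 mult_zero_left)
  show ?thesis using two 3 4 neg by auto
qed

section \<open>Residual values and coefficient comparison in tight pencils\<close>

lemma card_5_pairE:
  assumes "card M = 5" "x \<in> M" "y \<in> M" "x \<noteq> y"
  obtains m1 m2 m3 where "distinct [x,y,m1,m2,m3]" "M = {x,y,m1,m2,m3}"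
proof -
  have "finite M" using assms by (metis card.infinite zero_neq_numeral)
  then have "card (M - {x,y}) = 3" using assms by (simp add: card_Diff_subset)
  then obtain m1 m2 m3 where "M - {x,y} = {m1,m2,m3}" "m1 \<noteq> m2" "m2 \<noteq> m3" "m1 \<noteq> m3"
    by (metis card_3_iff)
  then have "distinct [x,y,m1,m2,m3]" "M = {x,y,m1,m2,m3}" using assms by auto
  then show thesis by (rule that)
qed

text \<open>Once the two points with values in \<open>C\<close> are cancelled, three values remain
  whose sum and sum of inverses vanish. Clearing denominators turns the latter into the second
  symmetric function, so the three values are the roots of some \<open>X^3 - c\<close>.\<close>

lemma residual_values:
  fixes f :: "'m \<Rightarrow> 'a::field"
  assumes M: "card M = 5" and C: "card C = 2" and hit: "\<And>c. c \<in> C \<Longrightarrow> card {m\<in>M. f m = c} = 1"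
    and nz: "\<And>m. m \<in> M \<Longrightarrow> f m \<noteq> 0"
    and s: "(\<Sum>m\<in>M. f m) = (\<Sum>c\<in>C. c)" and si: "(\<Sum>m\<in>M. inverse (f m)) = (\<Sum>c\<in>C. inverse c)"
  obtains m1 m2 m3 m4 m5 where "distinct [m1,m2,m3,m4,m5]" "M = {m1,m2,m3,m4,m5}"
    "C = {f m1, f m2}" "f m1 \<noteq> f m2" "f m3 \<notin> C" "f m4 \<notin> C" "f m5 \<notin> C"
    "f m3 + f m4 + f m5 = 0" "f m3 * f m4 + f m3 * f m5 + f m4 * f m5 = 0"
proof -
  obtain c1 c2 where c: "C = {c1,c2}" "c1 \<noteq> c2" using C by (meson card_2_iff)
  obtain m1 where m1: "{m\<in>M. f m = c1} = {m1}" using hit[of c1] c by (auto simp: card_1_singleton_iff)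
  obtain m2 where m2: "{m\<in>M. f m = c2} = {m2}" using hit[of c2] c by (auto simp: card_1_singleton_iff)
  have mm: "m1 \<in> M" "m2 \<in> M" "f m1 = c1" "f m2 = c2" using m1 m2 by blast+
  then have "m1 \<noteq> m2" using c by auto
  then obtain m3 m4 m5 where d: "distinct [m1,m2,m3,m4,m5]" "M = {m1,m2,m3,m4,m5}"
    using card_5_pairE M mm by metis
  have h: "m = m1 \<or> m = m2" if "m \<in> M" "f m \<in> C" for m using m1 m2 c(1) that by blast
  have o: "f m3 \<notin> C" "f m4 \<notin> C" "f m5 \<notin> C" using h[of m3] h[of m4] h[of m5] d by force+
  have 1: "f m3 + f m4 + f m5 = 0" using s d c mm by (simp add: add.assoc)
  have "inverse (f m3) + inverse (f m4) + inverse (f m5) = 0" using si d c mm by (simp add: add.assoc)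
  then have 2: "f m3 * f m4 + f m3 * f m5 + f m4 * f m5 = 0"
    using nz d by (simp add: field_simps)
  show thesis using d _ _ o 1 2 by (rule that) (use c mm in auto)
qed

lemma count_image_mset_set:
  assumes "finite M"
  shows "count (image_mset f (mset_set M)) y = card {m\<in>M. f m = y}"
proof -
  have "f -` {y} \<inter> M = {m\<in>M. f m = y}" by auto
  then show ?thesis using assms by (simp add: count_image_mset)
qed

text \<open>
  The value \<open>inverse (be m) + a * ga m\<close> is the parameter \<open>t\<close> of the line \<open>t x + a y + z = 0\<close> joining the side point
  \<open>(0 : 1 : -a)\<close> to \<open>m\<close>. That line passes through the opposite vertex if \<open>t = 0\<close>, and otherwise
  through the side points with parameters \<open>b = 1/t\<close> and \<open>c = t/a\<close>.
\<close>

definition tight_pencil :: "'m set \<Rightarrow> 'a::field set \<Rightarrow> 'a set \<Rightarrow> 'a set \<Rightarrow> ('m \<Rightarrow> 'a) \<Rightarrow> ('m \<Rightarrow> 'a) \<Rightarrow> bool" where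
  "tight_pencil M A B C be ga \<longleftrightarrow> (\<forall>a\<in>A. image_mset (\<lambda>m. inverse (be m) + a * ga m) (mset_set M)
     = {#0#} + image_mset inverse (mset_set B) + image_mset ((*) a) (mset_set C))"

text \<open>The sums of the two multisets are polynomials of degree 1 in the centre
  \<open>a\<close>; they agree at two centres, hence coefficientwise.\<close>

lemma tight_pencil_sums:
  assumes "tight_pencil M A B C be ga" "card A = 2"
  shows "(\<Sum>m\<in>M. inverse (be m)) = (\<Sum>b\<in>B. inverse b)" "(\<Sum>m\<in>M. ga m) = (\<Sum>c\<in>C. c)"
proof -
  let ?u = "\<Sum>m\<in>M. inverse (be m)" and ?v = "\<Sum>b\<in>B. inverse b"
    and ?g = "\<Sum>m\<in>M. ga m" and ?c = "\<Sum>c\<in>C. c"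
  have *: "(?u - ?v) + (?g - ?c) * a = 0" if "a \<in> A" for a
  proof -
    have "sum_mset (image_mset (\<lambda>m. inverse (be m) + a * ga m) (mset_set M))
      = sum_mset ({#0#} + image_mset inverse (mset_set B) + image_mset ((*) a) (mset_set C))"
      using assms that by (simp add: tight_pencil_def)
    then have "(\<Sum>m\<in>M. inverse (be m) + a * ga m) = ?v + (\<Sum>c\<in>C. a * c)"
      by (simp add: sum_unfold_sum_mset)
    then have "?u + a * ?g = ?v + a * ?c" by (simp only: sum.distrib sum_distrib_left)
    then show ?thesis by (simp add: algebra_simps)
  qed
  obtain a1 a2 where a: "A = {a1,a2}" "a1 \<noteq> a2" using assms(2) by (meson card_2_iff)
  have "?u - ?v = 0" using linear_two_roots[of "?u - ?v" "?g - ?c" a1 a2] * a by auto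
  moreover have "a1 \<noteq> 0 \<or> a2 \<noteq> 0" using a by auto
  ultimately show "?u = ?v" "?g = ?c" using *[of a1] *[of a2] a by auto
qed

lemma mset_set_5: "distinct [m1,m2,m3,m4,m5] \<Longrightarrow> mset_set {m1,m2,m3,m4,m5} = {#m1,m2,m3,m4,m5#}"
  by (simp add: add_mset_commute)

text \<open>The residual values enter the symmetric functions up to degree 3 only through their
  product.\<close>

lemma symmetric_functions_residual:
  fixes x1 :: "'a::field"
  assumes "x3+x4+x5 = 0" "x3*x4+x3*x5+x4*x5 = 0"
  shows "x1+x2+x3+x4+x5 = x1+x2"
    and "x1*x2+x1*x3+x1*x4+x1*x5+x2*x3+x2*x4+x2*x5+x3*x4+x3*x5+x4*x5 = x1*x2"
    and "x1*x2*x3+x1*x2*x4+x1*x2*x5+x1*x3*x4+x1*x3*x5+x1*x4*x5+x2*x3*x4+x2*x3*x5+x2*x4*x5+x3*x4*x5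
      = x3*x4*x5"
proof -
  have "x1+x2+x3+x4+x5 = x1+x2+(x3+x4+x5)" by (simp add: algebra_simps)
  then show "x1+x2+x3+x4+x5 = x1+x2" using assms by simp
  have "x1*x2+x1*x3+x1*x4+x1*x5+x2*x3+x2*x4+x2*x5+x3*x4+x3*x5+x4*x5
     = x1*x2 + (x1+x2)*(x3+x4+x5) + (x3*x4+x3*x5+x4*x5)" by (simp add: algebra_simps)
  then show "x1*x2+x1*x3+x1*x4+x1*x5+x2*x3+x2*x4+x2*x5+x3*x4+x3*x5+x4*x5 = x1*x2" using assms by simp
  have "x1*x2*x3+x1*x2*x4+x1*x2*x5+x1*x3*x4+x1*x3*x5+x1*x4*x5+x2*x3*x4+x2*x3*x5+x2*x4*x5+x3*x4*x5
     = x1*x2*(x3+x4+x5) + (x1+x2)*(x3*x4+x3*x5+x4*x5) + x3*x4*x5" by (simp add: algebra_simps)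
  then show "x1*x2*x3+x1*x2*x4+x1*x2*x5+x1*x3*x4+x1*x3*x5+x1*x4*x5+x2*x3*x4+x2*x3*x5+x2*x4*x5+x3*x4*x5
      = x3*x4*x5" using assms by simp
qed

text \<open>In degree 2 the constant and quadratic terms in \<open>a\<close> agree on both sides, so
  the mixed sum is 0 as soon as one centre is nonzero. In degree 3 this vanishing is used once more;
  what remains is a cubic in \<open>a\<close> whose outer coefficients come from the products of the
  residual values of \<open>be\<close> and \<open>ga\<close>.\<close>

lemma tight_pencil_moments:
  fixes be ga :: "'m \<Rightarrow> 'a::field"
  assumes sd: "tight_pencil M A B C be ga"
    and m: "distinct [m1,m2,m3,m4,m5]" "M = {m1,m2,m3,m4,m5}" "C = {ga m1, ga m2}" "ga m1 \<noteq> ga m2"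
      "ga m3 + ga m4 + ga m5 = 0" "ga m3 * ga m4 + ga m3 * ga m5 + ga m4 * ga m5 = 0"
    and n: "distinct [n1,n2,n3,n4,n5]" "M = {n1,n2,n3,n4,n5}" "B = {be n1, be n2}" "be n1 \<noteq> be n2"
      "be n3 + be n4 + be n5 = 0" "be n3 * be n4 + be n3 * be n5 + be n4 * be n5 = 0"
    and nz: "\<And>m. m \<in> M \<Longrightarrow> be m \<noteq> 0" and a: "a \<in> A" "a \<noteq> 0"
  shows "(\<Sum>m\<in>M. inverse (be m) * ga m) = 0"
    and "inverse (be n3 * be n4 * be n5) + a * (\<Sum>m\<in>M. (inverse (be m))\<^sup>2 * ga m)
       + a\<^sup>2 * (\<Sum>m\<in>M. inverse (be m) * (ga m)\<^sup>2) + a^3 * (ga m3 * ga m4 * ga m5) = 0"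
proof -
  define u1 u2 u3 u4 u5 where u: "u1 = inverse (be m1)" "u2 = inverse (be m2)" "u3 = inverse (be m3)"
    "u4 = inverse (be m4)" "u5 = inverse (be m5)"
  define g1 g2 g3 g4 g5 where g: "g1 = ga m1" "g2 = ga m2" "g3 = ga m3" "g4 = ga m4" "g5 = ga m5"
  define h1 h2 h3 h4 h5 where h: "h1 = inverse (be n1)" "h2 = inverse (be n2)" "h3 = inverse (be n3)"
    "h4 = inverse (be n4)" "h5 = inverse (be n5)"
  have bz: "be n1 \<noteq> 0" "be n2 \<noteq> 0" "be n3 \<noteq> 0" "be n4 \<noteq> 0" "be n5 \<noteq> 0" using nz n(2) by auto
  have vs: "h3 + h4 + h5 = 0" "h3*h4 + h3*h5 + h4*h5 = 0"
    using n(5,6) bz by (simp_all add: h field_simps)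
  have gs: "g3 + g4 + g5 = 0" "g3*g4 + g3*g5 + g4*g5 = 0" using m(5,6) by (simp_all add: g)
  \<comment> \<open>\<open>M\<close> is listed in two orders, one adapted to \<open>C\<close> and
    one to \<open>B\<close>. The multiset of inverse values does not depend on the order, which
    transfers the symmetric functions from one list to the other.\<close>
  have uv: "{#u1,u2,u3,u4,u5#} = {#h1,h2,h3,h4,h5#}"
  proof -
    have "image_mset (\<lambda>m. inverse (be m)) (mset_set {m1,m2,m3,m4,m5})
      = image_mset (\<lambda>m. inverse (be m)) (mset_set {n1,n2,n3,n4,n5})"
      using m(2) n(2) by metis
    then show ?thesis using m(1) n(1) unfolding mset_set_5[OF m(1)] mset_set_5[OF n(1)] by (simp add: u h)
  qed
  have e1u: "u1+u2+u3+u4+u5 = h1+h2"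
    unfolding symmetric_functions_5(1)[OF uv] by (rule symmetric_functions_residual[OF vs])
  have e2u: "u1*u2+u1*u3+u1*u4+u1*u5+u2*u3+u2*u4+u2*u5+u3*u4+u3*u5+u4*u5 = h1*h2"
    unfolding symmetric_functions_5(2)[OF uv] by (rule symmetric_functions_residual[OF vs])
  have e3u: "u1*u2*u3+u1*u2*u4+u1*u2*u5+u1*u3*u4+u1*u3*u5+u1*u4*u5+u2*u3*u4+u2*u3*u5+u2*u4*u5+u3*u4*u5
     = h3*h4*h5"
    unfolding symmetric_functions_5(3)[OF uv] by (rule symmetric_functions_residual[OF vs])
  have e1g: "g1+g2+g3+g4+g5 = g1+g2" by (rule symmetric_functions_residual[OF gs])
  have e2g: "g1*g2+g1*g3+g1*g4+g1*g5+g2*g3+g2*g4+g2*g5+g3*g4+g3*g5+g4*g5 = g1*g2" by (rule symmetric_functions_residual[OF gs])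
  have e3g: "g1*g2*g3+g1*g2*g4+g1*g2*g5+g1*g3*g4+g1*g3*g5+g1*g4*g5+g2*g3*g4+g2*g3*g5+g2*g4*g5+g3*g4*g5
     = g3*g4*g5" by (rule symmetric_functions_residual[OF gs])
  have mu: "{#u1+a*g1,u2+a*g2,u3+a*g3,u4+a*g4,u5+a*g5#} = {#0,h1,h2,a*g1,a*g2#}"
  proof -
    have "image_mset (\<lambda>m. inverse (be m) + a * ga m) (mset_set {m1,m2,m3,m4,m5})
     = {#0#} + image_mset inverse (mset_set {be n1, be n2}) + image_mset ((*) a) (mset_set {ga m1, ga m2})"
      using sd a m(2,3) n(3) by (auto simp: tight_pencil_def)
    then show ?thesis using m(4) n(4) unfolding mset_set_5[OF m(1)] by (simp add: u h g add_mset_commute)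
  qed
  let ?S = "u1*g1+u2*g2+u3*g3+u4*g4+u5*g5"
  let ?T = "u1\<^sup>2*g1+u2\<^sup>2*g2+u3\<^sup>2*g3+u4\<^sup>2*g4+u5\<^sup>2*g5"
  let ?U = "u1*g1\<^sup>2+u2*g2\<^sup>2+u3*g3\<^sup>2+u4*g4\<^sup>2+u5*g5\<^sup>2"
  let ?e1 = "\<lambda>x1 x2 x3 x4 x5. x1+x2+x3+x4+x5 :: 'a"
  let ?e2 = "\<lambda>x1 x2 x3 x4 x5. x1*x2+x1*x3+x1*x4+x1*x5+x2*x3+x2*x4+x2*x5+x3*x4+x3*x5+x4*x5 :: 'a"
  let ?e3 = "\<lambda>x1 x2 x3 x4 x5. x1*x2*x3+x1*x2*x4+x1*x2*x5+x1*x3*x4+x1*x3*x5+x1*x4*x5+x2*x3*x4+x2*x3*x5+x2*x4*x5+x3*x4*x5 :: 'a"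
  have "?e2 (u1+a*g1) (u2+a*g2) (u3+a*g3) (u4+a*g4) (u5+a*g5)
    = ?e2 u1 u2 u3 u4 u5 + a * (?e1 u1 u2 u3 u4 u5 * ?e1 g1 g2 g3 g4 g5 - ?S) + a\<^sup>2 * ?e2 g1 g2 g3 g4 g5"
    by (simp add: algebra_simps power2_eq_square)
  then have "h1*h2 + a*((h1+h2)*(g1+g2) - ?S) + a\<^sup>2*(g1*g2) = ?e2 0 h1 h2 (a*g1) (a*g2)"
    unfolding symmetric_functions_5(2)[OF mu] e1u e2u e1g e2g by simp
  then have "a * ?S = 0" by (simp add: algebra_simps power2_eq_square)
  then have S: "?S = 0" using a by simp
  then show "(\<Sum>m\<in>M. inverse (be m) * ga m) = 0" using m(1) unfolding m(2) by (simp add: u g add.assoc)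
  have "?e3 (u1+a*g1) (u2+a*g2) (u3+a*g3) (u4+a*g4) (u5+a*g5)
    = ?e3 u1 u2 u3 u4 u5 + a * (?e2 u1 u2 u3 u4 u5 * ?e1 g1 g2 g3 g4 g5 - ?e1 u1 u2 u3 u4 u5 * ?S + ?T)
      + a\<^sup>2 * (?e2 g1 g2 g3 g4 g5 * ?e1 u1 u2 u3 u4 u5 - ?e1 g1 g2 g3 g4 g5 * ?S + ?U) + a^3 * ?e3 g1 g2 g3 g4 g5"
    by (simp add: algebra_simps power2_eq_square power3_eq_cube)
  then have "h3*h4*h5 + a*(h1*h2*(g1+g2) - (h1+h2)*?S + ?T) + a\<^sup>2*(g1*g2*(h1+h2) - (g1+g2)*?S + ?U) + a^3*(g3*g4*g5)
      = ?e3 0 h1 h2 (a*g1) (a*g2)"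
    unfolding symmetric_functions_5(3)[OF mu] e1u e2u e1g e2g e3u e3g by simp
  then have "h3*h4*h5 + a*?T + a\<^sup>2*?U + a^3*(g3*g4*g5) = 0"
    unfolding S by (simp add: algebra_simps power2_eq_square)
  then show "inverse (be n3 * be n4 * be n5) + a * (\<Sum>m\<in>M. (inverse (be m))\<^sup>2 * ga m)
       + a\<^sup>2 * (\<Sum>m\<in>M. inverse (be m) * (ga m)\<^sup>2) + a^3 * (ga m3 * ga m4 * ga m5) = 0"
    using m(1) unfolding m(2) by (simp add: u g h add.assoc)
qed

text \<open>A diagonal change of coordinates multiplies the parameters of the three sides by factors
  with product 1, and all pencil values by \<open>inverse t\<close>.\<close>

lemma tight_pencil_scale:
  assumes "tight_pencil M A' B' C' f g" "s * t * r = 1"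
  shows "tight_pencil M ((*) s ` A') ((*) t ` B') ((*) r ` C') (\<lambda>m. t * f m) (\<lambda>m. r * g m)"
  unfolding tight_pencil_def
proof safe
  fix a assume a: "a \<in> A'"
  have nz: "s \<noteq> 0" "t \<noteq> 0" "r \<noteq> 0" using assms(2) by auto
  have t: "inverse t = s * r" using assms(2) nz by (simp add: field_simps)
  have "image_mset (\<lambda>m. inverse (t * f m) + s * a * (r * g m)) (mset_set M)
     = image_mset ((*) (inverse t)) (image_mset (\<lambda>m. inverse (f m) + a * g m) (mset_set M))"
    by (simp add: multiset.map_comp o_def t algebra_simps inverse_mult_distrib)
  also have "\<dots> = image_mset ((*) (inverse t)) ({#0#} + image_mset inverse (mset_set B') + image_mset ((*) a) (mset_set C'))"
    using assms(1) a by (simp add: tight_pencil_def)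
  also have "\<dots> = {#0#} + image_mset inverse (image_mset ((*) t) (mset_set B'))
      + image_mset ((*) (s * a)) (image_mset ((*) r) (mset_set C'))"
    by (simp add: multiset.map_comp o_def t algebra_simps inverse_mult_distrib)
  also have "image_mset ((*) t) (mset_set B') = mset_set ((*) t ` B')"
    by (rule image_mset_mset_set) (simp add: nz inj_on_def)
  also have "image_mset ((*) r) (mset_set C') = mset_set ((*) r ` C')"
    by (rule image_mset_mset_set) (simp add: nz inj_on_def)
  finally show "image_mset (\<lambda>m. inverse (t * f m) + s * a * (r * g m)) (mset_set M)
    = {#0#} + image_mset inverse (mset_set ((*) t ` B')) + image_mset ((*) (s * a)) (mset_set ((*) r ` C'))" .
qed

section \<open>The case of two removed points on each side\<close>

text \<open>Of the plane only the three values of each point of \<open>M\<close> are kept. The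
  hypotheses are stable under the cyclic shift of \<open>al\<close>, \<open>be\<close>,
  \<open>ga\<close>, so that every fact is proved for one side and transported by
  \<open>rotate\<close>.\<close>

locale balanced =
  fixes M :: "'m set" and al be ga :: "'m \<Rightarrow> 'a::field" and A B C :: "'a set"
  assumes card_M: "card M = 5"
    and card_A: "card A = 2" and card_B: "card B = 2" and card_C: "card C = 2"
    and zero_A: "0 \<notin> A" and zero_B: "0 \<notin> B" and zero_C: "0 \<notin> C"
    and prod: "\<And>m. m \<in> M \<Longrightarrow> al m * be m * ga m = -1"
    and inj: "\<And>m n. m \<in> M \<Longrightarrow> n \<in> M \<Longrightarrow> al m = al n \<Longrightarrow> be m = be n \<Longrightarrow> m = n"
    and side_a: "tight_pencil M A B C be ga" and side_b: "tight_pencil M B C A ga al" and side_c: "tight_pencil M C A B al be"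
begin

lemma nonzero: "m \<in> M \<Longrightarrow> al m \<noteq> 0" "m \<in> M \<Longrightarrow> be m \<noteq> 0" "m \<in> M \<Longrightarrow> ga m \<noteq> 0"
  using prod[of m] by auto

lemma finite_M: "finite M" using card_M by (metis card.infinite zero_neq_numeral)

lemma finite_B: "finite B" and finite_C: "finite C"
  using card_B card_C by (metis card.infinite zero_neq_numeral)+

lemma rotate: "balanced M be ga al B C A"
proof
  show "m = n" if "m \<in> M" "n \<in> M" "be m = be n" "ga m = ga n" for m n
  proof -
    have "al m * (be m * ga m) = al n * (be m * ga m)" using prod[of m] prod[of n] that by (simp add: mult.assoc)
    then show ?thesis using inj that nonzero by simp
  qed
  show "be m * ga m * al m = -1" if "m \<in> M" for m using prod[OF that] by (simp add: algebra_simps)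
qed (use card_M card_A card_B card_C zero_A zero_B zero_C side_a side_b side_c in auto)

lemma inverse_be: "m \<in> M \<Longrightarrow> inverse (be m) = - (al m * ga m)"
  using prod[of m] nonzero[of m] by (simp add: field_simps)

text \<open>A point has pencil value 0 from \<open>a\<close> exactly if \<open>al m = a\<close>,
  that is, if its line to \<open>a\<close> passes through the opposite vertex. As 0 is neither in
  \<open>B\<close> nor in \<open>C\<close>, the tight pencil contains the value 0 once.\<close>

lemma hit_once:
  assumes "a \<in> A"
  shows "card {m\<in>M. al m = a} = 1"
proof -
  have a0: "a \<noteq> 0" using assms zero_A by auto
  have "count (image_mset (\<lambda>m. inverse (be m) + a * ga m) (mset_set M)) 0
     = count ({#0#} + image_mset inverse (mset_set B) + image_mset ((*) a) (mset_set C)) 0"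
    using side_a assms by (simp add: tight_pencil_def)
  also have "\<dots> = 1" using zero_B zero_C a0
    by (auto simp: count_eq_zero_iff finite_B finite_C)
  finally have "card {m\<in>M. inverse (be m) + a * ga m = 0} = 1"
    by (simp add: count_image_mset_set finite_M)
  moreover have "{m\<in>M. inverse (be m) + a * ga m = 0} = {m\<in>M. al m = a}"
    using nonzero by (auto simp: inverse_be algebra_simps)
  ultimately show ?thesis by simp
qed

lemma hit_unique: "m \<in> M \<Longrightarrow> n \<in> M \<Longrightarrow> al m \<in> A \<Longrightarrow> al m = al n \<Longrightarrow> m = n"
proof -
  assume m: "m \<in> M" "n \<in> M" "al m \<in> A" "al m = al n"
  then obtain x where "{k\<in>M. al k = al m} = {x}" using hit_once[of "al m"] by (auto simp: card_1_singleton_iff)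
  then show "m = n" using m by (metis (mono_tags, lifting) mem_Collect_eq singletonD)
qed

text \<open>The information on \<open>al\<close> comes from the two other sides: centres in
  \<open>B\<close> give the sum of its values, centres in \<open>C\<close> the sum of their
  inverses.\<close>

lemma residual_al:
  obtains m1 m2 m3 m4 m5 where "distinct [m1,m2,m3,m4,m5]" "M = {m1,m2,m3,m4,m5}"
    "A = {al m1, al m2}" "al m1 \<noteq> al m2" "al m3 \<notin> A" "al m4 \<notin> A" "al m5 \<notin> A"
    "al m3 + al m4 + al m5 = 0" "al m3 * al m4 + al m3 * al m5 + al m4 * al m5 = 0"
  using residual_values[of M A al, OF card_M card_A hit_once nonzero(1)
      tight_pencil_sums(2)[OF side_b card_B] tight_pencil_sums(1)[OF side_c card_C]] by metis

lemma card_nonresidual: "card {m\<in>M. al m \<in> A} = 2"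
proof -
  obtain m1 m2 m3 m4 m5 where "distinct [m1,m2,m3,m4,m5]" "M = {m1,m2,m3,m4,m5}"
    "A = {al m1, al m2}" "al m3 \<notin> A" "al m4 \<notin> A" "al m5 \<notin> A" by (rule residual_al) blast
  then have "{m\<in>M. al m \<in> A} = {m1,m2}" "m1 \<noteq> m2" by auto
  then show ?thesis by simp
qed

lemma residual_pair:
  assumes "m \<in> M" "n \<in> M" "m \<noteq> n" "al m \<notin> A" "al n \<notin> A"
  shows "(al m)\<^sup>2 + al m * al n + (al n)\<^sup>2 = 0"
proof -
  obtain m1 m2 m3 m4 m5 where *: "M = {m1,m2,m3,m4,m5}" "A = {al m1, al m2}"
    "al m3 + al m4 + al m5 = 0" "al m3 * al m4 + al m3 * al m5 + al m4 * al m5 = 0"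
    by (rule residual_al) blast
  have q: "x\<^sup>2 + x*y + y\<^sup>2 = 0" if "x + y + z = 0" "x*y + x*z + y*z = 0" for x y z :: 'a
    using that by algebra
  have "(al m3)\<^sup>2 + al m3 * al m4 + (al m4)\<^sup>2 = 0" "(al m3)\<^sup>2 + al m3 * al m5 + (al m5)\<^sup>2 = 0"
    "(al m4)\<^sup>2 + al m4 * al m5 + (al m5)\<^sup>2 = 0"
    using q[of "al m3" "al m4" "al m5"] q[of "al m3" "al m5" "al m4"] q[of "al m4" "al m5" "al m3"] *(3,4)
    by (simp_all add: algebra_simps)
  moreover have "m \<in> {m3,m4,m5}" "n \<in> {m3,m4,m5}" using assms *(1,2) by auto
  ultimately show ?thesis using assms(3) by (auto simp: algebra_simps)
qed

lemma residual_sum: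
  assumes "m \<in> M" "n \<in> M" "k \<in> M" "distinct [m,n,k]" "al m \<notin> A" "al n \<notin> A" "al k \<notin> A"
  shows "al m + al n + al k = 0"
proof -
  obtain m1 m2 m3 m4 m5 where *: "M = {m1,m2,m3,m4,m5}" "A = {al m1, al m2}"
    "al m3 + al m4 + al m5 = 0" by (rule residual_al) blast
  have "m \<in> {m3,m4,m5}" "n \<in> {m3,m4,m5}" "k \<in> {m3,m4,m5}" using assms *(1,2) by auto
  then show ?thesis using assms(4) *(3) by (auto simp: algebra_simps)
qed

lemma residual_cube:
  assumes "m \<in> M" "n \<in> M" "al m \<notin> A" "al n \<notin> A"
  shows "(al m)^3 = (al n)^3"
proof (cases "m = n")
  case False
  then have "(al m)\<^sup>2 + al m * al n + (al n)\<^sup>2 = 0" using residual_pair[of m n] assms by simp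
  then show ?thesis by algebra
qed simp

text \<open>The residual values are all roots of \<open>X^3 - c\<close>, counted with multiplicity;
  an element of \<open>A\<close> with the same cube would be one of them.\<close>

lemma nonresidual_cube:
  assumes "a \<in> A" "n \<in> M" "al n \<notin> A"
  shows "a^3 \<noteq> (al n)^3"
proof
  assume e: "a^3 = (al n)^3"
  obtain m1 m2 m3 m4 m5 where *: "M = {m1,m2,m3,m4,m5}" "A = {al m1, al m2}"
     "al m3 \<notin> A" "al m4 \<notin> A" "al m5 \<notin> A"
    "al m3 + al m4 + al m5 = 0" "al m3 * al m4 + al m3 * al m5 + al m4 * al m5 = 0"
    by (rule residual_al) blast
  have "a^3 = (al m3)^3" using residual_cube[of n m3] assms e *(1,3) by simp
  moreover have "(al m3)^3 = al m3 * al m4 * al m5" using *(6,7) by algebra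
  moreover have "(a - al m3) * (a - al m4) * (a - al m5)
     = a^3 - a\<^sup>2 * (al m3 + al m4 + al m5) + a * (al m3 * al m4 + al m3 * al m5 + al m4 * al m5) - al m3 * al m4 * al m5"
    by (simp add: algebra_simps power2_eq_square power3_eq_cube)
  ultimately have "(a - al m3) * (a - al m4) * (a - al m5) = 0" using *(6,7) by simp
  then show False using assms(1) *(3-5) by auto
qed

text \<open>These are the identities of \<open>tight_pencil_moments\<close> after substituting
  \<open>- (al m * ga m)\<close> for \<open>inverse (be m)\<close>. The product of the three
  residual values equals the cube of each, so any residual \<open>n\<close> and \<open>k\<close> may
  represent the outer coefficients.\<close>

lemma moment_2: "(\<Sum>m\<in>M. al m * (ga m)\<^sup>2) = 0"
  and moment_3: "a \<in> A \<Longrightarrow> n \<in> M \<Longrightarrow> be n \<notin> B \<Longrightarrow> k \<in> M \<Longrightarrow> ga k \<notin> C \<Longrightarrow>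
     inverse ((be n)^3) + a * (\<Sum>m\<in>M. (al m)\<^sup>2 * (ga m)^3) - a\<^sup>2 * (\<Sum>m\<in>M. al m * (ga m)^3)
      + a^3 * (ga k)^3 = 0"
proof -
  interpret b: balanced M be ga al B C A by (rule rotate)
  interpret c: balanced M ga al be C A B by (rule b.rotate)
  obtain m1 m2 m3 m4 m5 where m: "distinct [m1,m2,m3,m4,m5]" "M = {m1,m2,m3,m4,m5}" "C = {ga m1, ga m2}" "ga m1 \<noteq> ga m2"
      "ga m3 + ga m4 + ga m5 = 0" "ga m3 * ga m4 + ga m3 * ga m5 + ga m4 * ga m5 = 0"
      and mC: "ga m3 \<notin> C" by (rule c.residual_al) blast
  obtain n1 n2 n3 n4 n5 where n: "distinct [n1,n2,n3,n4,n5]" "M = {n1,n2,n3,n4,n5}" "B = {be n1, be n2}" "be n1 \<noteq> be n2"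
      "be n3 + be n4 + be n5 = 0" "be n3 * be n4 + be n3 * be n5 + be n4 * be n5 = 0"
      and nB: "be n3 \<notin> B" by (rule b.residual_al) blast
  note mom = tight_pencil_moments[OF side_a m n nonzero(2)]
  have s1: "(\<Sum>m\<in>M. inverse (be m) * ga m) = - (\<Sum>m\<in>M. al m * (ga m)\<^sup>2)"
    by (simp add: sum_negf[symmetric] inverse_be power2_eq_square mult.assoc cong: sum.cong)
  have s2: "(\<Sum>m\<in>M. (inverse (be m))\<^sup>2 * ga m) = (\<Sum>m\<in>M. (al m)\<^sup>2 * (ga m)^3)"
    by (rule sum.cong[OF refl]) (simp add: inverse_be power2_eq_square power3_eq_cube)
  have s3: "(\<Sum>m\<in>M. inverse (be m) * (ga m)\<^sup>2) = - (\<Sum>m\<in>M. al m * (ga m)^3)"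
    unfolding sum_negf[symmetric]
    by (rule sum.cong[OF refl]) (simp add: inverse_be power2_eq_square power3_eq_cube)
  obtain a0 where "a0 \<in> A" using card_A by fastforce
  then show "(\<Sum>m\<in>M. al m * (ga m)\<^sup>2) = 0" using mom(1)[of a0] s1 zero_A by auto
  assume a: "a \<in> A" and nn: "n \<in> M" "be n \<notin> B" and k: "k \<in> M" "ga k \<notin> C"
  have "be n3 * be n4 * be n5 = (be n3)^3" using n(5,6) by algebra
  also have "\<dots> = (be n)^3" using b.residual_cube[of n3 n] nB n(2) nn by auto
  finally have 1: "be n3 * be n4 * be n5 = (be n)^3" .
  have "ga m3 * ga m4 * ga m5 = (ga m3)^3" using m(5,6) by algebra
  also have "\<dots> = (ga k)^3" using c.residual_cube[of m3 k] mC m(2) k by auto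
  finally have 2: "ga m3 * ga m4 * ga m5 = (ga k)^3" .
  have "a \<noteq> 0" using a zero_A by auto
  from mom(2)[OF _ a this] show "inverse ((be n)^3) + a * (\<Sum>m\<in>M. (al m)\<^sup>2 * (ga m)^3) - a\<^sup>2 * (\<Sum>m\<in>M. al m * (ga m)^3)
      + a^3 * (ga k)^3 = 0" unfolding s2 s3 1 2 by simp
qed

text \<open>In characteristic 3 the form \<open>x\<^sup>2 + x*y + y\<^sup>2\<close> is
  \<open>(x - y)\<^sup>2\<close>, so residual values coincide, and points residual in two
  coordinates could not be told apart.\<close>

lemma three_nonzero:
  assumes "m \<in> M" "n \<in> M" "m \<noteq> n" "al m \<notin> A" "al n \<notin> A" "be m \<notin> B" "be n \<notin> B"
  shows "(3::'a) \<noteq> 0"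
proof
  interpret b: balanced M be ga al B C A by (rule rotate)
  assume 3: "(3::'a) = 0"
  have *: "x = y" if "x\<^sup>2 + x*y + y\<^sup>2 = 0" for x y :: 'a
  proof -
    have "(x - y)\<^sup>2 = (x\<^sup>2 + x*y + y\<^sup>2) - 3*(x*y)" by algebra
    then show ?thesis using that 3 by simp
  qed
  have "al m = al n" "be m = be n" using * residual_pair b.residual_pair assms by blast+
  then show False using inj assms by blast
qed

lemma residual_neq:
  assumes "(3::'a) \<noteq> 0" "m \<in> M" "n \<in> M" "m \<noteq> n" "al m \<notin> A" "al n \<notin> A"
  shows "al m \<noteq> al n"
proof
  assume e: "al m = al n"
  then have "3 * (al n)\<^sup>2 = 0" using residual_pair[of m n] assms by (simp add: power2_eq_square)
  then show False using assms nonzero by simp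
qed

lemma tight_pencil_member:
  assumes "m \<in> M" "a \<in> A"
  shows "inverse (be m) + a * ga m = 0 \<or> inverse (be m) + a * ga m \<in> inverse ` B \<or> inverse (be m) + a * ga m \<in> (*) a ` C"
proof -
  have "inverse (be m) + a * ga m \<in># image_mset (\<lambda>m. inverse (be m) + a * ga m) (mset_set M)"
    using assms finite_M by simp
  also have "image_mset (\<lambda>m. inverse (be m) + a * ga m) (mset_set M) = {#0#} + image_mset inverse (mset_set B) + image_mset ((*) a) (mset_set C)"
    using side_a assms by (simp add: tight_pencil_def)
  finally show ?thesis by (auto simp: finite_B finite_C)
qed

text \<open>The condition \<open>s * t * r = 1\<close> leaves two factors free, enough to make two
  chosen coordinates equal to 1 in each pattern.\<close>

lemma scale:
  assumes s: "s * t * r = 1"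
  shows "balanced M (\<lambda>m. s * al m) (\<lambda>m. t * be m) (\<lambda>m. r * ga m) ((*) s ` A) ((*) t ` B) ((*) r ` C)"
proof
  have nz: "s \<noteq> 0" "t \<noteq> 0" "r \<noteq> 0" using s by auto
  have i: "inj_on ((*) x) X" if "x \<noteq> 0" for x :: 'a and X using that by (simp add: inj_on_def)
  show "card ((*) s ` A) = 2" "card ((*) t ` B) = 2" "card ((*) r ` C) = 2"
    using card_image[OF i] nz card_A card_B card_C by auto
  show "0 \<notin> (*) s ` A" "0 \<notin> (*) t ` B" "0 \<notin> (*) r ` C" using nz zero_A zero_B zero_C by auto
  show "m = n" if "m \<in> M" "n \<in> M" "s * al m = s * al n" "t * be m = t * be n" for m n
    using inj that nz by simp
  show "s * al m * (t * be m) * (r * ga m) = -1" if "m \<in> M" for m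
  proof -
    have "s * al m * (t * be m) * (r * ga m) = (s * t * r) * (al m * be m * ga m)" by (simp add: algebra_simps)
    then show ?thesis using s prod[OF that] by simp
  qed
  show "tight_pencil M ((*) s ` A) ((*) t ` B) ((*) r ` C) (\<lambda>m. t * be m) (\<lambda>m. r * ga m)"
    using tight_pencil_scale[OF side_a s] by simp
  show "tight_pencil M ((*) t ` B) ((*) r ` C) ((*) s ` A) (\<lambda>m. r * ga m) (\<lambda>m. s * al m)"
    using tight_pencil_scale[OF side_b, of t r s] s by (simp add: algebra_simps)
  show "tight_pencil M ((*) r ` C) ((*) s ` A) ((*) t ` B) (\<lambda>m. s * al m) (\<lambda>m. t * be m)"
    using tight_pencil_scale[OF side_c, of r s t] s by (simp add: algebra_simps)
qed (rule card_M)

text \<open>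
  A value of \<open>al\<close> outside \<open>A\<close> (of \<open>be\<close> outside \<open>B\<close>, of \<open>ga\<close> outside \<open>C\<close>) is called residual. In the
  three patterns below the pairs of points with non-residual \<open>al\<close>, \<open>be\<close>, \<open>ga\<close> are
  \<open>{m1,m2}, {m1,m3}, {m4,m5}\<close> (overlap), \<open>{m1,m2}\<close> three times (equal), and
  \<open>{m1,m3}, {m1,m2}, {m2,m3}\<close> (cyclic).
\<close>

lemma no_overlap_pattern_normalized:
  assumes m: "distinct [m1,m2,m3,m4,m5]" "M = {m1,m2,m3,m4,m5}"
    and N: "al m2 \<in> A" "be m2 \<notin> B" "ga m2 \<notin> C" "ga m1 \<notin> C"
      "al m3 \<notin> A" "ga m3 \<notin> C" "al m4 \<notin> A" "be m4 \<notin> B" "ga m4 \<in> C"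
      "al m5 \<notin> A" "be m5 \<notin> B"
    and one: "al m4 = 1" "be m4 = 1"
  shows False
proof -
  interpret b: balanced M be ga al B C A by (rule rotate)
  interpret c: balanced M ga al be C A B by (rule b.rotate)
  have mem: "m1 \<in> M" "m2 \<in> M" "m3 \<in> M" "m4 \<in> M" "m5 \<in> M" using m(2) by auto
  have ne: "m1 \<noteq> m2" "m1 \<noteq> m3" "m1 \<noteq> m4" "m1 \<noteq> m5" "m2 \<noteq> m3" "m2 \<noteq> m4" "m2 \<noteq> m5" "m3 \<noteq> m4" "m3 \<noteq> m5" "m4 \<noteq> m5"
    using m(1) by auto
  define w where "w = al m5"
  have w: "w\<^sup>2 + w + 1 = 0" using residual_pair[OF mem(4,5) ne(10) N(7,10)] one
    by (simp add: w_def algebra_simps)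
  have w3: "w^3 = 1" using w by algebra
  have roots: "t = w \<or> t = w\<^sup>2" if "t\<^sup>2 + t + 1 = 0" for t
  proof -
    have "(t - w) * (t - w\<^sup>2) = 0" using that w by algebra
    then show ?thesis by auto
  qed
  have al3: "al m3 = w\<^sup>2"
  proof -
    have "al m3 + al m4 + al m5 = 0" using residual_sum[OF mem(3,4,5)] ne N by simp
    then show ?thesis using w one unfolding w_def by algebra
  qed
  have ga4: "ga m4 = -1" using prod[OF mem(4)] one by simp
  have "(be m5)\<^sup>2 + be m5 + 1 = 0" using b.residual_pair[OF mem(4,5) ne(10) N(8,11)] one
    by (simp add: algebra_simps)
  \<comment> \<open>Otherwise \<open>ga m5 = ga m4\<close>, but this value lies in \<open>C\<close>
    and is attained only once.\<close>
  moreover have "be m5 \<noteq> w\<^sup>2"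
  proof
    assume "be m5 = w\<^sup>2"
    then have "w^3 * ga m5 = -1" using prod[OF mem(5)] w_def by (simp add: power2_eq_square power3_eq_cube mult.assoc)
    then have "ga m4 = ga m5" using w3 ga4 by simp
    then show False using c.hit_unique[OF mem(4,5) N(9)] ne by simp
  qed
  ultimately have be5: "be m5 = w" using roots by blast
  have ga5: "ga m5 = -w"
    using prod[OF mem(5)] w3 unfolding be5 w_def[symmetric] by algebra
  have be2: "be m2 = w\<^sup>2"
  proof -
    have "be m2 + be m4 + be m5 = 0" using b.residual_sum[OF mem(2,4,5)] ne N by simp
    then show ?thesis using w one be5 by algebra
  qed
  define g where "g = ga m1"
  have g0: "g \<noteq> 0" using nonzero mem g_def by simp
  define k where "k = ga m2 / g"
  have ga2: "ga m2 = g * k" using g0 by (simp add: k_def)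
  have "g\<^sup>2 + g * (g*k) + (g*k)\<^sup>2 = 0" using c.residual_pair[OF mem(1,2) ne(1) N(4,3)] ga2 g_def by simp
  then have "g\<^sup>2 * (k\<^sup>2 + k + 1) = 0" by algebra
  then have kk: "k\<^sup>2 + k + 1 = 0" using g0 by simp
  then have k: "k = w \<or> k = w\<^sup>2" by (rule roots)
  have ga3: "ga m3 = g * k\<^sup>2"
  proof -
    have "ga m1 + ga m2 + ga m3 = 0" using c.residual_sum[OF mem(1,2,3)] ne N by simp
    then show ?thesis using kk unfolding ga2 g_def[symmetric] by algebra
  qed
  have sum5: "(\<Sum>m\<in>M. f m) = f m1 + f m2 + f m3 + f m4 + f m5" for f :: "'m \<Rightarrow> 'a"
    using m by (simp add: add.assoc)
  have p: "al m1 * be m1 * g = -1" "al m2 * w\<^sup>2 * (g*k) = -1" "w\<^sup>2 * be m3 * (g*k\<^sup>2) = -1"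
    using prod[OF mem(1)] prod[OF mem(2)] prod[OF mem(3)] g_def be2 ga2 al3 ga3 by simp_all
  have "g^3 = -1"
  proof (rule overlap_system_cube[OF w k p])
    show "al m1 * g\<^sup>2 + al m2 * (g*k)\<^sup>2 + w\<^sup>2*(g*k\<^sup>2)\<^sup>2 + 1 + w*w\<^sup>2 = 0"
      using moment_2 unfolding sum5 al3 ga2 ga3 ga4 ga5 one w_def[symmetric] g_def[symmetric] by simp
    show "be m1 * (al m1)\<^sup>2 + w\<^sup>2 * (al m2)\<^sup>2 + be m3 * (w\<^sup>2)\<^sup>2 + 1 + w*w\<^sup>2 = 0"
      using b.moment_2 unfolding sum5 al3 be2 be5 one w_def[symmetric] by simp
    show "g * (be m1)\<^sup>2 + g*k*(w\<^sup>2)\<^sup>2 + g*k\<^sup>2*(be m3)\<^sup>2 - 1 - w*w\<^sup>2 = 0"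
      using c.moment_2 unfolding sum5 be2 be5 ga2 ga3 ga4 ga5 one g_def[symmetric] by simp
  qed
  moreover have "k^3 = 1" using kk by algebra
  \<comment> \<open>So \<open>al m2\<close>, an element of \<open>A\<close>, has the same cube as
    the residual value \<open>al m4 = 1\<close>.\<close>
  ultimately have "(al m2)^3 = 1" using p(2) w3 by algebra
  then show False using nonresidual_cube[OF N(1) mem(4) N(7)] one by simp
qed

lemma no_overlap_pattern:
  assumes m: "distinct [m1,m2,m3,m4,m5]" "M = {m1,m2,m3,m4,m5}"
    and N: "al m2 \<in> A" "be m2 \<notin> B" "ga m2 \<notin> C" "ga m1 \<notin> C"
      "al m3 \<notin> A" "ga m3 \<notin> C" "al m4 \<notin> A" "be m4 \<notin> B" "ga m4 \<in> C"
      "al m5 \<notin> A" "be m5 \<notin> B"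
  shows False
proof -
  have nz: "al m4 \<noteq> 0" "be m4 \<noteq> 0" using nonzero m(2) by auto
  define s t r where str: "s = inverse (al m4)" "t = inverse (be m4)" "r = al m4 * be m4"
  have nz': "s \<noteq> 0" "t \<noteq> 0" "r \<noteq> 0" using nz by (auto simp: str)
  have i: "x * y \<in> (*) x ` X \<longleftrightarrow> y \<in> X" if "x \<noteq> 0" for x y :: 'a and X using that by auto
  interpret n: balanced M "\<lambda>m. s * al m" "\<lambda>m. t * be m" "\<lambda>m. r * ga m" "(*) s ` A" "(*) t ` B" "(*) r ` C"
    by (rule scale) (use nz in \<open>simp add: str field_simps\<close>)
  show False by (rule n.no_overlap_pattern_normalized[OF m]) (use N nz nz' in \<open>simp_all add: i, simp_all add: str\<close>)
qed

text \<open>After normalization the residual points are completely known, and only \<open>m1\<close>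
  and \<open>m2\<close> are free. Each is viewed from the removed points belonging to the other; the
  resulting ratio system forces characteristic 2 and equal contributions of \<open>m1\<close> and
  \<open>m2\<close> to \<open>moment_2\<close>. What is left of that sum is 3, which is
  nonzero.\<close>

lemma no_equal_pattern_normalized:
  assumes m: "distinct [m1,m2,m3,m4,m5]" "M = {m1,m2,m3,m4,m5}"
    and N: "A = {al m1, al m2}" "B = {be m1, be m2}" "C = {ga m1, ga m2}"
      "al m3 \<notin> A" "al m4 \<notin> A" "al m5 \<notin> A" "be m3 \<notin> B" "be m4 \<notin> B" "be m5 \<notin> B"
      "ga m3 \<notin> C" "ga m4 \<notin> C" "ga m5 \<notin> C"
    and one: "al m3 = 1" "be m3 = 1"
  shows False
proof -
  interpret b: balanced M be ga al B C A by (rule rotate)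
  interpret c: balanced M ga al be C A B by (rule b.rotate)
  have mem: "m1 \<in> M" "m2 \<in> M" "m3 \<in> M" "m4 \<in> M" "m5 \<in> M" using m(2) by auto
  have ne: "m1 \<noteq> m2" "m3 \<noteq> m4" "m3 \<noteq> m5" "m4 \<noteq> m5" using m(1) by auto
  have three: "(3::'a) \<noteq> 0" using three_nonzero[OF mem(3,4) ne(2) N(4,5,7,8)] .
  define w where "w = al m4"
  have w: "w\<^sup>2 + w + 1 = 0" using residual_pair[OF mem(3,4) ne(2) N(4,5)] one
    by (simp add: w_def algebra_simps)
  have w3: "w^3 = 1" using w by algebra
  have roots: "t = w \<or> t = w\<^sup>2" if "t\<^sup>2 + t + 1 = 0" for t
  proof -
    have "(t - w) * (t - w\<^sup>2) = 0" using that w by algebra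
    then show ?thesis by auto
  qed
  have al5: "al m5 = w\<^sup>2"
  proof -
    have "al m3 + al m4 + al m5 = 0" using residual_sum[OF mem(3,4,5)] ne N by simp
    then show ?thesis using w one unfolding w_def by algebra
  qed
  have ga3: "ga m3 = -1" using prod[OF mem(3)] one by simp
  have "(be m4)\<^sup>2 + be m4 + 1 = 0" using b.residual_pair[OF mem(3,4) ne(2) N(7,8)] one
    by (simp add: algebra_simps)
  moreover have "be m4 \<noteq> w\<^sup>2"
  proof
    assume "be m4 = w\<^sup>2"
    then have "w^3 * ga m4 = -1" using prod[OF mem(4)] w_def by (simp add: power2_eq_square power3_eq_cube mult.assoc)
    then have "ga m3 = ga m4" using w3 ga3 by simp
    then show False using c.residual_neq[OF three mem(3,4) ne(2) N(10,11)] by simp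
  qed
  ultimately have be4: "be m4 = w" using roots by blast
  have ga4: "ga m4 = -w"
    using prod[OF mem(4)] w3 unfolding be4 w_def[symmetric] by algebra
  have ga5: "ga m5 = - (w\<^sup>2)"
  proof -
    have "ga m3 + ga m4 + ga m5 = 0" using c.residual_sum[OF mem(3,4,5)] ne N by simp
    then show ?thesis using w ga3 ga4 by algebra
  qed
  have pr: "al m1 * be m1 * ga m1 = -1" "al m2 * be m2 * ga m2 = -1"
     "be m1 * ga m1 * al m1 = -1" "be m2 * ga m2 * al m2 = -1"
     "ga m1 * al m1 * be m1 = -1" "ga m2 * al m2 * be m2 = -1"
    using prod[OF mem(1)] prod[OF mem(2)] by (auto simp: algebra_simps)
  have nz: "al m1 \<noteq> 0" "be m1 \<noteq> 0" "ga m1 \<noteq> 0" "al m2 \<noteq> 0" "be m2 \<noteq> 0" "ga m2 \<noteq> 0"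
    using nonzero mem by auto
  have d: "al m1 \<noteq> al m2" "be m1 \<noteq> be m2" "ga m1 \<noteq> ga m2"
    using hit_unique[OF mem(1,2)] b.hit_unique[OF mem(1,2)] c.hit_unique[OF mem(1,2)] N(1-3) ne(1) by auto
  define t f u where tfu: "t = al m1 / al m2" "f = be m1 / be m2" "u = ga m1 / ga m2"
  have tfu1: "t * f * u = 1" using pr(1,2) nz by (simp add: tfu field_simps)
  \<comment> \<open>Exchanging \<open>m1\<close> and \<open>m2\<close> inverts the ratios; this
    expresses the outcome in the original ratios again.\<close>
  have flip: "f*(t-1) = 1 \<or> f*(t-1) = -1"
    if "1/t - 1 = 1/t * (1/f) \<or> 1/t - 1 = - (1/t * (1/f))" "t \<noteq> 0" "f \<noteq> 0" for t f :: 'a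
  proof -
    have "t*f*(1/t - 1) = 1 \<or> t*f*(1/t - 1) = -1" using that by auto
    moreover have "t*f*(1/t - 1) = - (f*(t-1))" using that by (simp add: field_simps)
    ultimately show ?thesis by (metis minus_minus)
  qed
  have inv: "1/t = al m2 / al m1" "1/f = be m2 / be m1" "1/u = ga m2 / ga m1" by (simp_all add: tfu)
  have nz': "t \<noteq> 0" "f \<noteq> 0" "u \<noteq> 0" using tfu1 by auto
  have r: "t - 1 = t*f \<or> t - 1 = - (t*f)" "f - 1 = f*u \<or> f - 1 = -(f*u)" "u - 1 = u*t \<or> u - 1 = -(u*t)"
    using ratio_relation[OF pr(1,2) d(1)] ratio_relation[OF pr(3,4) d(2)] ratio_relation[OF pr(5,6) d(3)]
      tight_pencil_member[OF mem(1), of "al m2"] b.tight_pencil_member[OF mem(1), of "be m2"] c.tight_pencil_member[OF mem(1), of "ga m2"]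
    unfolding tfu N(1-3) by auto
  have r': "f*(t-1) = 1 \<or> f*(t-1) = -1" "u*(f-1) = 1 \<or> u*(f-1) = -1" "t*(u-1) = 1 \<or> t*(u-1) = -1"
    using ratio_relation[OF pr(2,1) d(1)[symmetric]] ratio_relation[OF pr(4,3) d(2)[symmetric]] ratio_relation[OF pr(6,5) d(3)[symmetric]]
      tight_pencil_member[OF mem(2), of "al m1"] b.tight_pencil_member[OF mem(2), of "be m1"] c.tight_pencil_member[OF mem(2), of "ga m1"]
      flip[of t f] flip[of f u] flip[of u t] nz'
    unfolding inv N(1-3) by auto
  have "(2::'a) = 0 \<and> t = f \<and> f = u"
    using ratio_system_char_2[OF tfu1 r r'] d nz by (auto simp: tfu)
  then have 2: "(2::'a) = 0" and tu: "t * u\<^sup>2 = 1" using tfu1 by (auto simp: power2_eq_square mult.assoc)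
  have "al m1 * (ga m1)\<^sup>2 = al m2 * (ga m2)\<^sup>2 * (t * u\<^sup>2)"
    using nz by (simp add: tfu field_simps power2_eq_square)
  then have x: "al m1 * (ga m1)\<^sup>2 = al m2 * (ga m2)\<^sup>2" using tu by simp
  have sum5: "(\<Sum>m\<in>M. f m) = f m1 + f m2 + f m3 + f m4 + f m5" for f :: "'m \<Rightarrow> 'a"
    using m by (simp add: add.assoc)
  have "2 * (al m2 * (ga m2)\<^sup>2) + (1 + w*w\<^sup>2 + w\<^sup>2*(w\<^sup>2)\<^sup>2) = 0"
    using moment_2 unfolding sum5 al5 ga3 ga4 ga5 one w_def[symmetric] x by (simp add: add.assoc)
  moreover have "w*w\<^sup>2 = 1" "w\<^sup>2*(w\<^sup>2)\<^sup>2 = 1" using w3 by algebra+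
  ultimately show False using 2 three by simp
qed

lemma no_equal_pattern:
  assumes m: "distinct [m1,m2,m3,m4,m5]" "M = {m1,m2,m3,m4,m5}"
    and N: "A = {al m1, al m2}" "B = {be m1, be m2}" "C = {ga m1, ga m2}"
      "al m3 \<notin> A" "al m4 \<notin> A" "al m5 \<notin> A" "be m3 \<notin> B" "be m4 \<notin> B" "be m5 \<notin> B"
      "ga m3 \<notin> C" "ga m4 \<notin> C" "ga m5 \<notin> C"
  shows False
proof -
  have nz: "al m3 \<noteq> 0" "be m3 \<noteq> 0" using nonzero m(2) by auto
  define s t r where str: "s = inverse (al m3)" "t = inverse (be m3)" "r = al m3 * be m3"
  have nz': "s \<noteq> 0" "t \<noteq> 0" "r \<noteq> 0" using nz by (auto simp: str)
  have i: "x * y \<in> (*) x ` X \<longleftrightarrow> y \<in> X" if "x \<noteq> 0" for x y :: 'a and X using that by auto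
  interpret n: balanced M "\<lambda>m. s * al m" "\<lambda>m. t * be m" "\<lambda>m. r * ga m" "(*) s ` A" "(*) t ` B" "(*) r ` C"
    by (rule scale) (use nz in \<open>simp add: str field_simps\<close>)
  have N': "(*) s ` A = {s * al m1, s * al m2}" "(*) t ` B = {t * be m1, t * be m2}" "(*) r ` C = {r * ga m1, r * ga m2}"
    using N by auto
  show False by (rule n.no_equal_pattern_normalized[OF m N'])
     (use N(4-) nz nz' in \<open>simp_all only: i not_False_eq_True simp_thms, simp_all add: str\<close>)
qed

text \<open>Three parameters survive normalization here. Degree 2 gives one equation per side and
  degree 3 one per removed point, together the nine equations of
  \<open>cyclic_system_inconsistent\<close>.\<close>

lemma no_cyclic_pattern_normalized:
  assumes m: "distinct [m1,m2,m3,m4,m5]" "M = {m1,m2,m3,m4,m5}"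
    and N: "A = {al m1, al m3}" "B = {be m1, be m2}" "C = {ga m2, ga m3}"
      "ga m1 \<notin> C" "al m2 \<notin> A" "be m3 \<notin> B"
      "al m4 \<notin> A" "be m4 \<notin> B" "ga m4 \<notin> C" "al m5 \<notin> A" "be m5 \<notin> B" "ga m5 \<notin> C"
    and one: "al m2 = 1" "be m3 = 1"
  shows False
proof -
  interpret b: balanced M be ga al B C A by (rule rotate)
  interpret c: balanced M ga al be C A B by (rule b.rotate)
  have mem: "m1 \<in> M" "m2 \<in> M" "m3 \<in> M" "m4 \<in> M" "m5 \<in> M" using m(2) by auto
  have ne: "m1 \<noteq> m2" "m1 \<noteq> m3" "m2 \<noteq> m3" "m1 \<noteq> m4" "m2 \<noteq> m4" "m3 \<noteq> m4" "m1 \<noteq> m5" "m2 \<noteq> m5" "m3 \<noteq> m5" "m4 \<noteq> m5"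
    using m(1) by auto
  have three: "(3::'a) \<noteq> 0" using three_nonzero[OF mem(4,5) ne(10) N(7,10,8,11)] .
  define w where "w = al m4"
  have w: "w\<^sup>2 + w + 1 = 0" using residual_pair[OF mem(2,4) ne(5) N(5,7)] one
    by (simp add: w_def algebra_simps)
  have w3: "w^3 = 1" using w by algebra
  have roots: "t = w \<or> t = w\<^sup>2" if "t\<^sup>2 + t + 1 = 0" for t
  proof -
    have "(t - w) * (t - w\<^sup>2) = 0" using that w by algebra
    then show ?thesis by auto
  qed
  have al5: "al m5 = w\<^sup>2"
  proof -
    have "al m2 + al m4 + al m5 = 0" using residual_sum[OF mem(2,4,5)] ne N by simp
    then show ?thesis using w one unfolding w_def by algebra
  qed
  have bes: "1 + be m4 + be m5 = 0" using b.residual_sum[OF mem(3,4,5)] ne N one by simp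
  have "(be m4)\<^sup>2 + be m4 + 1 = 0" using b.residual_pair[OF mem(3,4) ne(6) N(6,8)] one
    by (simp add: algebra_simps)
  \<comment> \<open>Otherwise \<open>m4\<close> and \<open>m5\<close> share their value of
    \<open>ga\<close>, while distinct points have distinct residual values outside characteristic
    3.\<close>
  moreover have "be m4 \<noteq> w\<^sup>2"
  proof
    assume b4: "be m4 = w\<^sup>2"
    then have "w^3 * ga m4 = -1" using prod[OF mem(4)] w_def by (simp add: power2_eq_square power3_eq_cube mult.assoc)
    moreover have "be m5 = w" using bes b4 w by algebra
    then have "w^3 * ga m5 = -1" using prod[OF mem(5)] al5 by (simp add: power2_eq_square power3_eq_cube mult.assoc)
    ultimately have "ga m4 = ga m5" using w3 by simp
    then show False using c.residual_neq[OF three mem(4,5) ne(10) N(9,12)] by simp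
  qed
  ultimately have be4: "be m4 = w" using roots by blast
  have be5: "be m5 = w\<^sup>2" using bes be4 w by algebra
  have ga4: "ga m4 = -w"
    using prod[OF mem(4)] w3 unfolding be4 w_def[symmetric] by algebra
  have ga5: "ga m5 = - (w\<^sup>2)"
    using prod[OF mem(5)] w3 unfolding be5 al5 by algebra
  have ga1: "ga m1 = -1"
  proof -
    have "ga m1 + ga m4 + ga m5 = 0" using c.residual_sum[OF mem(1,4,5)] ne N by simp
    then show ?thesis using w ga4 ga5 by algebra
  qed
  \<comment> \<open>The five points are \<open>(p, 1/p, -1)\<close>, \<open>(1, q, -1/q)\<close>, \<open>(1/r, 1, -r)\<close>, \<open>(w, w, -w)\<close> and \<open>(w\<^sup>2, w\<^sup>2, -w\<^sup>2)\<close>.\<close>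
  define p q r where pqr: "p = al m1" "q = be m2" "r = - ga m3"
  have nz: "p \<noteq> 0" "q \<noteq> 0" "r \<noteq> 0" using nonzero mem by (auto simp: pqr)
  define P Q R where PQR: "P = inverse p" "Q = inverse q" "R = inverse r"
  have pP: "p * P = 1" and qQ: "q * Q = 1" and rR: "r * R = 1" using nz by (simp_all add: PQR)
  have pP3: "p^3 * P^3 = 1" and qQ3: "q^3 * Q^3 = 1" and rR3: "r^3 * R^3 = 1" using pP qQ rR by algebra+
  have al1: "al m1 = p" and be2: "be m2 = q" and ga3: "ga m3 = - r" by (simp_all add: pqr)
  have be1: "be m1 = P" using prod[OF mem(1)] ga1 nz by (simp add: pqr PQR field_simps)
  have ga2: "ga m2 = - Q" using prod[OF mem(2)] one nz by (simp add: pqr PQR field_simps)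
  have al3: "al m3 = R" using prod[OF mem(3)] one nz unfolding ga3 PQR by (simp add: field_simps)
  have sum5: "(\<Sum>m\<in>M. f m) = f m1 + f m2 + f m3 + f m4 + f m5" for f :: "'m \<Rightarrow> 'a"
    using m by (simp add: add.assoc)
  note vals = al1 al3 al5 be1 be2 be4 be5 ga1 ga2 ga3 ga4 ga5 one w_def[symmetric]
  have pw: "w*w\<^sup>2 = 1" "w\<^sup>2*(w\<^sup>2)\<^sup>2 = 1" "w\<^sup>2*w^3 = w\<^sup>2" "(w\<^sup>2)\<^sup>2*(w\<^sup>2)^3 = w"
     "w*w^3 = w" "w\<^sup>2*(w\<^sup>2)^3 = w\<^sup>2" using w3 by algebra+
  have cancel: "x\<^sup>2 * y^3 = y" "x * y^3 = y\<^sup>2" "x * y\<^sup>2 = y" "x^3 * y\<^sup>2 = x" "x^3 * y = x\<^sup>2" "x\<^sup>2 * y = x"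
    if "y * x = 1" for x y :: 'a using that by algebra+
  have E1: "q\<^sup>2*(2+p+r) = -1"
  proof -
    have "p * (-1)\<^sup>2 + 1 * (-Q)\<^sup>2 + R * (-r)\<^sup>2 + w * (-w)\<^sup>2 + w\<^sup>2 * (-(w\<^sup>2))\<^sup>2 = 0"
      using moment_2 unfolding sum5 vals .
    then have "p + Q\<^sup>2 + r + 1 + 1 = 0" unfolding power2_minus cancel(3)[OF rR] pw by simp
    then show ?thesis using qQ by algebra
  qed
  have E2: "r\<^sup>2*(2+p+q) = -1"
  proof -
    have "P * p\<^sup>2 + q * 1\<^sup>2 + 1 * R\<^sup>2 + w * w\<^sup>2 + w\<^sup>2 * (w\<^sup>2)\<^sup>2 = 0"
      using b.moment_2 unfolding sum5 vals .
    then have "p + q + R\<^sup>2 + 1 + 1 = 0" unfolding cancel(3)[OF pP] pw by simp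
    then show ?thesis using rR by algebra
  qed
  have E3: "p\<^sup>2*(2+q+r) = -1"
  proof -
    have "-1 * P\<^sup>2 + -Q * q\<^sup>2 + -r * 1\<^sup>2 + -w * w\<^sup>2 + -(w\<^sup>2) * (w\<^sup>2)\<^sup>2 = 0"
      using c.moment_2 unfolding sum5 vals .
    then have "-(P\<^sup>2) - q - r - 1 - 1 = 0" unfolding mult_minus_left cancel(3)[OF qQ] pw by simp
    then show ?thesis using pP by algebra
  qed
  have minus3: "(-x)^3 = -(x^3)" for x :: 'a by (simp add: power3_eq_cube)
  have Fa: "1 + a * (1 - p\<^sup>2 - Q^3 - r) - a\<^sup>2 * (1 - p - Q^3 - r\<^sup>2) - a^3 = 0" if "a \<in> A" for a
  proof -
    have "(\<Sum>m\<in>M. (al m)\<^sup>2 * (ga m)^3) = - (p\<^sup>2) - Q^3 - r - w\<^sup>2 - w"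
      unfolding sum5 vals minus3 mult_minus_right cancel(1)[OF rR] pw by simp
    then have 1: "(\<Sum>m\<in>M. (al m)\<^sup>2 * (ga m)^3) = 1 - p\<^sup>2 - Q^3 - r" using w by algebra
    have "(\<Sum>m\<in>M. al m * (ga m)^3) = - p - Q^3 - r\<^sup>2 - w - w\<^sup>2"
      unfolding sum5 vals minus3 mult_minus_right cancel(2)[OF rR] pw by simp
    then have 2: "(\<Sum>m\<in>M. al m * (ga m)^3) = 1 - p - Q^3 - r\<^sup>2" using w by algebra
    show ?thesis using moment_3[OF that mem(3) N(6) mem(1) N(4)] unfolding 1 2 vals by simp
  qed
  have Fb: "-1 + a * (p + q\<^sup>2 + R^3 - 1) - a\<^sup>2 * (p\<^sup>2 + q + R^3 - 1) + a^3 = 0" if "a \<in> B" for a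
  proof -
    have "(\<Sum>m\<in>M. (be m)\<^sup>2 * (al m)^3) = p + q\<^sup>2 + R^3 + w\<^sup>2 + w"
      unfolding sum5 vals cancel(1)[OF pP] pw by simp
    then have 1: "(\<Sum>m\<in>M. (be m)\<^sup>2 * (al m)^3) = p + q\<^sup>2 + R^3 - 1" using w by algebra
    have "(\<Sum>m\<in>M. be m * (al m)^3) = p\<^sup>2 + q + R^3 + w + w\<^sup>2"
      unfolding sum5 vals cancel(2)[OF pP] pw by simp
    then have 2: "(\<Sum>m\<in>M. be m * (al m)^3) = p\<^sup>2 + q + R^3 - 1" using w by algebra
    show ?thesis using b.moment_3[OF that mem(1) N(4) mem(2) N(5)] unfolding 1 2 vals by simp
  qed
  have Fc: "1 + a * (P^3 + q + r\<^sup>2 - 1) - a\<^sup>2 * (1 - P^3 - q\<^sup>2 - r) + a^3 = 0" if "a \<in> C" for a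
  proof -
    have "(\<Sum>m\<in>M. (ga m)\<^sup>2 * (be m)^3) = P^3 + q + r\<^sup>2 + w\<^sup>2 + w"
      unfolding sum5 vals power2_minus cancel(1)[OF qQ] pw by simp
    then have 1: "(\<Sum>m\<in>M. (ga m)\<^sup>2 * (be m)^3) = P^3 + q + r\<^sup>2 - 1" using w by algebra
    have "(\<Sum>m\<in>M. ga m * (be m)^3) = - (P^3) - q\<^sup>2 - r - w - w\<^sup>2"
      unfolding sum5 vals mult_minus_left cancel(2)[OF qQ] pw by simp
    then have 2: "(\<Sum>m\<in>M. ga m * (be m)^3) = 1 - P^3 - q\<^sup>2 - r" using w by algebra
    show ?thesis using c.moment_3[OF that mem(2) N(5) mem(3) N(6)] unfolding 1 2 vals by simp
  qed
  have inA: "p \<in> A" "R \<in> A" and inB: "q \<in> B" "P \<in> B" and inC: "-r \<in> C" "-Q \<in> C"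
    using N(1-3) vals by auto
  have F1: "q^3*(p-1)*(p+1)\<^sup>2 - p*(p-1) = q^3*(p*r*(p*r-1))"
    using Fa[OF inA(1)] qQ3 by algebra
  \<comment> \<open>Evaluated at \<open>R\<close>, the inverse of \<open>r\<close>, and multiplied
    by \<open>r^3\<close>, the cubic becomes \<open>F1\<close> with \<open>p\<close> and
    \<open>r\<close> exchanged.\<close>
  have F1': "q^3*(r-1)*(r+1)\<^sup>2 - r*(r-1) = q^3*(p*r*(p*r-1))"
  proof -
    have "r^3 * (1 + R * (1 - p\<^sup>2 - Q^3 - r) - R\<^sup>2 * (1 - p - Q^3 - r\<^sup>2) - R^3) = 0" using Fa[OF inA(2)] by simp
    then have "r^3 + r\<^sup>2 * (1 - p\<^sup>2 - Q^3 - r) - r * (1 - p - Q^3 - r\<^sup>2) - 1 = 0" using rR by algebra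
    then show ?thesis using qQ3 by algebra
  qed
  have F2: "r^3*(q-1)*(q+1)\<^sup>2 - q*(q-1) = r^3*(q*p*(q*p-1))"
    using Fb[OF inB(1)] rR3 by algebra
  have F2': "r^3*(p-1)*(p+1)\<^sup>2 - p*(p-1) = r^3*(q*p*(q*p-1))"
  proof -
    have "p^3 * (-1 + P * (p + q\<^sup>2 + R^3 - 1) - P\<^sup>2 * (p\<^sup>2 + q + R^3 - 1) + P^3) = 0" using Fb[OF inB(2)] by simp
    then have "-(p^3) + p\<^sup>2 * (p + q\<^sup>2 + R^3 - 1) - p * (p\<^sup>2 + q + R^3 - 1) + 1 = 0" using pP by algebra
    then show ?thesis using rR3 by algebra
  qed
  have F3: "p^3*(r-1)*(r+1)\<^sup>2 - r*(r-1) = p^3*(r*q*(r*q-1))"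
    using Fc[OF inC(1)] pP3 by algebra
  have F3': "p^3*(q-1)*(q+1)\<^sup>2 - q*(q-1) = p^3*(r*q*(r*q-1))"
  proof -
    have "q^3 * (1 + (-Q) * (P^3 + q + r\<^sup>2 - 1) - (-Q)\<^sup>2 * (1 - P^3 - q\<^sup>2 - r) + (-Q)^3) = 0" using Fc[OF inC(2)] by simp
    then have "q^3 - q\<^sup>2 * (P^3 + q + r\<^sup>2 - 1) - q * (1 - P^3 - q\<^sup>2 - r) - 1 = 0" using qQ by algebra
    then show ?thesis using pP3 by algebra
  qed
  have cube: "p \<noteq> 1" "q \<noteq> 1" "r \<noteq> 1"
    using nonresidual_cube[OF inA(1) mem(2) N(5)] b.nonresidual_cube[OF inB(1) mem(3) N(6)]
      c.nonresidual_cube[OF inC(1) mem(1) N(4)] vals by auto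
  have d: "al m1 \<noteq> al m3" "be m1 \<noteq> be m2" "ga m2 \<noteq> ga m3"
    using hit_unique[OF mem(1,3)] b.hit_unique[OF mem(1,2)] c.hit_unique[OF mem(2,3)] N(1-3) ne by auto
  have "p*r \<noteq> 1" "q*p \<noteq> 1" "r*q \<noteq> 1"
    using d nz unfolding vals PQR by (auto simp: field_simps)
  then show False using cyclic_system_inconsistent[OF E1 E2 E3 F1 F1' F2 F2' F3 F3' nz cube _ _ _ three] by blast
qed

lemma no_cyclic_pattern:
  assumes m: "distinct [m1,m2,m3,m4,m5]" "M = {m1,m2,m3,m4,m5}"
    and N: "A = {al m1, al m3}" "B = {be m1, be m2}" "C = {ga m2, ga m3}"
      "ga m1 \<notin> C" "al m2 \<notin> A" "be m3 \<notin> B"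
      "al m4 \<notin> A" "be m4 \<notin> B" "ga m4 \<notin> C" "al m5 \<notin> A" "be m5 \<notin> B" "ga m5 \<notin> C"
  shows False
proof -
  have nz: "al m2 \<noteq> 0" "be m3 \<noteq> 0" using nonzero m(2) by auto
  define s t r where str: "s = inverse (al m2)" "t = inverse (be m3)" "r = al m2 * be m3"
  have nz': "s \<noteq> 0" "t \<noteq> 0" "r \<noteq> 0" using nz by (auto simp: str)
  have i: "x * y \<in> (*) x ` X \<longleftrightarrow> y \<in> X" if "x \<noteq> 0" for x y :: 'a and X using that by auto
  interpret n: balanced M "\<lambda>m. s * al m" "\<lambda>m. t * be m" "\<lambda>m. r * ga m" "(*) s ` A" "(*) t ` B" "(*) r ` C"
    by (rule scale) (use nz in \<open>simp add: str field_simps\<close>)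
  have N': "(*) s ` A = {s * al m1, s * al m3}" "(*) t ` B = {t * be m1, t * be m2}" "(*) r ` C = {r * ga m2, r * ga m3}"
    using N by auto
  show False by (rule n.no_cyclic_pattern_normalized[OF m N'])
     (use N(4-) nz nz' in \<open>simp_all only: i not_False_eq_True simp_thms, simp_all add: str\<close>)
qed

end

section \<open>Three pairs in a set of five, and the conclusion of the balanced case\<close>

lemma three_pairs_covered:
  assumes "card X = 2" "card Y = 2" "card Z = 2" "X \<subseteq> Y \<union> Z" "Y \<subseteq> X \<union> Z" "Z \<subseteq> X \<union> Y"
  shows "(X = Y \<and> Y = Z) \<or> (\<exists>x y z. distinct [x,y,z] \<and> X = {x,z} \<and> Y = {x,y} \<and> Z = {y,z})"
proof -
  have fin: "finite X" "finite Y" "finite Z" using assms(1-3) by (metis card.infinite zero_neq_numeral)+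
  have "X \<inter> Y \<noteq> {}"
  proof
    assume *: "X \<inter> Y = {}"
    then have "X \<subseteq> Z" "Y \<subseteq> Z" using assms by auto
    then have "X = Z" "Y = Z" using card_subset_eq fin assms by metis+
    then have "X = {}" using * by auto
    then show False using assms(1) by simp
  qed
  then obtain x where x: "x \<in> X" "x \<in> Y" by auto
  have pair: "\<exists>z. z \<noteq> x \<and> W = {x,z}" if "card W = 2" "x \<in> W" for W
    using that by (auto simp: card_2_iff)
  obtain z where z: "z \<noteq> x" "X = {x,z}" using pair[OF assms(1) x(1)] by auto
  obtain y where y: "y \<noteq> x" "Y = {x,y}" using pair[OF assms(2) x(2)] by auto
  show ?thesis
  proof (cases "y = z")
    case True
    then have "Z \<subseteq> X" "X = Y" using y z assms by auto
    then show ?thesis using card_subset_eq fin assms by metis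
  next
    case False
    then have "{y,z} \<subseteq> Z" "card {y,z} = 2" using y z assms by auto
    then have "Z = {y,z}" using card_subset_eq fin assms by metis
    then show ?thesis using y z False by (intro disjI2 exI[of _ x] exI[of _ y] exI[of _ z]) auto
  qed
qed

text \<open>Six entries with five distinct values admit a single coincidence, and the common element
  of \<open>X\<close> and \<open>Y\<close> already accounts for it.\<close>

lemma three_pairs_union_5:
  assumes c: "card X = 2" "card Y = 2" "card Z = 2" "card (X \<union> Y \<union> Z) = 5"
    and "X \<inter> Y \<noteq> {}"
  shows "\<exists>s x y z w. distinct [s,x,y,z,w] \<and> X = {s,x} \<and> Y = {s,y} \<and> Z = {z,w}"
proof -
  obtain s where s: "s \<in> X" "s \<in> Y" using assms by auto
  have pair: "\<exists>z. z \<noteq> s \<and> W = {s,z}" if "card W = 2" "s \<in> W" for W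
    using that by (auto simp: card_2_iff)
  obtain x where x: "x \<noteq> s" "X = {s,x}" using pair[OF c(1) s(1)] by auto
  obtain y where y: "y \<noteq> s" "Y = {s,y}" using pair[OF c(2) s(2)] by auto
  obtain z w where z: "Z = {z,w}" using c(3) by (meson card_2_iff)
  have "X \<union> Y \<union> Z = set [s,x,y,z,w]" using x y z by auto
  then have "distinct [s,x,y,z,w]" using c(4) by (intro card_distinct) simp
  then show ?thesis using x y z by blast
qed

context balanced
begin

lemma A_image: "A = al ` {m\<in>M. al m \<in> A}"
proof -
  have "a \<in> al ` {m\<in>M. al m \<in> A}" if "a \<in> A" for a
  proof -
    have "{m\<in>M. al m = a} \<noteq> {}" using hit_once[OF that] by fastforce
    then show ?thesis using that by auto
  qed
  then show ?thesis by auto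
qed

text \<open>When every point of \<open>M\<close> has a non-residual value, two intersecting pairs
  produce exactly the overlap pattern. The three rotations of this lemma make the pairs disjoint,
  which five points do not allow.\<close>

lemma no_overlap:
  assumes "{m\<in>M. al m \<in> A} \<union> {m\<in>M. be m \<in> B} \<union> {m\<in>M. ga m \<in> C} = M"
  shows "{m\<in>M. al m \<in> A} \<inter> {m\<in>M. be m \<in> B} = {}"
proof (rule ccontr)
  assume ne: "{m\<in>M. al m \<in> A} \<inter> {m\<in>M. be m \<in> B} \<noteq> {}"
  interpret b: balanced M be ga al B C A by (rule rotate)
  interpret c: balanced M ga al be C A B by (rule b.rotate)
  have "card ({m\<in>M. al m \<in> A} \<union> {m\<in>M. be m \<in> B} \<union> {m\<in>M. ga m \<in> C}) = 5"
    unfolding assms by (rule card_M)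
  from three_pairs_union_5[OF card_nonresidual b.card_nonresidual c.card_nonresidual this ne]
  obtain s x y z w where d: "distinct [s,x,y,z,w]"
    and N: "{m\<in>M. al m \<in> A} = {s,x}" "{m\<in>M. be m \<in> B} = {s,y}" "{m\<in>M. ga m \<in> C} = {z,w}"
    by blast
  have M: "M = {s,x,y,z,w}" using assms unfolding N by auto
  have iA: "al m \<in> A \<longleftrightarrow> m \<in> {s,x}" and iB: "be m \<in> B \<longleftrightarrow> m \<in> {s,y}" and iC: "ga m \<in> C \<longleftrightarrow> m \<in> {z,w}" if "m \<in> M" for m
    using N that by blast+
  have mem: "s \<in> M" "x \<in> M" "y \<in> M" "z \<in> M" "w \<in> M" using M by auto
  show False by (rule no_overlap_pattern[OF d M]) (use iA iB iC mem d in auto)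
qed

lemma contradiction: False
proof -
  interpret b: balanced M be ga al B C A by (rule rotate)
  interpret c: balanced M ga al be C A B by (rule b.rotate)
  define Na Nb Nc where N: "Na = {m\<in>M. al m \<in> A}" "Nb = {m\<in>M. be m \<in> B}" "Nc = {m\<in>M. ga m \<in> C}"
  have cards: "card Na = 2" "card Nb = 2" "card Nc = 2"
    using card_nonresidual b.card_nonresidual c.card_nonresidual by (simp_all add: N)
  have fin: "finite Na" "finite Nb" "finite Nc" using finite_M by (simp_all add: N)
  show False
  proof (cases "Na \<union> Nb \<union> Nc = M")
    case True
    have "Na \<inter> Nb = {}" "Nb \<inter> Nc = {}" "Nc \<inter> Na = {}"
      using no_overlap b.no_overlap c.no_overlap True unfolding N by blast+
    then have "card (Na \<union> Nb \<union> Nc) = 6" using cards fin by (subst card_Un_disjoint, auto)+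
    then show False using True card_M by simp
  next
    case False
    then obtain m0 where m0: "m0 \<in> M" "al m0 \<notin> A" "be m0 \<notin> B" "ga m0 \<notin> C" unfolding N by blast
    \<comment> \<open>Residual values of one coordinate have equal cubes. If \<open>al m\<close>
      were the only non-residual value at \<open>m\<close>, cubing the product -1 at
      \<open>m\<close> and at the wholly residual point \<open>m0\<close> would give
      \<open>al m\<close> the residual cube too.\<close>
    have cov: "be m \<in> B' \<or> ga m \<in> C'" if "balanced M al be ga A' B' C'" "m \<in> M" "al m \<in> A'" "al m0 \<notin> A'" "be m0 \<notin> B'" "ga m0 \<notin> C'"
      for m and al be ga :: "'m \<Rightarrow> 'a" and A' B' C'
    proof (rule ccontr)
      interpret x: balanced M al be ga A' B' C' by fact
      interpret xb: balanced M be ga al B' C' A' by (rule x.rotate)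
      interpret xc: balanced M ga al be C' A' B' by (rule xb.rotate)
      assume "\<not> ?thesis"
      then have "(be m)^3 = (be m0)^3" "(ga m)^3 = (ga m0)^3"
        using xb.residual_cube[of m m0] xc.residual_cube[of m m0] that m0(1) by auto
      moreover have "(al m)^3 * (be m)^3 * (ga m)^3 = (al m0)^3 * (be m0)^3 * (ga m0)^3"
        using x.prod[OF that(2)] x.prod[OF m0(1)] by (simp flip: power_mult_distrib)
      ultimately have "(al m)^3 = (al m0)^3" using x.nonzero[OF m0(1)] by simp
      then show False using x.nonresidual_cube[of "al m" m0] that m0(1) by auto
    qed
    have "Na \<subseteq> Nb \<union> Nc" using cov[OF balanced_axioms] m0 unfolding N by blast
    moreover have "Nb \<subseteq> Na \<union> Nc" using cov[OF b.balanced_axioms] m0 unfolding N by blast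
    moreover have "Nc \<subseteq> Na \<union> Nb" using cov[OF c.balanced_axioms] m0 unfolding N by blast
    ultimately consider "Na = Nb" "Nb = Nc" | x y z where "distinct [x,y,z]" "Na = {x,z}" "Nb = {x,y}" "Nc = {y,z}"
      using three_pairs_covered[OF cards] by metis
    then show False
    proof cases
      case 1
      obtain m1 m2 where m: "Na = {m1,m2}" "m1 \<noteq> m2" using cards(1) by (meson card_2_iff)
      then have "m1 \<in> M" "m2 \<in> M" unfolding N by auto
      then obtain m3 m4 m5 where d: "distinct [m1,m2,m3,m4,m5]" and M: "M = {m1,m2,m3,m4,m5}"
        using card_5_pairE card_M m(2) by metis
      have iA: "al k \<in> A \<longleftrightarrow> k \<in> {m1,m2}" and iB: "be k \<in> B \<longleftrightarrow> k \<in> {m1,m2}" and iC: "ga k \<in> C \<longleftrightarrow> k \<in> {m1,m2}" if "k \<in> M" for k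
        using m 1 N that by blast+
      have im: "A = {al m1, al m2}" "B = {be m1, be m2}" "C = {ga m1, ga m2}"
        using A_image b.A_image c.A_image m(1) 1 unfolding N by auto
      have mem: "m3 \<in> M" "m4 \<in> M" "m5 \<in> M" using M by auto
      show False by (rule no_equal_pattern[OF d M im]) (use iA iB iC mem d in auto)
    next
      case (2 x y z)
      have mem3: "x \<in> M" "y \<in> M" "z \<in> M" using 2 unfolding N by auto
      have "card (M - {x,y,z}) = 2" using card_M mem3 2(1) finite_M by (simp add: card_Diff_subset)
      then obtain m4 m5 where m45: "M - {x,y,z} = {m4,m5}" "m4 \<noteq> m5" by (meson card_2_iff)
      have d: "distinct [x,y,z,m4,m5]" and M: "M = {x,y,z,m4,m5}" using m45 2(1) mem3 by auto
      have iA: "al k \<in> A \<longleftrightarrow> k \<in> {x,z}" and iB: "be k \<in> B \<longleftrightarrow> k \<in> {x,y}" and iC: "ga k \<in> C \<longleftrightarrow> k \<in> {y,z}" if "k \<in> M" for k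
        using 2 N that by blast+
      have im: "A = {al x, al z}" "B = {be x, be y}" "C = {ga y, ga z}"
        using A_image b.A_image c.A_image 2(2-4) unfolding N by auto
      have mem: "m4 \<in> M" "m5 \<in> M" using M by auto
      show False by (rule no_cyclic_pattern[OF d M im]) (use iA iB iC mem mem3 d in auto)
    qed
  qed
qed

end

section \<open>Pencils for a triangle with an intact side\<close>

lemma subset_mset_Suc_size:
  assumes "N \<subseteq># N'" "size N' = Suc (size N)"
  obtains x where "N' = add_mset x N"
proof -
  obtain K where K: "N' = N + K" using assms(1) by (meson mset_subset_eq_exists_conv)
  then have "size K = 1" using assms(2) by simp
  then obtain x where "K = {#x#}" by (meson size_1_singleton_mset)
  then show thesis using K that by simp
qed

lemma subset_mset_eq_size:
  assumes "N \<subseteq># N'" "size N' = size N"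
  shows "N' = N"
proof -
  obtain K where K: "N' = N + K" using assms(1) by (meson mset_subset_eq_exists_conv)
  then show ?thesis using assms(2) by simp
qed

text \<open>
  In the next two lemmas the symmetric functions of \<open>r m + x * h m\<close> are polynomials in \<open>x\<close> of known degree
  whose constant terms are the symmetric functions of \<open>r\<close>.
\<close>

lemma pencil_4:
  fixes r h :: "'m \<Rightarrow> 'a::field"
  assumes M: "card M = 5" and D: "card D = 4" "D \<subseteq> r ` M" and nz: "\<And>m. m \<in> M \<Longrightarrow> r m \<noteq> 0"
    and t: "t \<noteq> t'"
    and *: "\<And>x. x \<in> {t,t'} \<Longrightarrow> add_mset 0 (mset_set D) \<subseteq># image_mset (\<lambda>m. r m + x * h m) (mset_set M)"
  shows False
proof -
  have finM: "finite M" using M by (metis card.infinite zero_neq_numeral)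
  have eq: "((\<Sum>m\<in>M. r m) - \<Sum>D) + (\<Sum>m\<in>M. h m) * x = 0" if "x \<in> {t,t'}" for x
  proof -
    have "image_mset (\<lambda>m. r m + x * h m) (mset_set M) = add_mset 0 (mset_set D)"
      by (rule subset_mset_eq_size[OF *[OF that]]) (simp add: M D)
    then have "(\<Sum>m\<in>M. r m + x * h m) = \<Sum>D" by (simp add: sum_unfold_sum_mset)
    then have "(\<Sum>m\<in>M. r m) + x * (\<Sum>m\<in>M. h m) = \<Sum>D" by (simp only: sum.distrib sum_distrib_left)
    then show ?thesis by (simp add: algebra_simps)
  qed
  \<comment> \<open>Two values of \<open>x\<close> fix the constant term. Since \<open>r\<close>
    attains the four elements of \<open>D\<close> at four points, its value at the fifth point must
    be 0.\<close>
  have h: "(\<Sum>m\<in>M. r m) = \<Sum>D"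
    using linear_two_roots[of "(\<Sum>m\<in>M. r m) - \<Sum>D" "\<Sum>m\<in>M. h m" t t'] eq t by auto
  have "\<exists>N\<subseteq>M. inj_on r N \<and> D = r ` N" using D(2) by (meson subset_image_inj)
  then obtain N where N: "N \<subseteq> M" "inj_on r N" "D = r ` N" by auto
  have "card N = 4" using N D(1) card_image by metis
  then have "card (M - N) = 1" using N(1) M finM by (simp add: card_Diff_subset finite_subset[OF N(1) finM] \<open>card N = 4\<close>)
  then obtain k where k: "M - N = {k}" by (meson card_1_singletonE)
  have "(\<Sum>m\<in>M. r m) = (\<Sum>m\<in>N. r m) + r k"
    using sum.subset_diff[OF N(1) finM, of r] k by simp
  also have "(\<Sum>m\<in>N. r m) = \<Sum>D" using N by (simp add: sum.reindex)
  finally have "r k = 0" using h by simp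
  then show False using nz k by blast
qed

lemma pencil_3:
  fixes r h :: "'m \<Rightarrow> 'a::field"
  assumes M: "card M = 5" and D: "card D = 3" "D \<subseteq> r ` M" and nz: "\<And>m. m \<in> M \<Longrightarrow> r m \<noteq> 0"
    and *: "\<And>t. t \<in> X \<Longrightarrow> add_mset 0 (mset_set D) \<subseteq># image_mset (\<lambda>m. r m + t * h m) (mset_set M)"
  obtains m1 m2 m3 m4 m5 U k where "distinct [m1,m2,m3,m4,m5]" "M = {m1,m2,m3,m4,m5}" "U \<noteq> 0"
    "\<And>t. t \<in> X \<Longrightarrow> U + k * t + (h m1*h m2+h m1*h m3+h m1*h m4+h m1*h m5+h m2*h m3+h m2*h m4+h m2*h m5+h m3*h m4+h m3*h m5+h m4*h m5) * t\<^sup>2 = 0"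
proof -
  have finM: "finite M" using M by (metis card.infinite zero_neq_numeral)
  obtain d1 d2 d3 where d: "D = {d1,d2,d3}" "d1 \<noteq> d2" "d2 \<noteq> d3" "d1 \<noteq> d3" using D(1) by (metis card_3_iff)
  obtain m1 m2 m3 where m: "m1 \<in> M" "m2 \<in> M" "m3 \<in> M" "r m1 = d1" "r m2 = d2" "r m3 = d3"
  proof -
    have "d1 \<in> r ` M" "d2 \<in> r ` M" "d3 \<in> r ` M" using D(2) d(1) by auto
    then show thesis using that by auto
  qed
  have ne: "m1 \<noteq> m2" "m2 \<noteq> m3" "m1 \<noteq> m3" using m d by auto
  have "card (M - {m1,m2,m3}) = 2" using M m finM ne by (simp add: card_Diff_subset)
  then obtain m4 m5 where m45: "M - {m1,m2,m3} = {m4,m5}" "m4 \<noteq> m5" by (meson card_2_iff)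
  have dm: "distinct [m1,m2,m3,m4,m5]" and Me: "M = {m1,m2,m3,m4,m5}" using m45 m ne by auto
  define r4 r5 where r: "r4 = r m4" "r5 = r m5"
  define h1 h2 h3 h4 h5 where h: "h1 = h m1" "h2 = h m2" "h3 = h m3" "h4 = h m4" "h5 = h m5"
  define k where "k = (r4 + r5) * (h1+h2+h3+h4+h5) - (d1*h1+d2*h2+d3*h3+r4*h4+r5*h5)"
  have "r4 * r5 + k * t + (h1*h2+h1*h3+h1*h4+h1*h5+h2*h3+h2*h4+h2*h5+h3*h4+h3*h5+h4*h5) * t\<^sup>2 = 0" if t: "t \<in> X" for t
  proof -
    obtain x where "image_mset (\<lambda>m. r m + t * h m) (mset_set M) = add_mset x (add_mset 0 (mset_set D))"
      by (rule subset_mset_Suc_size[OF *[OF t]]) (use M D in auto)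
    then have x: "{#d1+t*h1,d2+t*h2,d3+t*h3,r4+t*h4,r5+t*h5#} = {#x,0,d1,d2,d3#}"
      unfolding Me mset_set_5[OF dm] using d m by (simp add: r h)
    \<comment> \<open>The first symmetric function determines the one free value \<open>x\<close>.
      Inserted into the second it leaves a quadratic in \<open>t\<close> with constant term
      \<open>r4 * r5\<close>, the product of the two values of \<open>r\<close> not matched with
      \<open>D\<close>.\<close>
    have "x = r4 + r5 + t*(h1+h2+h3+h4+h5)" using symmetric_functions_5(1)[OF x] by algebra
    with symmetric_functions_5(2)[OF x] show ?thesis unfolding k_def by algebra
  qed
  moreover have "r4 * r5 \<noteq> 0" using nz m45 unfolding r by auto
  ultimately show thesis using that[OF dm Me] unfolding h by blast
qed

section \<open>Removed vertices and unequal sides\<close>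

lemma of_nat_CARD_eq_0: "of_nat CARD('a) = (0::'a::{field,finite})"
proof -
  have "bij (\<lambda>x::'a. x + 1)" by (rule bij_plus_right)
  then have "(\<Sum>x\<in>UNIV. (x::'a) + 1) = (\<Sum>x\<in>UNIV. x)"
    using sum.reindex_bij_betw[of "\<lambda>x::'a. x + 1" UNIV UNIV "\<lambda>x. x"] by simp
  then show ?thesis by (simp add: sum.distrib)
qed

lemma card_nonzero: "card (-{0::'a::{field,finite}}) = CARD('a) - 1"
  by (simp add: Compl_eq_Diff_UNIV card_Diff_singleton)

lemma power_CARD_minus_1:
  fixes x :: "'a::{field,finite}"
  assumes "x \<noteq> 0"
  shows "x ^ (CARD('a) - 1) = 1"
proof -
  have "bij_betw ((*) x) (-{0}) (-{0})"
    by (rule bij_betwI[of _ _ _ "(*) (inverse x)"]) (use assms in auto)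
  then have "(\<Prod>y\<in>-{0}. x * y) = \<Prod>(-{0})"
    using prod.reindex_bij_betw[of "(*) x" "-{0}" "-{0}" "\<lambda>y. y"] by simp
  then have "x ^ card (-{0::'a}) * \<Prod>(-{0}) = \<Prod>(-{0})" by (simp add: prod.distrib)
  moreover have "\<Prod>(-{0::'a}) \<noteq> 0" by simp
  ultimately show ?thesis by (simp add: card_nonzero)
qed

text \<open>The bound q - 1 \<le> 5 still admits q = 6. Every nonzero element would have fifth power
  1; for -1 this gives characteristic 2, and for \<open>x\<close> and \<open>1 + x\<close> together
  it gives \<open>x = 1\<close>.\<close>

lemma no_field_of_order_6: "CARD('a::{field,finite}) \<noteq> 6"
proof
  assume c: "CARD('a) = 6"
  then have p: "x^5 = 1" if "x \<noteq> 0" for x :: 'a using power_CARD_minus_1[OF that] by simp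
  have "(-1::'a)^5 = 1" using p[of "-1"] by simp
  then have "-1 = (1::'a)" by (simp add: eval_nat_numeral)
  then have two: "(2::'a) = 0" by (metis add.right_inverse one_add_one)
  have "\<not> (UNIV :: 'a set) \<subseteq> {0,1}" using c card_mono[of "{0,1::'a}" UNIV] by auto
  then obtain x :: 'a where x: "x \<noteq> 0" "x \<noteq> 1" by auto
  have "1 + x \<noteq> 0" using x two by (metis add_eq_0_iff add_left_cancel mult_2 mult_zero_left)
  then have a: "(1+x)^5 = 1" "x^5 = 1" using p x by auto
  have "(1+x)^5 = 1 + x + x^4 + x^5 + 2*(2*x + 5*x^2 + 5*x^3 + 2*x^4)" by algebra
  then have "x^4 + x = 1" using a two by (simp add: add.commute)
  then have b: "x^4 + x + 1 = 0" using two by simp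
  have "x^5 + x^2 + x = 0" using b by algebra
  then have "x^2 + x + 1 = 0" unfolding a(2) by (simp add: algebra_simps)
  then have d: "x^3 = 1" by algebra
  have "x^2 = 1" using a(2) d by algebra
  then have "x = 1" using d by algebra
  then show False using x by simp
qed

lemma field_of_order_5:
  assumes "CARD('a::{field,finite}) = 5"
  shows "(5::'a) = 0" "mset_set (-{0::'a}) = {#1,2,3,4#}" "1 / (2::'a) = 3" "1 / (3::'a) = 2" "1 / (4::'a) = 4"
    "(3::'a) \<noteq> 0" "\<And>x::'a. x \<noteq> 0 \<Longrightarrow> x^4 = 1"
proof -
  show five: "(5::'a) = 0" using of_nat_CARD_eq_0[where 'a='a] assms by simp
  have "(1::'a) + 5 = 6" "(1::'a) + 3 * 5 = 16" by simp_all
  then have s: "(6::'a) = 1" "(16::'a) = 1" unfolding five by simp_all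
  have one: "(2::'a) * 3 = 1" "(4::'a)*4 = 1" using s by simp_all
  have ne: "(2::'a) \<noteq> 0" "(3::'a) \<noteq> 0" "(4::'a) \<noteq> 0"
    using one by (metis mult_zero_left mult_zero_right zero_neq_one)+
  have d: "(1::'a) \<noteq> 2" "(1::'a) \<noteq> 3" "(1::'a) \<noteq> 4" "(2::'a) \<noteq> 3" "(2::'a) \<noteq> 4" "(3::'a) \<noteq> 4"
  proof -
    have "(2::'a) - 1 \<noteq> 0" "(3::'a) - 1 \<noteq> 0" "(4::'a) - 1 \<noteq> 0" "(3::'a) - 2 \<noteq> 0" "(4::'a) - 2 \<noteq> 0" "(4::'a) - 3 \<noteq> 0"
      using ne by simp_all
    then show "(1::'a) \<noteq> 2" "(1::'a) \<noteq> 3" "(1::'a) \<noteq> 4" "(2::'a) \<noteq> 3" "(2::'a) \<noteq> 4" "(3::'a) \<noteq> 4"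
      by (metis diff_self)+
  qed
  have "card {1,2,3,4::'a} = card (-{0::'a})" using d assms by (simp add: card_nonzero)
  moreover have "{1,2,3,4::'a} \<subseteq> -{0}" using ne by auto
  ultimately have "{1,2,3,4::'a} = -{0}" by (simp add: card_subset_eq)
  then have "mset_set (-{0::'a}) = mset_set {1,2,3,4}" by simp
  also have "\<dots> = {#1,2,3,4#}" using d by simp
  finally show "mset_set (-{0::'a}) = {#1,2,3,4#}" .
  show "1 / (2::'a) = 3" "1 / (3::'a) = 2" "1 / (4::'a) = 4" "(3::'a) \<noteq> 0"
    using one ne by (simp_all add: divide_eq_eq mult.commute)
  show "x^4 = 1" if "x \<noteq> 0" for x :: 'a using power_CARD_minus_1[OF that] assms by simp
qed

text \<open>\<open>v1\<close>, \<open>v2\<close>, \<open>v3\<close> record which vertices lie in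
  \<open>H\<close>. A removed vertex doubles the required multiplicity of the pencil value 0. By
  \<open>vertex_A\<close> it also requires a point of \<open>M\<close> on each line through it that
  is not a side, and a second one if the line meets the opposite side in \<open>H\<close>.
  \<open>side_A\<close> expresses that a side, which misses \<open>M\<close>, keeps two of its q + 1
  points.\<close>

locale config =
  fixes M :: "'m set" and al be ga :: "'m \<Rightarrow> 'a::{field,finite}" and A B C :: "'a set" and v1 v2 v3 :: bool
  assumes card_M: "card M = 5"
    and zero_A: "0 \<notin> A" and zero_B: "0 \<notin> B" and zero_C: "0 \<notin> C"
    and prod: "\<And>m. m \<in> M \<Longrightarrow> al m * be m * ga m = -1"
    and inj: "\<And>m n. m \<in> M \<Longrightarrow> n \<in> M \<Longrightarrow> al m = al n \<Longrightarrow> be m = be n \<Longrightarrow> m = n"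
    and pencil_A: "\<And>a. a \<in> A \<Longrightarrow> replicate_mset (1 + of_bool v1) 0 + image_mset inverse (mset_set B)
        + image_mset ((*) a) (mset_set C) \<subseteq># image_mset (\<lambda>m. inverse (be m) + a * ga m) (mset_set M)"
    and pencil_B: "\<And>a. a \<in> B \<Longrightarrow> replicate_mset (1 + of_bool v2) 0 + image_mset inverse (mset_set C)
        + image_mset ((*) a) (mset_set A) \<subseteq># image_mset (\<lambda>m. inverse (ga m) + a * al m) (mset_set M)"
    and pencil_C: "\<And>a. a \<in> C \<Longrightarrow> replicate_mset (1 + of_bool v3) 0 + image_mset inverse (mset_set A)
        + image_mset ((*) a) (mset_set B) \<subseteq># image_mset (\<lambda>m. inverse (al m) + a * be m) (mset_set M)"
    and vertex_A: "v1 \<Longrightarrow> mset_set (-{0}) + mset_set A \<subseteq># image_mset al (mset_set M)"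
    and vertex_B: "v2 \<Longrightarrow> mset_set (-{0}) + mset_set B \<subseteq># image_mset be (mset_set M)"
    and vertex_C: "v3 \<Longrightarrow> mset_set (-{0}) + mset_set C \<subseteq># image_mset ga (mset_set M)"
    and side_A: "card A + of_bool v2 + of_bool v3 < CARD('a)"
    and side_B: "card B + of_bool v3 + of_bool v1 < CARD('a)"
    and side_C: "card C + of_bool v1 + of_bool v2 < CARD('a)"
    and total: "card A + card B + card C + of_bool v1 + of_bool v2 + of_bool v3 = 6"
begin

lemma finite_M: "finite M" using card_M by (metis card.infinite zero_neq_numeral)

lemma nonzero: "m \<in> M \<Longrightarrow> al m \<noteq> 0" "m \<in> M \<Longrightarrow> be m \<noteq> 0" "m \<in> M \<Longrightarrow> ga m \<noteq> 0"
  using prod[of m] by auto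

lemma rotate: "config M be ga al B C A v2 v3 v1"
proof
  show "m = n" if "m \<in> M" "n \<in> M" "be m = be n" "ga m = ga n" for m n
  proof -
    have "al m * (be m * ga m) = al n * (be m * ga m)" using prod[of m] prod[of n] that by (simp add: mult.assoc)
    then show ?thesis using inj that nonzero by simp
  qed
  show "be m * ga m * al m = -1" if "m \<in> M" for m using prod[OF that] by (simp add: algebra_simps)
qed (use card_M zero_A zero_B zero_C pencil_A pencil_B pencil_C vertex_A vertex_B vertex_C side_A side_B side_C total in auto)

lemma card_pencil: "a \<in> A \<Longrightarrow> of_bool v1 + card B + card C \<le> 4"
  using size_mset_mono[OF pencil_A] card_M by force

lemma card_vertex: "v1 \<Longrightarrow> CARD('a) - 1 + card A \<le> 5"
  using size_mset_mono[OF vertex_A] card_M by (simp add: card_nonzero)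

lemma inverse_be: "m \<in> M \<Longrightarrow> inverse (be m) = - (al m * ga m)"
  using prod[of m] nonzero[of m] by (simp add: field_simps)

lemma pencil_zero: "m \<in> M \<Longrightarrow> inverse (be m) + a * ga m = 0 \<longleftrightarrow> al m = a"
  using nonzero[of m] by (auto simp: inverse_be algebra_simps)

lemma covers: "A \<subseteq> al ` M"
proof
  fix a assume a: "a \<in> A"
  have "0 \<in># replicate_mset (1 + of_bool v1) 0 + image_mset inverse (mset_set B) + image_mset ((*) a) (mset_set C)"
    by simp
  then have "0 \<in># image_mset (\<lambda>m. inverse (be m) + a * ga m) (mset_set M)"
    using pencil_A[OF a] by (meson mset_subset_eqD)
  then show "a \<in> al ` M" using finite_M pencil_zero by auto
qed

lemma pencil_B_empty:
  assumes "A = {}" "b \<in> B"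
  shows "add_mset 0 (mset_set (inverse ` C)) \<subseteq># image_mset (\<lambda>m. inverse (ga m) + b * al m) (mset_set M)"
proof -
  have "image_mset inverse (mset_set C) = mset_set (inverse ` C)"
    by (rule image_mset_mset_set) (simp add: inj_on_def)
  then have "add_mset 0 (mset_set (inverse ` C)) \<subseteq># replicate_mset (1 + of_bool v2) 0 + image_mset inverse (mset_set C)
        + image_mset ((*) b) (mset_set A)" by simp
  then show ?thesis using pencil_B[OF assms(2)] by (rule subset_mset.trans)
qed

text \<open>Division by \<open>c\<close> makes the required values independent of the centre, which
  then enters through \<open>inverse c\<close> alone; this is the form treated by
  \<open>pencil_4\<close> and \<open>pencil_3\<close>.\<close>

lemma pencil_C_empty:
  assumes "A = {}" "c \<in> C"
  shows "add_mset 0 (mset_set B) \<subseteq># image_mset (\<lambda>m. be m + inverse c * inverse (al m)) (mset_set M)"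
proof -
  have c: "c \<noteq> 0" using assms zero_C by auto
  have "add_mset 0 (image_mset ((*) c) (mset_set B)) \<subseteq># replicate_mset (1 + of_bool v3) 0 + image_mset inverse (mset_set A)
        + image_mset ((*) c) (mset_set B)" by simp
  then have "add_mset 0 (image_mset ((*) c) (mset_set B)) \<subseteq># image_mset (\<lambda>m. inverse (al m) + c * be m) (mset_set M)"
    using pencil_C[OF assms(2)] by (rule subset_mset.trans)
  then have "image_mset ((*) (inverse c)) (add_mset 0 (image_mset ((*) c) (mset_set B)))
     \<subseteq># image_mset ((*) (inverse c)) (image_mset (\<lambda>m. inverse (al m) + c * be m) (mset_set M))"
    by (rule image_mset_subseteq_mono)
  moreover have "inverse c * (inverse (al m) + c * be m) = be m + inverse c * inverse (al m)" for m
    using c by (simp add: algebra_simps)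
  moreover have "inverse c * (c * x) = x" for x using c by simp
  ultimately show ?thesis by (simp add: multiset.map_comp o_def)
qed

text \<open>With \<open>A\<close> empty the required values are the same for all centres on a side.
  If there are 1 + 4 of them, two centres suffice by the first symmetric function; if 1 + 3, one
  value is free and the second symmetric function is used at three centres.\<close>

lemma no_vertex_empty:
  assumes v: "\<not> v1" "\<not> v2" "\<not> v3" and A: "A = {}"
  shows False
proof -
  interpret b: config M be ga al B C A v2 v3 v1 by (rule rotate)
  interpret c: config M ga al be C A B v3 v1 v2 by (rule b.rotate)
  have s: "card B + card C = 6" using total v A by simp
  have "card B \<le> 5" "card C \<le> 5" using surj_card_le[OF finite_M b.covers] surj_card_le[OF finite_M c.covers] card_M by auto
  then have "B \<noteq> {}" "C \<noteq> {}" using s by auto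
  then have "card C \<le> 4" "card B \<le> 4" using b.card_pencil c.card_pencil by fastforce+
  then consider "card B = 2" "card C = 4" | "card B = 3" "card C = 3" | "card B = 4" "card C = 2" using s by linarith
  then show False
  proof cases
    case 1
    obtain t t' where t: "t \<in> B" "t' \<in> B" "t \<noteq> t'" using 1 by (metis card_2_iff insertI1 insertI2)
    have i: "card (inverse ` C) = 4" using 1 by (simp add: card_image inj_on_def)
    have cov: "inverse ` C \<subseteq> (\<lambda>m. inverse (ga m)) ` M" using c.covers by auto
    show False
    proof (rule pencil_4[OF card_M i cov _ t(3)])
      show "inverse (ga m) \<noteq> 0" if "m \<in> M" for m using nonzero that by simp
      show "add_mset 0 (mset_set (inverse ` C)) \<subseteq># image_mset (\<lambda>m. inverse (ga m) + x * al m) (mset_set M)"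
        if "x \<in> {t,t'}" for x using pencil_B_empty[OF A] t that by blast
    qed
  next
    case 2
    obtain t t' t'' where t: "B = {t,t',t''}" "t \<noteq> t'" "t' \<noteq> t''" "t \<noteq> t''" using 2 by (metis card_3_iff)
    have i: "card (inverse ` C) = 3" using 2 by (simp add: card_image inj_on_def)
    have cov: "inverse ` C \<subseteq> (\<lambda>m. inverse (ga m)) ` M" using c.covers by auto
    obtain U k l where "U \<noteq> 0" and *: "\<And>t. t \<in> B \<Longrightarrow> U + k * t + l * t\<^sup>2 = 0"
      using pencil_3[of M "inverse ` C" "\<lambda>m. inverse (ga m)" B al, OF card_M i cov _ pencil_B_empty[OF A]] nonzero(3)
      by (metis inverse_nonzero_iff_nonzero)
    then show False using quadratic_three_roots[of U k t l t' t''] t by auto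
  next
    case 3
    obtain t t' where t: "t \<in> C" "t' \<in> C" "t \<noteq> t'" using 3 by (metis card_2_iff insertI1 insertI2)
    then have ne: "inverse t \<noteq> inverse t'" by simp
    show False
    proof (rule pencil_4[OF card_M 3(1) b.covers nonzero(2) ne])
      show "add_mset 0 (mset_set B) \<subseteq># image_mset (\<lambda>m. be m + x * inverse (al m)) (mset_set M)"
        if "x \<in> {inverse t, inverse t'}" for x using pencil_C_empty[OF A] t that by blast
    qed
  qed
qed

text \<open>Each pencil bounds the sizes of the other two sets by 4. The three bounds add up to 12,
  twice the total, so all are attained and every pencil is tight.\<close>

lemma no_vertex:
  assumes v: "\<not> v1" "\<not> v2" "\<not> v3"
  shows False
proof -
  interpret b: config M be ga al B C A v2 v3 v1 by (rule rotate)
  interpret c: config M ga al be C A B v3 v1 v2 by (rule b.rotate)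
  have ne: "A \<noteq> {}" "B \<noteq> {}" "C \<noteq> {}"
    using no_vertex_empty b.no_vertex_empty c.no_vertex_empty v by blast+
  then have "card B + card C \<le> 4" "card C + card A \<le> 4" "card A + card B \<le> 4"
    using card_pencil b.card_pencil c.card_pencil by fastforce+
  moreover have "card A + card B + card C = 6" using total v by simp
  ultimately have cards: "card A = 2" "card B = 2" "card C = 2" by linarith+
  have "tight_pencil M A B C be ga" unfolding tight_pencil_def
    using subset_mset_eq_size[OF pencil_A] v(1) card_M cards by simp
  moreover have "tight_pencil M B C A ga al" unfolding tight_pencil_def
    using subset_mset_eq_size[OF pencil_B] v(2) card_M cards by simp
  moreover have "tight_pencil M C A B al be" unfolding tight_pencil_def
    using subset_mset_eq_size[OF pencil_C] v(3) card_M cards by simp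
  ultimately interpret balanced M al be ga A B C
    by unfold_locales (use card_M cards zero_A zero_B zero_C prod inj in auto)
  show False by (rule contradiction)
qed

lemma vertex_values:
  assumes "v1" "CARD('a) = 5"
  obtains f where "image_mset al (mset_set M) = {#1,2,3,4,f#}" "A \<subseteq> {f}"
proof -
  have cA: "card A \<le> 1" using card_vertex assms by simp
  have *: "{#1,2,3,4#} + mset_set A \<subseteq># image_mset al (mset_set M)"
    using vertex_A[OF assms(1)] field_of_order_5(2)[OF assms(2)] by simp
  show thesis
  proof (cases "A = {}")
    case True
    with * have "{#1,2,3,4#} \<subseteq># image_mset al (mset_set M)" by simp
    then obtain f where "image_mset al (mset_set M) = add_mset f {#1,2,3,4#}"
      by (rule subset_mset_Suc_size) (simp add: card_M)
    then show thesis using that[of f] True by (simp add: add_mset_commute)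
  next
    case False
    then have "card A = 1" using cA by (simp add: card_gt_0_iff le_Suc_eq)
    then obtain f where "A = {f}" by (meson card_1_singletonE)
    then show thesis using that[of f] subset_mset_eq_size[OF *] card_M by (simp add: add_mset_commute)
  qed
qed

text \<open>The values of \<open>al\<close> are 1, 2, 3, 4 and one more, so their second symmetric
  function, and that of their inverses, is a multiple of 5. The quadratic of \<open>pencil_3\<close>
  thus becomes linear, and two centres do the work of three.\<close>

lemma one_vertex:
  assumes v: "v1" "\<not> v2" "\<not> v3" and q: "CARD('a) = 5"
  shows False
proof -
  interpret b: config M be ga al B C A v2 v3 v1 by (rule rotate)
  interpret c: config M ga al be C A B v3 v1 v2 by (rule b.rotate)
  note F = field_of_order_5[OF q]
  have cA: "card A \<le> 1" using card_vertex v q by simp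
  \<comment> \<open>A centre in \<open>A\<close> would give \<open>card B + card C \<le> 3\<close>,
    whereas \<open>card A \<le> 1\<close> leaves at least 4 for \<open>B\<close> and
    \<open>C\<close>.\<close>
  have A: "A = {}"
  proof (rule ccontr)
    assume "A \<noteq> {}"
    then show False using card_pencil total cA v by fastforce
  qed
  have "card B + card C = 5" "card B < 4" "card C < 4" using total A v side_B side_C q by auto
  then consider "card B = 2" "card C = 3" | "card B = 3" "card C = 2" by linarith
  then show False
  proof cases
    case 1
    obtain t t' where t: "t \<in> B" "t' \<in> B" "t \<noteq> t'" using 1 by (metis card_2_iff insertI1 insertI2)
    have i: "card (inverse ` C) = 3" using 1 by (simp add: card_image inj_on_def)
    have cov: "inverse ` C \<subseteq> (\<lambda>m. inverse (ga m)) ` M" using c.covers by auto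
    have nz: "\<And>m. m \<in> M \<Longrightarrow> inverse (ga m) \<noteq> 0" using nonzero by simp
    obtain m1 m2 m3 m4 m5 U k where m: "distinct [m1,m2,m3,m4,m5]" "M = {m1,m2,m3,m4,m5}" "U \<noteq> 0"
      and *: "\<And>t. t \<in> B \<Longrightarrow> U + k * t + (al m1*al m2+al m1*al m3+al m1*al m4+al m1*al m5+al m2*al m3+al m2*al m4+al m2*al m5+al m3*al m4+al m3*al m5+al m4*al m5) * t\<^sup>2 = 0"
      using pencil_3[of M "inverse ` C" "\<lambda>m. inverse (ga m)" B al, OF card_M i cov nz pencil_B_empty[OF A]] by metis
    obtain f where f: "image_mset al (mset_set M) = {#1,2,3,4,f#}" using vertex_values v q by metis
    have "{#al m1, al m2, al m3, al m4, al m5#} = {#1,2,3,4,f#}" using f m mset_set_5[OF m(1)] by simp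
    from symmetric_functions_5(2)[OF this]
    have "al m1*al m2+al m1*al m3+al m1*al m4+al m1*al m5+al m2*al m3+al m2*al m4+al m2*al m5+al m3*al m4+al m3*al m5+al m4*al m5
       = 5 * (7 + 2*f)" by (simp add: algebra_simps)
    then show False using linear_two_roots[of U k t t'] * t m(3) F(1) by simp
  next
    case 2
    obtain t t' where t: "t \<in> C" "t' \<in> C" "t \<noteq> t'" using 2 by (metis card_2_iff insertI1 insertI2)
    have p: "\<And>t. t \<in> inverse ` C \<Longrightarrow> add_mset 0 (mset_set B) \<subseteq># image_mset (\<lambda>m. be m + t * inverse (al m)) (mset_set M)"
      using pencil_C_empty[OF A] by auto
    obtain m1 m2 m3 m4 m5 U k where m: "distinct [m1,m2,m3,m4,m5]" "M = {m1,m2,m3,m4,m5}" "U \<noteq> 0"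
      and *: "\<And>t. t \<in> inverse ` C \<Longrightarrow> U + k * t + (inverse (al m1)*inverse (al m2)+inverse (al m1)*inverse (al m3)+inverse (al m1)*inverse (al m4)+inverse (al m1)*inverse (al m5)+inverse (al m2)*inverse (al m3)+inverse (al m2)*inverse (al m4)+inverse (al m2)*inverse (al m5)+inverse (al m3)*inverse (al m4)+inverse (al m3)*inverse (al m5)+inverse (al m4)*inverse (al m5)) * t\<^sup>2 = 0"
      using pencil_3[of M B be "inverse ` C" "\<lambda>m. inverse (al m)", OF card_M 2(1) b.covers nonzero(2) p] by metis
    obtain f where f: "image_mset al (mset_set M) = {#1,2,3,4,f#}" using vertex_values v q by metis
    have "image_mset inverse {#al m1, al m2, al m3, al m4, al m5#} = image_mset inverse {#1,2,3,4,f#}" using f m mset_set_5[OF m(1)] by simp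
    then have "{#inverse (al m1), inverse (al m2), inverse (al m3), inverse (al m4), inverse (al m5)#} = {#1,3,2,4,inverse f#}"
      by (simp add: F(3-5))
    from symmetric_functions_5(2)[OF this]
    have "inverse (al m1)*inverse (al m2)+inverse (al m1)*inverse (al m3)+inverse (al m1)*inverse (al m4)+inverse (al m1)*inverse (al m5)+inverse (al m2)*inverse (al m3)+inverse (al m2)*inverse (al m4)+inverse (al m2)*inverse (al m5)+inverse (al m3)*inverse (al m4)+inverse (al m3)*inverse (al m5)+inverse (al m4)*inverse (al m5)
       = 5 * (7 + 2*inverse f)" by (simp add: algebra_simps)
    then show False using linear_two_roots[of U k "inverse t" "inverse t'"] *[of "inverse t"] *[of "inverse t'"] t m(3) F(1) by simp
  qed
qed

text \<open>The nonzero elements of the field of order 5 sum to 0, and inversion permutes them, so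
  only the repeated value contributes.\<close>

lemma pencil_sum_5:
  assumes v: "v1" "v2" and q: "CARD('a) = 5"
  shows "b \<in> B \<Longrightarrow> (\<Sum>m\<in>M. inverse (be m)) = inverse b"
    "a \<in> A \<Longrightarrow> (\<Sum>m\<in>M. al m) = a"
proof -
  interpret b: config M be ga al B C A v2 v3 v1 by (rule rotate)
  note F = field_of_order_5[OF q]
  show "(\<Sum>m\<in>M. al m) = a" if "a \<in> A"
  proof -
    obtain f where f: "image_mset al (mset_set M) = {#1,2,3,4,f#}" "A \<subseteq> {f}" using vertex_values v q by metis
    have "(\<Sum>m\<in>M. al m) = 2*5 + f" unfolding sum_unfold_sum_mset f(1) by simp
    then show ?thesis using F(1) f(2) that by auto
  qed
  show "(\<Sum>m\<in>M. inverse (be m)) = inverse b" if "b \<in> B"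
  proof -
    obtain f where f: "image_mset be (mset_set M) = {#1,2,3,4,f#}" "B \<subseteq> {f}" using b.vertex_values v q by metis
    have "(\<Sum>m\<in>M. inverse (be m)) = sum_mset (image_mset inverse (image_mset be (mset_set M)))"
      unfolding sum_unfold_sum_mset by (simp add: multiset.map_comp o_def)
    also have "\<dots> = 2*5 + inverse f" unfolding f(1) by (simp add: F(3-5))
    finally show ?thesis using F(1) f(2) that by auto
  qed
qed

text \<open>The sizes must be 1, 1, 2, and the pencils from \<open>A\<close> and \<open>B\<close>
  are tight. As in the balanced case three values of \<open>ga\<close> have equal cubes; but
  \<open>x^4 = 1\<close> makes cubing injective, so they coincide and
  \<open>3 * x\<^sup>2 = 0\<close>.\<close>

lemma two_vertices:
  assumes v: "v1" "v2" "\<not> v3" and q: "CARD('a) = 5"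
  shows False
proof -
  interpret b: config M be ga al B C A v2 v3 v1 by (rule rotate)
  interpret c: config M ga al be C A B v3 v1 v2 by (rule b.rotate)
  note F = field_of_order_5[OF q]
  have "card A \<le> 1" "card B \<le> 1" "card C \<le> 2" using card_vertex b.card_vertex v q side_C by auto
  moreover have "card A + card B + card C = 4" using total v by simp
  ultimately have cards: "card A = 1" "card B = 1" "card C = 2" by linarith+
  obtain a b where ab: "A = {a}" "B = {b}" using cards by (metis card_1_singletonE)
  have nz: "a \<noteq> 0" "b \<noteq> 0" using zero_A zero_B ab by auto
  have "image_mset (\<lambda>m. inverse (be m) + a * ga m) (mset_set M)
     = replicate_mset (1 + of_bool v1) 0 + image_mset inverse (mset_set B) + image_mset ((*) a) (mset_set C)"
    by (rule subset_mset_eq_size[OF pencil_A]) (use ab card_M cards v in auto)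
  then have "(\<Sum>m\<in>M. inverse (be m) + a * ga m) = inverse b + (\<Sum>c\<in>C. a * c)"
    using v by (simp add: sum_unfold_sum_mset ab)
  then have "(\<Sum>m\<in>M. inverse (be m)) + a * (\<Sum>m\<in>M. ga m) = inverse b + a * \<Sum>C"
    by (simp only: sum.distrib sum_distrib_left)
  then have s1: "(\<Sum>m\<in>M. ga m) = \<Sum>C" using pencil_sum_5[OF v(1,2) q] nz ab by simp
  have "image_mset (\<lambda>m. inverse (ga m) + b * al m) (mset_set M)
     = replicate_mset (1 + of_bool v2) 0 + image_mset inverse (mset_set C) + image_mset ((*) b) (mset_set A)"
    by (rule subset_mset_eq_size[OF pencil_B]) (use ab card_M cards v in auto)
  then have "(\<Sum>m\<in>M. inverse (ga m) + b * al m) = (\<Sum>c\<in>C. inverse c) + b * a"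
    using v by (simp add: sum_unfold_sum_mset ab)
  then have "(\<Sum>m\<in>M. inverse (ga m)) + b * (\<Sum>m\<in>M. al m) = (\<Sum>c\<in>C. inverse c) + b * a"
    by (simp only: sum.distrib sum_distrib_left)
  then have s2: "(\<Sum>m\<in>M. inverse (ga m)) = (\<Sum>c\<in>C. inverse c)"
    using pencil_sum_5[OF v(1,2) q] ab by simp
  obtain c1 c2 where c: "C = {c1,c2}" "c1 \<noteq> c2" using cards(3) by (meson card_2_iff)
  obtain m1 m2 where m: "m1 \<in> M" "m2 \<in> M" "ga m1 = c1" "ga m2 = c2"
  proof -
    have "c1 \<in> ga ` M" "c2 \<in> ga ` M" using c.covers c by auto
    then show thesis using that by auto
  qed
  then have "m1 \<noteq> m2" using c by auto
  then obtain m3 m4 m5 where d: "distinct [m1,m2,m3,m4,m5]" "M = {m1,m2,m3,m4,m5}"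
    using card_5_pairE card_M m by metis
  have 1: "ga m3 + ga m4 + ga m5 = 0" using s1 d c m by (simp add: add.assoc)
  have "inverse (ga m3) + inverse (ga m4) + inverse (ga m5) = 0" using s2 d c m by (simp add: add.assoc)
  then have 2: "ga m3 * ga m4 + ga m3 * ga m5 + ga m4 * ga m5 = 0"
    using nonzero(3) d by (simp add: field_simps)
  define x y where xy: "x = ga m3" "y = ga m4"
  have xy0: "x \<noteq> 0" "y \<noteq> 0" using nonzero d xy by auto
  have 3: "x\<^sup>2 + x*y + y\<^sup>2 = 0" using 1 2 unfolding xy by algebra
  have "x^3 = y^3" using 3 by algebra
  moreover have "x^4 = y^4" using F(7) xy0 by simp
  ultimately have "x * y^3 = y * y^3" by (simp add: numeral_eq_Suc)
  then have "x = y" using xy0 by simp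
  then have "3 * x\<^sup>2 = 0" using 3 by (simp add: power2_eq_square)
  then have "(3::'a) = 0" using xy0 by simp
  then show False using F(6) by simp
qed

text \<open>From \<open>a\<close> the values 0, 0, \<open>inverse b\<close> and \<open>a * c\<close>
  are required, and comparing sums shows the fifth to be another 0. Then three points have
  \<open>al m = a\<close>, while \<open>vertex_A\<close> leaves room for two.\<close>

lemma three_vertices:
  assumes v: "v1" "v2" "v3" and q: "CARD('a) = 5"
  shows False
proof -
  interpret b: config M be ga al B C A v2 v3 v1 by (rule rotate)
  interpret c: config M ga al be C A B v3 v1 v2 by (rule b.rotate)
  note F = field_of_order_5[OF q]
  have "card A \<le> 1" "card B \<le> 1" "card C \<le> 1" using card_vertex b.card_vertex c.card_vertex v q by auto
  moreover have "card A + card B + card C = 3" using total v by simp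
  ultimately have cards: "card A = 1" "card B = 1" "card C = 1" by linarith+
  obtain a b c where abc: "A = {a}" "B = {b}" "C = {c}" using cards by (metis card_1_singletonE)
  obtain x where x: "image_mset (\<lambda>m. inverse (be m) + a * ga m) (mset_set M)
     = add_mset x (replicate_mset (1 + of_bool v1) 0 + image_mset inverse (mset_set B) + image_mset ((*) a) (mset_set C))"
    by (rule subset_mset_Suc_size[OF pencil_A]) (use abc card_M cards v in auto)
  then have "(\<Sum>m\<in>M. inverse (be m) + a * ga m) = x + (inverse b + a * c)"
    using v by (simp add: sum_unfold_sum_mset abc)
  then have "(\<Sum>m\<in>M. inverse (be m)) + a * (\<Sum>m\<in>M. ga m) = x + (inverse b + a * c)"
    by (simp only: sum.distrib sum_distrib_left)
  then have "x = 0" using pencil_sum_5(1)[OF v(1,2) q] c.pencil_sum_5(2)[OF v(3,1) q] abc by simp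
  then have "count (image_mset (\<lambda>m. inverse (be m) + a * ga m) (mset_set M)) 0 \<ge> 3" unfolding x using v by simp
  also have "count (image_mset (\<lambda>m. inverse (be m) + a * ga m) (mset_set M)) 0 = count (image_mset al (mset_set M)) a"
    unfolding count_image_mset_set[OF finite_M]
    by (rule arg_cong[where f = card]) (use pencil_zero in auto)
  also have "image_mset al (mset_set M) = mset_set (-{0}) + mset_set A"
    by (rule subset_mset_eq_size[OF vertex_A[OF v(1)]]) (use card_M cards q in \<open>simp add: card_nonzero\<close>)
  also have "count (mset_set (-{0}) + mset_set A) a \<le> 2"
    using abc by (simp add: count_mset_set')
  finally show False by simp
qed

lemma contradiction:
  assumes "CARD('a) \<noteq> 4"
  shows False
proof -
  interpret b: config M be ga al B C A v2 v3 v1 by (rule rotate)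
  interpret c: config M ga al be C A B v3 v1 v2 by (rule b.rotate)
  have v: "v1 \<or> v2 \<or> v3" using no_vertex by blast
  then have "CARD('a) \<le> 6" using card_vertex b.card_vertex c.card_vertex by linarith
  \<comment> \<open>Only \<open>(q - 1)\<^sup>2\<close> points lie off the triangle, and
    \<open>M\<close> needs five of them.\<close>
  moreover have "CARD('a) > 3"
  proof (rule ccontr)
    assume "\<not> ?thesis"
    then have "card (-{0::'a}) \<le> 2" by (simp add: card_nonzero)
    have "inj_on (\<lambda>m. (al m, be m)) M" using inj by (auto simp: inj_on_def)
    moreover have "(\<lambda>m. (al m, be m)) ` M \<subseteq> (-{0}) \<times> (-{0})" using nonzero by auto
    ultimately have "card M \<le> card ((-{0::'a}) \<times> (-{0::'a}))" by (intro card_inj_on_le) auto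
    also have "\<dots> \<le> 2 * 2" unfolding card_cartesian_product using \<open>card (-{0::'a}) \<le> 2\<close> by (intro mult_le_mono) auto
    finally show False using card_M by simp
  qed
  ultimately have q: "CARD('a) = 5" using no_field_of_order_6[where 'a='a] assms by linarith
  show False
    using v one_vertex b.one_vertex c.one_vertex two_vertices b.two_vertices c.two_vertices three_vertices q by blast
qed

end

section \<open>Coordinates\<close>

text \<open>Passing from \<open>pt\<close> to \<open>rot pt\<close> turns statements about the side
  \<open>x = 0\<close> and the vertex \<open>(1 : 0 : 0)\<close> into those about
  \<open>y = 0\<close> and \<open>(0 : 1 : 0)\<close>.\<close>

definition rot :: "('a \<Rightarrow> 'a \<Rightarrow> 'a \<Rightarrow> 'p) \<Rightarrow> 'a \<Rightarrow> 'a \<Rightarrow> 'a \<Rightarrow> 'p" where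
  "rot pt x y z = pt z x y"

lemma rot_rot_rot [simp]: "rot (rot (rot pt)) = pt"
  by (simp add: rot_def fun_eq_iff)

definition line :: "('a::field \<Rightarrow> 'a \<Rightarrow> 'a \<Rightarrow> 'p) \<Rightarrow> 'a \<Rightarrow> 'a \<Rightarrow> 'a \<Rightarrow> 'p set" where
  "line pt u v w = {pt x y z | x y z. (x,y,z) \<noteq> (0,0,0) \<and> u*x + v * y + w*z = 0}"

lemma rot_line: "line (rot pt) u v w = line pt w u v"
  unfolding line_def rot_def by (intro equalityI subsetI; clarsimp; metis add.assoc add.commute)

text \<open>For \<open>pt\<close>, \<open>rot pt\<close> and \<open>rot (rot pt)\<close> these are
  the functions \<open>al\<close>, \<open>be\<close>, \<open>ga\<close>. Off the triangle the ratio
  does not depend on the chosen representative, so the description is definite there.\<close>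

definition slope :: "('a::field \<Rightarrow> 'a \<Rightarrow> 'a \<Rightarrow> 'p) \<Rightarrow> 'p \<Rightarrow> 'a" where
  "slope pt m = (THE r. \<exists>x y z. x \<noteq> 0 \<and> y \<noteq> 0 \<and> z \<noteq> 0 \<and> m = pt x y z \<and> r = - z / y)"

definition side_set :: "('a::field \<Rightarrow> 'a \<Rightarrow> 'a \<Rightarrow> 'p) \<Rightarrow> 'p set \<Rightarrow> 'a set" where
  "side_set pt H = {a. a \<noteq> 0 \<and> pt 0 1 (-a) \<in> H}"

text \<open>Homogeneous coordinates are kept abstract so that \<open>rot pt\<close> is again an
  instance and one side stands for all three.\<close>

locale coordinates =
  fixes pt :: "'a::{field,finite} \<Rightarrow> 'a \<Rightarrow> 'a \<Rightarrow> 'p" and Pts T :: "'p set"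
  assumes pt_in: "(x,y,z) \<noteq> (0,0,0) \<Longrightarrow> pt x y z \<in> Pts"
    and pt_surj: "P \<in> Pts \<Longrightarrow> \<exists>x y z. (x,y,z) \<noteq> (0,0,0) \<and> P = pt x y z"
    and pt_eq: "(x,y,z) \<noteq> (0,0,0) \<Longrightarrow> (x',y',z') \<noteq> (0,0,0) \<Longrightarrow>
       pt x y z = pt x' y' z' \<longleftrightarrow> (\<exists>c. c \<noteq> 0 \<and> x' = c*x \<and> y' = c*y \<and> z' = c*z)"
    and T_def: "T = {pt x y z | x y z. (x,y,z) \<noteq> (0,0,0) \<and> x*y*z = 0}"
begin

lemma rotate: "coordinates (rot pt) Pts T"
proof
  show "rot pt x y z \<in> Pts" if "(x,y,z) \<noteq> (0,0,0)" for x y z using pt_in[of z x y] that by (auto simp: rot_def)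
  show "\<exists>x y z. (x,y,z) \<noteq> (0,0,0) \<and> P = rot pt x y z" if "P \<in> Pts" for P
  proof -
    obtain x y z where "(x,y,z) \<noteq> (0,0,0)" "P = pt x y z" using pt_surj \<open>P \<in> Pts\<close> by blast
    then have "(y,z,x) \<noteq> (0,0,0)" "P = rot pt y z x" by (auto simp: rot_def)
    then show ?thesis by blast
  qed
  show "rot pt x y z = rot pt x' y' z' \<longleftrightarrow> (\<exists>c. c \<noteq> 0 \<and> x' = c*x \<and> y' = c*y \<and> z' = c*z)"
    if "(x,y,z) \<noteq> (0,0,0)" "(x',y',z') \<noteq> (0,0,0)" for x y z x' y' z'
    using pt_eq[of z x y z' x' y'] that by (auto simp: rot_def)
  show "T = {rot pt x y z | x y z. (x,y,z) \<noteq> (0,0,0) \<and> x*y*z = 0}"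
    unfolding T_def rot_def by (intro equalityI subsetI; clarsimp; metis mult.commute mult_zero_left mult_zero_right)
qed

lemma mem_line: "(x,y,z) \<noteq> (0,0,0) \<Longrightarrow> pt x y z \<in> line pt u v w \<longleftrightarrow> u*x + v * y + w*z = 0"
proof
  assume nz: "(x,y,z) \<noteq> (0,0,0)" and "pt x y z \<in> line pt u v w"
  then obtain x' y' z' where *: "pt x y z = pt x' y' z'" "(x',y',z') \<noteq> (0,0,0)" "u*x'+v * y'+w*z' = 0"
    unfolding line_def by blast
  then obtain c where "c \<noteq> 0" "x' = c*x" "y' = c*y" "z' = c*z" using pt_eq nz by blast
  then have "c * (u*x + v * y + w*z) = 0" using * by (simp add: algebra_simps)
  then show "u*x + v * y + w*z = 0" using \<open>c \<noteq> 0\<close> by simp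
qed (auto simp: line_def)

lemma mem_T: "(x,y,z) \<noteq> (0,0,0) \<Longrightarrow> pt x y z \<in> T \<longleftrightarrow> x*y*z = 0"
proof
  assume nz: "(x,y,z) \<noteq> (0,0,0)" and "pt x y z \<in> T"
  then obtain x' y' z' where *: "pt x y z = pt x' y' z'" "(x',y',z') \<noteq> (0,0,0)" "x'*y'*z' = 0"
    unfolding T_def by blast
  then obtain c where "c \<noteq> 0" "x' = c*x" "y' = c*y" "z' = c*z" using pt_eq nz by blast
  then show "x*y*z = 0" using *(3) by auto
qed (auto simp: T_def)

lemma finite_Pts: "finite Pts"
proof -
  have "Pts \<subseteq> (\<lambda>(x,y,z). pt x y z) ` UNIV"
  proof
    fix P assume "P \<in> Pts"
    then obtain x y z where "P = pt x y z" using pt_surj by blast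
    then show "P \<in> (\<lambda>(x,y,z). pt x y z) ` UNIV" by (intro image_eqI[of _ _ "(x,y,z)"]) auto
  qed
  then show ?thesis by (rule finite_subset) simp
qed

lemma T_Pts: "T \<subseteq> Pts" unfolding T_def using pt_in by auto

lemma off_T:
  assumes "m \<in> Pts" "m \<notin> T"
  obtains x y z where "x \<noteq> 0" "y \<noteq> 0" "z \<noteq> 0" "m = pt x y z"
  using pt_surj[OF assms(1)] assms(2) mem_T by (metis mult_eq_0_iff)

lemma slope_eq:
  assumes "x \<noteq> 0" "y \<noteq> 0" "z \<noteq> 0"
  shows "slope pt (pt x y z) = - z / y"
  unfolding slope_def
proof (rule the_equality)
  show "\<exists>x' y' z'. x' \<noteq> 0 \<and> y' \<noteq> 0 \<and> z' \<noteq> 0 \<and> pt x y z = pt x' y' z' \<and> - z / y = - z' / y'"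
    using assms by blast
  fix r assume "\<exists>x' y' z'. x' \<noteq> 0 \<and> y' \<noteq> 0 \<and> z' \<noteq> 0 \<and> pt x y z = pt x' y' z' \<and> r = - z' / y'"
  then obtain x' y' z' where "y' \<noteq> 0" "pt x y z = pt x' y' z'" "r = - z' / y'" by blast
  moreover then obtain c where "c \<noteq> 0" "y' = c*y" "z' = c*z" using pt_eq[of x y z x' y' z'] assms by auto
  ultimately show "r = - z / y" using assms by simp
qed

lemma side_point_inj: "inj_on (\<lambda>a. pt 0 1 (-a)) S"
  using pt_eq by (auto simp: inj_on_def)

lemma T_pencil_vertex:
  assumes "a \<noteq> 0"
  shows "T \<inter> line pt 0 a 1 \<subseteq> {pt 1 0 0, pt 0 1 (-a)}"
proof
  fix P assume P: "P \<in> T \<inter> line pt 0 a 1"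
  then obtain x y z where nz: "(x,y,z) \<noteq> (0,0,0)" and e: "P = pt x y z" using pt_surj T_Pts by blast
  then have 1: "x*y*z = 0" "a*y + z = 0" using P mem_T[OF nz] mem_line[OF nz] by auto
  then have z: "z = - (a*y)" by (simp add: eq_neg_iff_add_eq_0 add.commute)
  show "P \<in> {pt 1 0 0, pt 0 1 (-a)}"
  proof (cases "y = 0")
    case True
    then have "z = 0" "x \<noteq> 0" using z nz by auto
    then have "pt 1 0 0 = pt x y z" using pt_eq[of 1 0 0 x y z] True by auto
    then show ?thesis using e by simp
  next
    case False
    then have "x = 0" using 1 z assms by auto
    then have "pt 0 1 (-a) = pt x y z" using pt_eq[of 0 1 "-a" x y z] False z by (auto simp: mult.commute)
    then show ?thesis using e by simp
  qed
qed

lemma T_pencil: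
  assumes "a \<noteq> 0" "t \<noteq> 0"
  shows "T \<inter> line pt t a 1 \<subseteq> {pt 0 1 (-a), pt (- inverse t) 0 1, pt 1 (-(t/a)) 0}"
proof
  fix P assume P: "P \<in> T \<inter> line pt t a 1"
  then obtain x y z where nz: "(x,y,z) \<noteq> (0,0,0)" and e: "P = pt x y z" using pt_surj T_Pts by blast
  then have 1: "x*y*z = 0" "t*x + a*y + z = 0" using P mem_T[OF nz] mem_line[OF nz] by auto
  then have z: "z = - (t*x) - a*y" by algebra
  consider "x = 0" | "y = 0" | "z = 0" using 1 by auto
  then show "P \<in> {pt 0 1 (-a), pt (- inverse t) 0 1, pt 1 (-(t/a)) 0}"
  proof cases
    case 1
    then have "y \<noteq> 0" using z nz by auto
    then have "pt 0 1 (-a) = pt x y z" using pt_eq[of 0 1 "-a" x y z] 1 z nz by (auto simp: mult.commute)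
    then show ?thesis using e by simp
  next
    case 2
    then have "z \<noteq> 0" using z nz assms by auto
    moreover have "x = z * - inverse t" using z 2 assms by simp
    ultimately have "pt (- inverse t) 0 1 = pt x y z" using pt_eq[of "- inverse t" 0 1 x y z] 2 nz by auto
    then show ?thesis using e by simp
  next
    case 3
    then have "a*y + t*x = 0" using z by algebra
    then have "a * (y + x * (t/a)) = 0" using assms by (simp add: algebra_simps)
    then have "y + x * (t/a) = 0" using assms(1) by simp
    then have y: "y = x * -(t/a)" by (simp add: eq_neg_iff_add_eq_0)
    then have "x \<noteq> 0" using 3 nz by auto
    then have "pt 1 (-(t/a)) 0 = pt x y z" using pt_eq[of 1 "-(t/a)" 0 x y z] 3 nz y by auto
    then show ?thesis using e by simp
  qed
qed

lemma T_side: "T \<inter> line pt 1 0 0 = {pt 0 1 0, pt 0 0 1} \<union> (\<lambda>a. pt 0 1 (-a)) ` (-{0})"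
proof (intro equalityI subsetI)
  fix P assume P: "P \<in> T \<inter> line pt 1 0 0"
  then obtain x y z where nz: "(x,y,z) \<noteq> (0,0,0)" and e: "P = pt x y z" using pt_surj T_Pts by blast
  then have x: "x = 0" using P mem_line[OF nz] by auto
  consider "y = 0" | "z = 0" "y \<noteq> 0" | "y \<noteq> 0" "z \<noteq> 0" by blast
  then show "P \<in> {pt 0 1 0, pt 0 0 1} \<union> (\<lambda>a. pt 0 1 (-a)) ` (-{0})"
  proof cases
    case 1
    then have "pt 0 0 1 = P" using pt_eq[of 0 0 1 x y z] x nz e by auto
    then show ?thesis by simp
  next
    case 2
    then have "pt 0 1 0 = P" using pt_eq[of 0 1 0 x y z] x nz e by auto
    then show ?thesis by simp
  next
    case 3
    then have "P = pt 0 1 (-(-z/y))" "-z/y \<noteq> 0" using pt_eq[of 0 1 "z/y" x y z] x nz e by auto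
    then show ?thesis by blast
  qed
next
  fix P assume "P \<in> {pt 0 1 0, pt 0 0 1} \<union> (\<lambda>a. pt 0 1 (-a)) ` (-{0})"
  then show "P \<in> T \<inter> line pt 1 0 0" using mem_T mem_line by auto
qed

lemma card_subset_T:
  assumes H: "H \<subseteq> T"
  shows "card H = card (side_set pt H) + card (side_set (rot pt) H) + card (side_set (rot (rot pt)) H)
     + of_bool (pt 1 0 0 \<in> H) + of_bool (pt 0 1 0 \<in> H) + of_bool (pt 0 0 1 \<in> H)"
proof -
  interpret r: coordinates "rot pt" Pts T by (rule rotate)
  interpret s: coordinates "rot (rot pt)" Pts T by (rule r.rotate)
  have finite_H: "finite H" using H T_Pts finite_Pts by (meson finite_subset)
  let ?p = "\<lambda>a. pt 0 1 (-a)" and ?q = "\<lambda>a. pt (-a) 0 1" and ?r = "\<lambda>a. pt 1 (-a) 0"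
  let ?A = "side_set pt H" and ?B = "side_set (rot pt) H" and ?C = "side_set (rot (rot pt)) H"
  let ?V = "H \<inter> {pt 1 0 0, pt 0 1 0, pt 0 0 1}"
  have T: "T \<subseteq> {pt 1 0 0, pt 0 1 0, pt 0 0 1} \<union> ?p ` (-{0}) \<union> ?q ` (-{0}) \<union> ?r ` (-{0})"
  proof
    fix P assume P: "P \<in> T"
    then obtain x y z where nz: "(x,y,z) \<noteq> (0,0,0)" and e: "P = pt x y z" using pt_surj T_Pts by blast
    then have "x*y*z = 0" using P mem_T[OF nz] by simp
    then have "P \<in> T \<inter> line pt 1 0 0 \<or> P \<in> T \<inter> line (rot pt) 1 0 0 \<or> P \<in> T \<inter> line (rot (rot pt)) 1 0 0"
      using P mem_line[OF nz] by (auto simp: e rot_line)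
    then show "P \<in> {pt 1 0 0, pt 0 1 0, pt 0 0 1} \<union> ?p ` (-{0}) \<union> ?q ` (-{0}) \<union> ?r ` (-{0})"
      unfolding T_side r.T_side s.T_side unfolding rot_def by blast
  qed
  have dec: "H = ?V \<union> ?p ` ?A \<union> ?q ` ?B \<union> ?r ` ?C"
  proof (intro equalityI subsetI)
    fix P assume "P \<in> H"
    moreover then have "P \<in> {pt 1 0 0, pt 0 1 0, pt 0 0 1} \<union> ?p ` (-{0}) \<union> ?q ` (-{0}) \<union> ?r ` (-{0})"
      using T H by blast
    ultimately show "P \<in> ?V \<union> ?p ` ?A \<union> ?q ` ?B \<union> ?r ` ?C" by (auto simp: side_set_def rot_def)
  qed (auto simp: side_set_def rot_def)
  have ne: "pt 1 0 0 \<noteq> pt 0 1 0" "pt 1 0 0 \<noteq> pt 0 0 1" "pt 0 1 0 \<noteq> pt 0 0 1"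
    using pt_eq[of 1 0 0 0 1 0] pt_eq[of 1 0 0 0 0 1] pt_eq[of 0 1 0 0 0 1] by auto
  have V: "card ?V = of_bool (pt 1 0 0 \<in> H) + of_bool (pt 0 1 0 \<in> H) + of_bool (pt 0 0 1 \<in> H)"
    using ne by (auto simp: Int_insert_right)
  have d: "?V \<inter> ?p ` ?A = {}" "(?V \<union> ?p ` ?A) \<inter> ?q ` ?B = {}" "(?V \<union> ?p ` ?A \<union> ?q ` ?B) \<inter> ?r ` ?C = {}"
    by (auto simp: side_set_def pt_eq)
  have inj: "inj_on ?p X" "inj_on ?q X" "inj_on ?r X" for X
    using side_point_inj r.side_point_inj s.side_point_inj by (auto simp: rot_def)
  have "card H = card (?V \<union> ?p ` ?A \<union> ?q ` ?B \<union> ?r ` ?C)" using dec by simp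
  also have "\<dots> = card (?V \<union> ?p ` ?A \<union> ?q ` ?B) + card (?r ` ?C)"
    by (rule card_Un_disjoint) (use finite_H d in auto)
  also have "card (?V \<union> ?p ` ?A \<union> ?q ` ?B) = card (?V \<union> ?p ` ?A) + card (?q ` ?B)"
    by (rule card_Un_disjoint) (use finite_H d in auto)
  also have "card (?V \<union> ?p ` ?A) = card ?V + card (?p ` ?A)"
    by (rule card_Un_disjoint) (use finite_H d in auto)
  finally show ?thesis using V by (simp add: card_image inj)
qed

lemma card_T: "card T = 3 * CARD('a)"
proof -
  interpret r: coordinates "rot pt" Pts T by (rule rotate)
  interpret s: coordinates "rot (rot pt)" Pts T by (rule r.rotate)
  have "side_set pt T = -{0}" "side_set (rot pt) T = -{0}" "side_set (rot (rot pt)) T = -{0}"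
    using mem_T r.mem_T s.mem_T by (auto simp: side_set_def)
  moreover obtain n where "CARD('a) = Suc n" using gr0_implies_Suc[OF zero_less_card_finite] by blast
  ultimately show ?thesis using card_subset_T[of T] mem_T by (simp add: card_nonzero)
qed

end

section \<open>From the blocking property to multiset inclusions\<close>

locale modified_triangle = coordinates pt Pts T
  for pt :: "'a::{field,finite} \<Rightarrow> 'a \<Rightarrow> 'a \<Rightarrow> 'p" and Pts T +
  fixes H M :: "'p set"
  assumes H: "H \<subseteq> T" "card H = 6"
    and M: "M \<subseteq> Pts" "M \<inter> T = {}" "card M = 5"
    and blocking: "(u,v,w) \<noteq> (0,0,0) \<Longrightarrow> 2 \<le> card (((T - H) \<union> M) \<inter> line pt u v w)"
begin

lemma rotate_modified: "modified_triangle (rot pt) Pts T H M"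
proof -
  interpret r: coordinates "rot pt" Pts T by (rule rotate)
  show ?thesis
    by unfold_locales (use H M in \<open>auto simp: rot_line intro!: blocking\<close>)
qed

lemma finite_M: "finite M" and finite_H: "finite H" and finite_T: "finite T"
  using finite_Pts M H T_Pts by (auto intro: finite_subset)

text \<open>In the applications \<open>X\<close> lists the two or three points in which the line can
  meet the triangle; what \<open>H\<close> takes from them has to be made up by
  \<open>M\<close>.\<close>

lemma card_M_line:
  assumes "(u,v,w) \<noteq> (0,0,0)" "T \<inter> line pt u v w \<subseteq> X" "finite X"
  shows "2 \<le> card (X - H) + card (M \<inter> line pt u v w)"
proof -
  have "2 \<le> card (((T - H) \<union> M) \<inter> line pt u v w)" by (rule blocking[OF assms(1)])
  also have "\<dots> \<le> card ((X - H) \<union> (M \<inter> line pt u v w))"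
    by (rule card_mono) (use assms finite_M in auto)
  also have "\<dots> \<le> card (X - H) + card (M \<inter> line pt u v w)" by (rule card_Un_le)
  finally show ?thesis .
qed

lemma coords_M:
  assumes "m \<in> M"
  obtains x y z where "x \<noteq> 0" "y \<noteq> 0" "z \<noteq> 0" "m = pt x y z"
    "slope pt m = - z / y" "slope (rot pt) m = - x / z" "slope (rot (rot pt)) m = - y / x"
proof -
  interpret r: coordinates "rot pt" Pts T by (rule rotate)
  interpret s: coordinates "rot (rot pt)" Pts T by (rule r.rotate)
  obtain x y z where *: "x \<noteq> 0" "y \<noteq> 0" "z \<noteq> 0" "m = pt x y z" using off_T assms M by blast
  moreover have "m = rot pt y z x" "m = rot (rot pt) z x y" using * by (simp_all add: rot_def)
  ultimately show thesis using that slope_eq r.slope_eq s.slope_eq by metis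
qed

text \<open>The multiplicity of the value \<open>t\<close> is the number of points of
  \<open>M\<close> on the line \<open>t x + a y + z = 0\<close>, whose point on \<open>x = 0\<close>
  is removed. For nonzero \<open>t\<close> two other points of the triangle are left, so
  \<open>M\<close> supplies one point for each of them in \<open>H\<close>. For \<open>t = 0\<close>
  only a vertex is left, and \<open>M\<close> supplies one point more.\<close>

lemma pencil:
  assumes a: "a \<in> side_set pt H"
  shows "replicate_mset (1 + of_bool (pt 1 0 0 \<in> H)) 0 + image_mset inverse (mset_set (side_set (rot pt) H))
        + image_mset ((*) a) (mset_set (side_set (rot (rot pt)) H))
     \<subseteq># image_mset (\<lambda>m. inverse (slope (rot pt) m) + a * slope (rot (rot pt)) m) (mset_set M)"
proof (rule mset_subset_eqI)
  fix t
  have a0: "a \<noteq> 0" and aH: "pt 0 1 (-a) \<in> H" using a by (auto simp: side_set_def)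
  have "count (image_mset (\<lambda>m. inverse (slope (rot pt) m) + a * slope (rot (rot pt)) m) (mset_set M)) t
     = card {m\<in>M. inverse (slope (rot pt) m) + a * slope (rot (rot pt)) m = t}"
    by (rule count_image_mset_set[OF finite_M])
  also have "{m\<in>M. inverse (slope (rot pt) m) + a * slope (rot (rot pt)) m = t} = M \<inter> line pt t a 1"
  proof -
    have "inverse (slope (rot pt) m) + a * slope (rot (rot pt)) m = t \<longleftrightarrow> m \<in> line pt t a 1" if mM: "m \<in> M" for m
    proof -
      obtain x y z where *: "x \<noteq> 0" "y \<noteq> 0" "z \<noteq> 0" "m = pt x y z"
        "slope (rot pt) m = - x / z" "slope (rot (rot pt)) m = - y / x" by (rule coords_M[OF mM])
      have "m \<in> line pt t a 1 \<longleftrightarrow> t*x + a*y + z = 0" using mem_line[of x y z t a 1] * by simp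
      also have "\<dots> \<longleftrightarrow> inverse (- x / z) + a * (- y / x) = t"
      proof -
        have "x * (inverse (- x / z) + a * (- y / x) - t) = - (t*x + a*y + z)" using *(1-3) by (simp add: field_simps)
        then show ?thesis using *(1) by (metis eq_iff_diff_eq_0 mult_eq_0_iff neg_equal_0_iff_equal)
      qed
      finally show ?thesis using * by simp
    qed
    then show ?thesis by auto
  qed
  finally have R: "count (image_mset (\<lambda>m. inverse (slope (rot pt) m) + a * slope (rot (rot pt)) m) (mset_set M)) t
     = card (M \<inter> line pt t a 1)" .
  have b: "count (image_mset inverse (mset_set (side_set (rot pt) H))) t = of_bool (inverse t \<in> side_set (rot pt) H)"
  proof -
    have "image_mset inverse (mset_set (side_set (rot pt) H)) = mset_set (inverse ` side_set (rot pt) H)"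
      by (rule image_mset_mset_set) (simp add: inj_on_def)
    moreover have "t \<in> inverse ` side_set (rot pt) H \<longleftrightarrow> inverse t \<in> side_set (rot pt) H"
      by (metis image_iff inverse_inverse_eq)
    ultimately show ?thesis by (simp add: count_mset_set')
  qed
  have c: "count (image_mset ((*) a) (mset_set (side_set (rot (rot pt)) H))) t = of_bool (t/a \<in> side_set (rot (rot pt)) H)"
  proof -
    have "image_mset ((*) a) (mset_set (side_set (rot (rot pt)) H)) = mset_set ((*) a ` side_set (rot (rot pt)) H)"
      by (rule image_mset_mset_set) (simp add: inj_on_def a0)
    moreover have "t \<in> (*) a ` side_set (rot (rot pt)) H \<longleftrightarrow> t/a \<in> side_set (rot (rot pt)) H"
      using a0 by (auto simp: image_iff intro!: bexI[of _ "t/a"])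
    ultimately show ?thesis by (simp add: count_mset_set')
  qed
  have "count (replicate_mset (1 + of_bool (pt 1 0 0 \<in> H)) 0 + image_mset inverse (mset_set (side_set (rot pt) H))
        + image_mset ((*) a) (mset_set (side_set (rot (rot pt)) H))) t
     = (if t = 0 then 1 + of_bool (pt 1 0 0 \<in> H) else 0) + of_bool (inverse t \<in> side_set (rot pt) H) + of_bool (t/a \<in> side_set (rot (rot pt)) H)"
    using b c by (auto simp: count_replicate_mset)
  also have "\<dots> \<le> card (M \<inter> line pt t a 1)"
  proof (cases "t = 0")
    case True
    have "2 \<le> card ({pt 1 0 0, pt 0 1 (-a)} - H) + card (M \<inter> line pt 0 a 1)"
      by (rule card_M_line[OF _ T_pencil_vertex[OF a0]]) auto
    also have "card ({pt 1 0 0, pt 0 1 (-a)} - H) \<le> card (if pt 1 0 0 \<in> H then {} else {pt 1 0 0})"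
      by (rule card_mono) (use aH in auto)
    finally show ?thesis using True by (auto simp: side_set_def split: if_splits)
  next
    case False
    let ?Q = "pt (- inverse t) 0 1" and ?R = "pt 1 (-(t/a)) 0"
    have q: "inverse t \<in> side_set (rot pt) H \<longleftrightarrow> ?Q \<in> H" "t/a \<in> side_set (rot (rot pt)) H \<longleftrightarrow> ?R \<in> H"
      using False a0 by (auto simp: side_set_def rot_def)
    have "2 \<le> card ({pt 0 1 (-a), ?Q, ?R} - H) + card (M \<inter> line pt t a 1)"
      by (rule card_M_line[OF _ T_pencil[OF a0 False]]) auto
    also have "card ({pt 0 1 (-a), ?Q, ?R} - H) \<le> card ((if ?Q \<in> H then {} else {?Q}) \<union> (if ?R \<in> H then {} else {?R}))"
      by (rule card_mono) (use aH in auto)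
    also have "\<dots> \<le> card (if ?Q \<in> H then {} else {?Q}) + card (if ?R \<in> H then {} else {?R})"
      by (rule card_Un_le)
    finally show ?thesis using False q by (auto split: if_splits)
  qed
  finally show "count (replicate_mset (1 + of_bool (pt 1 0 0 \<in> H)) 0 + image_mset inverse (mset_set (side_set (rot pt) H))
        + image_mset ((*) a) (mset_set (side_set (rot (rot pt)) H))) t
     \<le> count (image_mset (\<lambda>m. inverse (slope (rot pt) m) + a * slope (rot (rot pt)) m) (mset_set M)) t"
    unfolding R .
qed

lemma vertex:
  assumes v: "pt 1 0 0 \<in> H"
  shows "mset_set (-{0}) + mset_set (side_set pt H) \<subseteq># image_mset (slope pt) (mset_set M)"
proof (rule mset_subset_eqI)
  fix t
  show "count (mset_set (-{0}) + mset_set (side_set pt H)) t \<le> count (image_mset (slope pt) (mset_set M)) t"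
  proof (cases "t = 0")
    case True
    then show ?thesis by (simp add: side_set_def)
  next
    case False
    have "slope pt m = t \<longleftrightarrow> m \<in> line pt 0 t 1" if mM: "m \<in> M" for m
    proof -
      obtain x y z where *: "x \<noteq> 0" "y \<noteq> 0" "z \<noteq> 0" "m = pt x y z" "slope pt m = - z / y" by (rule coords_M[OF mM])
      have "m \<in> line pt 0 t 1 \<longleftrightarrow> t*y + z = 0" using mem_line[of x y z 0 t 1] * by simp
      moreover have "y * (- z / y - t) = - (t*y + z)" using *(2) by (simp add: algebra_simps)
      then have "- z / y = t \<longleftrightarrow> t*y + z = 0"
        using *(2) by (metis eq_iff_diff_eq_0 mult_eq_0_iff neg_equal_0_iff_equal)
      ultimately show ?thesis using *(5) by simp
    qed
    then have "{m\<in>M. slope pt m = t} = M \<inter> line pt 0 t 1" by auto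
    then have R: "count (image_mset (slope pt) (mset_set M)) t = card (M \<inter> line pt 0 t 1)"
      by (simp add: count_image_mset_set[OF finite_M])
    have "2 \<le> card ({pt 1 0 0, pt 0 1 (-t)} - H) + card (M \<inter> line pt 0 t 1)"
      by (rule card_M_line[OF _ T_pencil_vertex[OF False]]) auto
    also have "card ({pt 1 0 0, pt 0 1 (-t)} - H) \<le> card (if pt 0 1 (-t) \<in> H then {} else {pt 0 1 (-t)})"
      by (rule card_mono) (use v in auto)
    finally show ?thesis unfolding R using False by (auto simp: side_set_def count_mset_set' split: if_splits)
  qed
qed

lemma side_bound: "card (side_set pt H) + of_bool (pt 0 1 0 \<in> H) + of_bool (pt 0 0 1 \<in> H) < CARD('a)"
proof -
  let ?p = "\<lambda>a. pt 0 1 (-a)"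
  have "M \<inter> line pt 1 0 0 = {}"
  proof -
    have "m \<notin> line pt 1 0 0" if mM: "m \<in> M" for m
    proof -
      obtain x y z where *: "x \<noteq> 0" "m = pt x y z" by (rule coords_M[OF mM])
      then show ?thesis using mem_line[of x y z 1 0 0] by auto
    qed
    then show ?thesis by auto
  qed
  then have "((T - H) \<union> M) \<inter> line pt 1 0 0 = (T \<inter> line pt 1 0 0) - H" by auto
  then have "2 \<le> card ((T \<inter> line pt 1 0 0) - H)" using blocking[of 1 0 0] by simp
  also have "(T \<inter> line pt 1 0 0) - H \<subseteq> (if pt 0 1 0 \<in> H then {} else {pt 0 1 0}) \<union> (if pt 0 0 1 \<in> H then {} else {pt 0 0 1})
      \<union> ?p ` (-{0} - side_set pt H)" unfolding T_side side_set_def by auto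
  then have "card ((T \<inter> line pt 1 0 0) - H) \<le> card \<dots>" by (rule card_mono[rotated]) simp
  also have "\<dots> \<le> card ((if pt 0 1 0 \<in> H then {} else {pt 0 1 0}) \<union> (if pt 0 0 1 \<in> H then {} else {pt 0 0 1}))
      + card (?p ` (-{0} - side_set pt H))" by (rule card_Un_le)
  also have "\<dots> \<le> card (if pt 0 1 0 \<in> H then {} else {pt 0 1 0}) + card (if pt 0 0 1 \<in> H then {} else {pt 0 0 1})
      + card (-{0} - side_set pt H)"
    by (intro add_mono card_Un_le card_image_le) simp
  also have "card (-{0} - side_set pt H) = CARD('a) - 1 - card (side_set pt H)"
    by (subst card_Diff_subset) (auto simp: side_set_def card_nonzero)
  finally have "2 \<le> card (if pt 0 1 0 \<in> H then {} else {pt 0 1 0}) + card (if pt 0 0 1 \<in> H then {} else {pt 0 0 1})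
      + (CARD('a) - 1 - card (side_set pt H))" .
  moreover have "card (side_set pt H) \<le> CARD('a) - 1"
    unfolding card_nonzero[symmetric] by (rule card_mono) (auto simp: side_set_def)
  moreover have "CARD('a) > 0" by simp
  ultimately show ?thesis by (auto split: if_splits)
qed

lemma order_eq_4: "CARD('a) = 4"
proof (rule ccontr)
  assume q: "CARD('a) \<noteq> 4"
  interpret r: modified_triangle "rot pt" Pts T H M by (rule rotate_modified)
  interpret s: modified_triangle "rot (rot pt)" Pts T H M by (rule r.rotate_modified)
  interpret config M "slope pt" "slope (rot pt)" "slope (rot (rot pt))" "side_set pt H" "side_set (rot pt) H"
    "side_set (rot (rot pt)) H" "pt 1 0 0 \<in> H" "rot pt 1 0 0 \<in> H" "rot (rot pt) 1 0 0 \<in> H"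
  proof
    show "slope pt m * slope (rot pt) m * slope (rot (rot pt)) m = -1" if mM: "m \<in> M" for m
      by (rule coords_M[OF mM]) simp
    show "m = n" if mn: "m \<in> M" "n \<in> M" "slope pt m = slope pt n" "slope (rot pt) m = slope (rot pt) n" for m n
    proof (rule coords_M[OF mn(1)], rule coords_M[OF mn(2)])
      fix x y z x' y' z' assume *: "x \<noteq> 0" "y \<noteq> 0" "z \<noteq> 0" "m = pt x y z"
        "slope pt m = - z / y" "slope (rot pt) m = - x / z"
        "x' \<noteq> 0" "y' \<noteq> 0" "z' \<noteq> 0" "n = pt x' y' z'"
        "slope pt n = - z' / y'" "slope (rot pt) n = - x' / z'"
      then have e: "z / y = z' / y'" "x / z = x' / z'" using mn by simp_all
      have "x' = z'/z * x" "y' = z'/z * y" "z' = z'/z * z" "z'/z \<noteq> 0"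
        using e *(1-3,7-9) by (simp_all add: field_simps)
      then have "\<exists>c. c \<noteq> 0 \<and> x' = c*x \<and> y' = c*y \<and> z' = c*z" by blast
      then show "m = n" using pt_eq[of x y z x' y' z'] *(1,4,7,10) by simp
    qed
    show "card (side_set pt H) + of_bool (rot pt 1 0 0 \<in> H) + of_bool (rot (rot pt) 1 0 0 \<in> H) < CARD('a)"
      using side_bound by (simp add: rot_def)
    show "card (side_set (rot pt) H) + of_bool (rot (rot pt) 1 0 0 \<in> H) + of_bool (pt 1 0 0 \<in> H) < CARD('a)"
      using r.side_bound by (simp add: rot_def)
    show "card (side_set (rot (rot pt)) H) + of_bool (pt 1 0 0 \<in> H) + of_bool (rot pt 1 0 0 \<in> H) < CARD('a)"
      using s.side_bound by (simp add: rot_def)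
    show "card (side_set pt H) + card (side_set (rot pt) H) + card (side_set (rot (rot pt)) H)
     + of_bool (pt 1 0 0 \<in> H) + of_bool (rot pt 1 0 0 \<in> H) + of_bool (rot (rot pt) 1 0 0 \<in> H) = 6"
      using card_subset_T[OF H(1)] H(2) by (simp add: rot_def)
  qed (use M pencil r.pencil s.pencil vertex r.vertex s.vertex in \<open>auto simp: side_set_def\<close>)
  show False using contradiction q by blast
qed

end

section \<open>Counting 2-secants in the plane of order 4\<close>

context coordinates
begin

lemma card_line_aux:
  assumes "w \<noteq> 0"
  shows "card (line pt u v w) = CARD('a) + 1"
proof -
  let ?f = "\<lambda>y. pt 1 y (-(u + v * y)/w)"
  have "line pt u v w = insert (pt 0 1 (-v/w)) (range ?f)"
  proof (intro equalityI subsetI)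
    fix P assume "P \<in> line pt u v w"
    then obtain x y z where nz: "(x,y,z) \<noteq> (0,0,0)" and P: "P = pt x y z" and e: "u*x + v * y + w*z = 0"
      unfolding line_def by blast
    have z: "z = -(u*x + v * y)/w" using e assms by (simp add: field_simps eq_neg_iff_add_eq_0)
    show "P \<in> insert (pt 0 1 (-v/w)) (range ?f)"
    proof (cases "x = 0")
      case True
      then have "y \<noteq> 0" using z nz by auto
      then have "pt 0 1 (-v/w) = pt x y z" using pt_eq[of 0 1 "-v/w" x y z] nz True z by auto
      then show ?thesis using P by simp
    next
      case False
      have "x * (-(u + v * (y/x))/w) = -(u*x + v * (x*(y/x)))/w" by (simp add: algebra_simps)
      also have "\<dots> = z" using False by (simp add: z)
      finally have "z = x * (-(u + v * (y/x))/w)" ..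
      then have "\<exists>c. c \<noteq> 0 \<and> x = c*1 \<and> y = c*(y/x) \<and> z = c*(-(u + v * (y/x))/w)"
        using False by (intro exI[of _ x]) simp
      then have "?f (y/x) = pt x y z"
        using pt_eq[of 1 "y/x" "-(u + v * (y/x))/w" x y z] nz by simp
      then have "P = ?f (y/x)" using P by simp
      then show ?thesis by blast
    qed
  next
    fix P assume "P \<in> insert (pt 0 1 (-v/w)) (range ?f)"
    then show "P \<in> line pt u v w" using assms by (auto simp: mem_line)
  qed
  moreover have "pt 0 1 (-v/w) \<notin> range ?f" by (auto simp: pt_eq)
  moreover have "inj ?f" by (auto simp: inj_on_def pt_eq)
  ultimately show ?thesis by (simp add: card_image)
qed

lemma card_line:
  assumes "(u,v,w) \<noteq> (0,0,0)"
  shows "card (line pt u v w) = CARD('a) + 1"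
proof -
  interpret r: coordinates "rot pt" Pts T by (rule rotate)
  interpret s: coordinates "rot (rot pt)" Pts T by (rule r.rotate)
  consider "w \<noteq> 0" | "v \<noteq> 0" | "u \<noteq> 0" using assms by auto
  then show ?thesis
    using card_line_aux[of w u v] r.card_line_aux[of u v w] s.card_line_aux[of v w u] by cases (simp_all add: rot_line)
qed

lemma card_Pts: "card Pts = CARD('a)\<^sup>2 + CARD('a) + 1"
proof -
  let ?f = "\<lambda>(y,z). pt 1 y z" and ?g = "\<lambda>z. pt 0 1 z"
  have "Pts = insert (pt 0 0 1) (range ?g \<union> range ?f)"
  proof (intro equalityI subsetI)
    fix P assume "P \<in> Pts"
    then obtain x y z where nz: "(x,y,z) \<noteq> (0,0,0)" and P: "P = pt x y z" using pt_surj by blast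
    consider "x \<noteq> 0" | "x = 0" "y \<noteq> 0" | "x = 0" "y = 0" by blast
    then show "P \<in> insert (pt 0 0 1) (range ?g \<union> range ?f)"
    proof cases
      case 1
      then have "?f (y/x, z/x) = P" using pt_eq[of 1 "y/x" "z/x" x y z] P by auto
      then show ?thesis by (metis UnI2 insertI2 rangeI)
    next
      case 2
      then have "?g (z/y) = P" using pt_eq[of 0 1 "z/y" x y z] P by auto
      then show ?thesis by (metis UnI1 insertI2 rangeI)
    next
      case 3
      then have "pt 0 0 1 = P" using pt_eq[of 0 0 1 x y z] P nz by auto
      then show ?thesis by simp
    qed
  next
    fix P assume "P \<in> insert (pt 0 0 1) (range ?g \<union> range ?f)"
    then show "P \<in> Pts" by (auto intro: pt_in)
  qed
  moreover have "pt 0 0 1 \<notin> range ?g \<union> range ?f" "range ?g \<inter> range ?f = {}" by (auto simp: pt_eq)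
  moreover have "inj ?f" "inj ?g" by (auto simp: inj_on_def pt_eq)
  ultimately show ?thesis
    by (simp add: card_Un_disjoint card_image power2_eq_square)
qed

text \<open>The five lines through a point outside \<open>B\<close> share its 11 points with at
  least 2 on each, so four are 2-secants and one is a 3-secant. Every 2-secant has 3 points outside
  \<open>B\<close>, but the number of incidences, 10 * 4, is not divisible by 3.\<close>

lemma double_blocking_order_4:
  assumes q: "CARD('a) = 4" and B: "B \<subseteq> Pts" "card B = 11"
    and L: "L = {line pt u v w | u v w. (u,v,w) \<noteq> (0,0,0)}"
    and blocking: "\<And>l. l \<in> L \<Longrightarrow> 2 \<le> card (B \<inter> l)"
    and join: "\<And>P Q. P \<in> Pts \<Longrightarrow> Q \<in> Pts \<Longrightarrow> P \<noteq> Q \<Longrightarrow> \<exists>!l. l \<in> L \<and> P \<in> l \<and> Q \<in> l"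
  shows False
proof -
  have cP: "card Pts = 21" using card_Pts q by simp
  have cl: "card l = 5" if "l \<in> L" for l using card_line q that L by auto
  have lP: "l \<subseteq> Pts" if "l \<in> L" for l using that pt_in unfolding L line_def by blast
  have fl: "finite l" if "l \<in> L" for l using cl[OF that] by (metis card.infinite zero_neq_numeral)
  have "L \<subseteq> Pow Pts" using lP by blast
  then have finL: "finite L" using finite_Pts by (simp add: finite_subset)
  have finB: "finite B" using B finite_Pts finite_subset by blast
  define L2 where "L2 = {l\<in>L. card (B \<inter> l) = 2}"
  have pencil: "card {l\<in>L2. P \<in> l} = 4" if P: "P \<in> Pts - B" for P
  proof -
    let ?S = "{l\<in>L. P \<in> l}"
    have finS: "finite ?S" using finL by simp
    have dis: "l = l'" if "l \<in> ?S" "l' \<in> ?S" "Q \<in> l" "Q \<in> l'" "Q \<noteq> P" for l l' Q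
    proof -
      have "Q \<in> Pts" using that lP by blast
      then have "\<exists>!l. l \<in> L \<and> P \<in> l \<and> Q \<in> l" using join[of P Q] P that(5) by blast
      then show ?thesis using that(1-4) by blast
    qed
    have ex: "\<exists>l\<in>?S. Q \<in> l" if "Q \<in> Pts" "Q \<noteq> P" for Q using join[of P Q] P that by blast
    have "Pts - {P} = (\<Union>l\<in>?S. l - {P})"
    proof (intro equalityI subsetI)
      fix Q assume "Q \<in> Pts - {P}"
      then show "Q \<in> (\<Union>l\<in>?S. l - {P})" using ex[of Q] by blast
    qed (use lP in blast)
    then have "card (Pts - {P}) = card (\<Union>l\<in>?S. l - {P})" by simp
    also have "\<dots> = (\<Sum>l\<in>?S. card (l - {P}))"
    proof (rule card_UN_disjoint)
      show "\<forall>l\<in>?S. \<forall>l'\<in>?S. l \<noteq> l' \<longrightarrow> (l - {P}) \<inter> (l' - {P}) = {}"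
      proof (intro ballI impI equals0I)
        fix l l' Q assume "l \<in> ?S" "l' \<in> ?S" "l \<noteq> l'" "Q \<in> (l - {P}) \<inter> (l' - {P})"
        then show False using dis[of l l' Q] by blast
      qed
    qed (use finS fl in auto)
    also have "\<dots> = (\<Sum>l\<in>?S. 4)" by (rule sum.cong) (use cl fl in auto)
    finally have cS: "card ?S = 5" using cP P finite_Pts by simp
    have PB: "Q \<noteq> P" if "Q \<in> B" for Q using P that by blast
    have "B = (\<Union>l\<in>?S. B \<inter> l)"
    proof (intro equalityI subsetI)
      fix Q assume "Q \<in> B"
      then show "Q \<in> (\<Union>l\<in>?S. B \<inter> l)" using ex[of Q] PB B(1) by blast
    qed blast
    then have "card B = card (\<Union>l\<in>?S. B \<inter> l)" by simp
    also have "\<dots> = (\<Sum>l\<in>?S. card (B \<inter> l))"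
    proof (rule card_UN_disjoint)
      show "\<forall>l\<in>?S. \<forall>l'\<in>?S. l \<noteq> l' \<longrightarrow> (B \<inter> l) \<inter> (B \<inter> l') = {}"
      proof (intro ballI impI equals0I)
        fix l l' Q assume "l \<in> ?S" "l' \<in> ?S" "l \<noteq> l'" "Q \<in> (B \<inter> l) \<inter> (B \<inter> l')"
        then show False using dis[of l l' Q] PB by blast
      qed
    qed (use finS finB in auto)
    finally have s: "(\<Sum>l\<in>?S. card (B \<inter> l)) = 11" using B by simp
    let ?E = "{l\<in>?S. card (B \<inter> l) \<noteq> 2}"
    have "(\<Sum>l\<in>?S. 2 + (if card (B \<inter> l) \<noteq> 2 then 1 else 0)) \<le> (\<Sum>l\<in>?S. card (B \<inter> l))"
      by (rule sum_mono) (use blocking in force)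
    moreover have "card ?E = (\<Sum>l\<in>?S. if card (B \<inter> l) \<noteq> 2 then 1 else 0)"
      by (simp only: card_eq_sum sum.inter_filter[OF finS])
    then have "(\<Sum>l\<in>?S. 2 + (if card (B \<inter> l) \<noteq> 2 then 1 else 0)) = 10 + card ?E"
      unfolding sum.distrib using cS by simp
    ultimately have "card ?E \<le> 1" using s by simp
    moreover have "?E \<noteq> {}"
    proof
      assume "?E = {}"
      then have "(\<Sum>l\<in>?S. card (B \<inter> l)) = (\<Sum>l\<in>?S. 2)" by (intro sum.cong) auto
      then show False using s cS by simp
    qed
    then have "card ?E > 0" using finL by (simp add: card_gt_0_iff)
    ultimately have "card ?E = 1" by linarith
    moreover have "card (?S - ?E) = card ?S - card ?E" by (rule card_Diff_subset) (use finL in auto)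
    moreover have "{l\<in>L2. P \<in> l} = ?S - ?E" by (auto simp: L2_def)
    ultimately show ?thesis using cS by simp
  qed
  have three: "card {P\<in>Pts - B. P \<in> l} = 3" if "l \<in> L2" for l
  proof -
    have l: "l \<in> L" "card (B \<inter> l) = 2" using that by (auto simp: L2_def)
    have "{P\<in>Pts - B. P \<in> l} = l - (B \<inter> l)" using lP[OF l(1)] by auto
    then show ?thesis using l cl fl by (simp add: card_Diff_subset)
  qed
  have "(\<Sum>P\<in>Pts - B. card {l\<in>L2. P \<in> l}) = 3 * card L2"
    by (rule sum_multicount) (use finite_Pts finL three in \<open>auto simp: L2_def\<close>)
  moreover have "(\<Sum>P\<in>Pts - B. card {l\<in>L2. P \<in> l}) = 40"
    using pencil cP B finB by (simp add: card_Diff_subset)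
  ultimately show False by presburger
qed

end

section \<open>Linear forms, planes and the coordinates of a triangle\<close>

definition dotp :: "'a::field ^ 3 \<Rightarrow> 'a ^ 3 \<Rightarrow> 'a" where
  "dotp f x = f$1 * x$1 + f$2 * x$2 + f$3 * x$3"

lemma dotp_add: "dotp f (x + y) = dotp f x + dotp f y"
  and dotp_scale: "dotp f (c *s x) = c * dotp f x"
  and dotp_add_left: "dotp (f + g) x = dotp f x + dotp g x"
  and dotp_scale_left: "dotp (c *s f) x = c * dotp f x"
  and dotp_zero: "dotp f 0 = 0"
  by (simp_all add: dotp_def algebra_simps)

lemma dotp_axis: "dotp f (axis i 1) = f $ i"
  using exhaust_3[of i] by (auto simp: dotp_def axis_def)

lemma subspace_kernel: "vec.subspace {x. dotp f x = 0}"
  by (simp add: vec.subspace_def dotp_add dotp_scale dotp_zero)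

text \<open>A vector on which the form does not vanish spans the whole space together with the
  kernel and adds one dimension.\<close>

lemma dim_kernel:
  fixes f :: "'a::field ^ 3"
  assumes "f \<noteq> 0"
  shows "vec.dim {x. dotp f x = 0} = 2"
proof -
  let ?K = "{x. dotp f x = 0}"
  obtain i where i: "f $ i \<noteq> 0" using assms by (metis vec_eq_iff zero_index)
  define e :: "'a ^ 3" where "e = axis i 1"
  have e: "dotp f e \<noteq> 0" using i by (simp add: e_def dotp_axis)
  have span: "vec.span ?K = ?K" using subspace_kernel by (simp add: vec.span_eq_iff)
  have "x \<in> vec.span (insert e ?K)" for x
  proof -
    let ?c = "dotp f x / dotp f e"
    have "x - ?c *s e \<in> vec.span ?K" unfolding span
      using e dotp_add[of f x "- (?c *s e)"] dotp_scale[of f "-?c" e] by simp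
    then show ?thesis by (meson vec.span_breakdown_eq)
  qed
  then have "vec.span (insert e ?K) = UNIV" by blast
  then have "vec.dim (insert e ?K) = 3" using vec.dim_span[of "insert e ?K"] vec_dim_card[where 'a='a and 'n=3] by simp
  then show ?thesis using e span by (simp add: vec.dim_insert)
qed

text \<open>The coefficients of a form vanishing on a basis \<open>b1\<close>, \<open>b2\<close> are
  a null vector of the matrix with rows \<open>b1\<close>, \<open>b2\<close>, 0, which is singular
  because of its third row.\<close>

lemma subspace_eq_kernel:
  fixes W :: "('a::field ^ 3) set"
  assumes W: "vec.subspace W" "vec.dim W = 2"
  obtains f where "f \<noteq> 0" "W = {x. dotp f x = 0}"
proof -
  obtain B where B: "B \<subseteq> W" "vec.independent B" "W \<subseteq> vec.span B" "card B = 2"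
    using vec.basis_exists[of W] W by metis
  obtain b1 b2 where b: "B = {b1,b2}" using B(4) by (meson card_2_iff)
  define A :: "'a ^ 3 ^ 3" where "A = vector [b1, b2, 0]"
  have "\<not> (\<exists>A'. A ** A' = mat 1)"
  proof
    assume "\<exists>A'. A ** A' = mat 1"
    then obtain A' where "A ** A' = mat 1" by blast
    then have "(A ** A') $ 3 $ 3 = 1" by (simp add: mat_def)
    then show False by (simp add: matrix_matrix_mult_def A_def)
  qed
  then have "\<not> (\<exists>A'. A' ** A = mat 1)" using matrix_left_right_inverse by blast
  then obtain f where f: "A *v f = 0" "f \<noteq> 0" unfolding matrix_left_invertible_ker by blast
  have "(A *v f) $ 1 = dotp f b1" "(A *v f) $ 2 = dotp f b2"
    by (simp_all add: matrix_vector_mult_def A_def dotp_def sum_3 algebra_simps)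
  then have "B \<subseteq> {x. dotp f x = 0}" using f b by simp
  then have "vec.span B \<subseteq> {x. dotp f x = 0}" by (rule vec.span_minimal[OF _ subspace_kernel])
  then have "W \<subseteq> {x. dotp f x = 0}" using B by blast
  then have "W = {x. dotp f x = 0}"
    by (rule vec.subspace_dim_equal[OF W(1) subspace_kernel]) (simp add: dim_kernel f W)
  then show thesis using that f by blast
qed

lemma span_in_pg_points:
  assumes "p \<noteq> 0"
  shows "vec.span {p} \<in> pg_points"
proof -
  have "vec.independent {p}" using assms by simp
  then have "vec.dim {p} = 1" by (simp add: vec.dim_eq_card_independent)
  then show ?thesis by (simp add: pg_points_def)
qed

lemma pg_pointsE:
  assumes "P \<in> pg_points"
  obtains p where "p \<noteq> 0" "P = vec.span {p}"
proof -
  have P: "vec.subspace P" "vec.dim P = 1" using assms by (auto simp: pg_points_def)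
  obtain B where B: "B \<subseteq> P" "vec.independent B" "P \<subseteq> vec.span B" "card B = 1"
    using vec.basis_exists[of P] P by metis
  obtain p where p: "B = {p}" using B(4) by (meson card_1_singletonE)
  then have "p \<noteq> 0" using B(2) vec.dependent_zero by blast
  moreover have "P = vec.span {p}" using B p P vec.span_minimal[of B P] by blast
  ultimately show thesis using that by blast
qed

lemma span_subset_kernel: "vec.span {p} \<subseteq> {x. dotp f x = 0} \<longleftrightarrow> dotp f p = 0"
  using vec.span_minimal[OF _ subspace_kernel, of "{p}" f] vec.span_base[of p "{p}"] by auto

lemma pg_lines_kernel: "pg_lines = {{P \<in> pg_points. P \<subseteq> {x. dotp f x = 0}} | f. f \<noteq> 0}"
  unfolding pg_lines_def
proof (intro equalityI subsetI; clarify)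
  fix W :: "('a ^ 3) set" assume "vec.subspace W" "vec.dim W = 2"
  then obtain f where "f \<noteq> 0" "W = {x. dotp f x = 0}" by (rule subspace_eq_kernel)
  then show "\<exists>f. {P \<in> pg_points. P \<subseteq> W} = {P \<in> pg_points. P \<subseteq> {x. dotp f x = 0}} \<and> f \<noteq> 0" by blast
next
  fix f :: "'a ^ 3" assume "f \<noteq> 0"
  then show "\<exists>W. {P \<in> pg_points. P \<subseteq> {x. dotp f x = 0}} = {P \<in> pg_points. P \<subseteq> W} \<and> vec.subspace W \<and> vec.dim W = 2"
    using subspace_kernel dim_kernel by blast
qed

lemma pg_join:
  assumes P: "P \<in> pg_points" and Q: "Q \<in> pg_points" and "P \<noteq> Q"
  shows "\<exists>!l. l \<in> pg_lines \<and> P \<in> l \<and> Q \<in> l"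
proof -
  obtain p where p: "p \<noteq> 0" "P = vec.span {p}" using P by (rule pg_pointsE)
  obtain q where q: "q \<noteq> 0" "Q = vec.span {q}" using Q by (rule pg_pointsE)
  have sub: "vec.subspace P" "vec.subspace Q" "vec.dim P = 1" "vec.dim Q = 1"
    using P Q by (auto simp: pg_points_def)
  have "q \<notin> vec.span {p}"
  proof
    assume "q \<in> vec.span {p}"
    then have "Q \<subseteq> P" unfolding p q by (intro vec.span_minimal) auto
    then show False using vec.subspace_dim_equal[of Q P] sub assms(3) by simp
  qed
  then have "vec.independent {q,p}" "q \<noteq> p" using p(1) vec.span_base by (auto simp: vec.independent_insert)
  then have dim: "vec.dim {q,p} = 2" by (simp add: vec.dim_eq_card_independent)
  let ?W = "vec.span {q,p}"
  show ?thesis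
  proof (rule ex1I[of _ "{R \<in> pg_points. R \<subseteq> ?W}"])
    show "{R \<in> pg_points. R \<subseteq> ?W} \<in> pg_lines \<and> P \<in> {R \<in> pg_points. R \<subseteq> ?W} \<and> Q \<in> {R \<in> pg_points. R \<subseteq> ?W}"
      using dim P Q vec.span_mono[of "{p}" "{q,p}"] vec.span_mono[of "{q}" "{q,p}"]
      unfolding pg_lines_def p q by auto
    fix l assume l: "l \<in> pg_lines \<and> P \<in> l \<and> Q \<in> l"
    then obtain W where W: "vec.subspace W" "vec.dim W = 2" "l = {R \<in> pg_points. R \<subseteq> W}"
      unfolding pg_lines_def by blast
    then have "p \<in> W" "q \<in> W" using l p q vec.span_base by blast+
    then have "?W \<subseteq> W" using W(1) by (intro vec.span_minimal) auto
    then have "?W = W" by (rule vec.subspace_dim_equal[OF vec.subspace_span W(1)]) (use dim W in simp)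
    then show "l = {R \<in> pg_points. R \<subseteq> ?W}" using W by simp
  qed
qed

text \<open>The sides are kernels of forms \<open>f1\<close>, \<open>f2\<close>, \<open>f3\<close>
  without a common zero. Their values serve as coordinates, and \<open>e\<close> inverts the
  resulting isomorphism.\<close>

lemma triangle_coordinates:
  fixes T :: "('a::{field,finite} ^ 3) set set"
  assumes "is_triangle T"
  obtains pt :: "'a \<Rightarrow> 'a \<Rightarrow> 'a \<Rightarrow> ('a ^ 3) set" where "coordinates pt pg_points T"
    "pg_lines = {line pt u v w | u v w. (u,v,w) \<noteq> (0,0,0)}"
proof -
  obtain l1 l2 l3 where l: "l1 \<in> pg_lines" "l2 \<in> pg_lines" "l3 \<in> pg_lines" "l1 \<inter> l2 \<inter> l3 = {}" "T = l1 \<union> l2 \<union> l3"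
    using assms unfolding is_triangle_def by blast
  obtain f1 where f1: "l1 = {P \<in> pg_points. P \<subseteq> {x. dotp f1 x = 0}}" using l(1) unfolding pg_lines_kernel by blast
  obtain f2 where f2: "l2 = {P \<in> pg_points. P \<subseteq> {x. dotp f2 x = 0}}" using l(2) unfolding pg_lines_kernel by blast
  obtain f3 where f3: "l3 = {P \<in> pg_points. P \<subseteq> {x. dotp f3 x = 0}}" using l(3) unfolding pg_lines_kernel by blast
  have inj: "p = 0" if "dotp f1 p = 0" "dotp f2 p = 0" "dotp f3 p = 0" for p
  proof (rule ccontr)
    assume "p \<noteq> 0"
    then have "vec.span {p} \<in> l1 \<inter> l2 \<inter> l3"
      using that span_in_pg_points by (simp add: f1 f2 f3 span_subset_kernel)
    then show False using l(4) by blast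
  qed
  have inj2: "p = q" if "dotp f1 p = dotp f1 q" "dotp f2 p = dotp f2 q" "dotp f3 p = dotp f3 q" for p q
  proof -
    have "dotp f (p - q) = dotp f p - dotp f q" for f by (simp add: dotp_def algebra_simps)
    then show ?thesis using inj[of "p - q"] that by simp
  qed
  define A :: "'a ^ 3 ^ 3" where "A = vector [f1, f2, f3]"
  have A: "(A *v x) $ 1 = dotp f1 x" "(A *v x) $ 2 = dotp f2 x" "(A *v x) $ 3 = dotp f3 x" for x
    by (simp_all add: matrix_vector_mult_def A_def dotp_def sum_3)
  have "\<forall>x. A *v x = 0 \<longrightarrow> x = 0" using inj A by (metis zero_index)
  then obtain A' where "A' ** A = mat 1" using matrix_left_invertible_ker by blast
  then have AA': "A ** A' = mat 1" by (simp add: matrix_left_right_inverse)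
  define e where "e x y z = A' *v vector [x, y, z]" for x y z
  have "A *v e x y z = vector [x,y,z]" for x y z
    by (simp add: e_def matrix_vector_mul_assoc AA')
  then have e: "dotp f1 (e x y z) = x" "dotp f2 (e x y z) = y" "dotp f3 (e x y z) = z" for x y z
    using A[of "e x y z"] by simp_all
  have ee: "e (dotp f1 p) (dotp f2 p) (dotp f3 p) = p" for p by (rule inj2) (simp_all add: e)
  have e0: "e x y z \<noteq> 0" if "(x,y,z) \<noteq> (0,0,0)" for x y z using that e[of x y z] by (auto simp: dotp_zero)
  have escale: "c *s e x y z = e (c*x) (c*y) (c*z)" for c x y z by (rule inj2) (simp_all add: e dotp_scale)
  have elin: "e x y z = x *s e 1 0 0 + y *s e 0 1 0 + z *s e 0 0 1" for x y z
    by (rule inj2) (simp_all add: e dotp_scale dotp_add)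
  define pt where "pt x y z = vec.span {e x y z}" for x y z
  have surj: "\<exists>x y z. (x,y,z) \<noteq> (0,0,0) \<and> P = pt x y z" if "P \<in> pg_points" for P
  proof -
    obtain p where p: "p \<noteq> 0" "P = vec.span {p}" using pg_pointsE[OF \<open>P \<in> pg_points\<close>] .
    then have "(dotp f1 p, dotp f2 p, dotp f3 p) \<noteq> (0,0,0)" using inj by auto
    then show ?thesis using p ee[of p] unfolding pt_def by metis
  qed
  have "coordinates pt pg_points T"
  proof
    show in_pts: "pt x y z \<in> pg_points" if "(x,y,z) \<noteq> (0,0,0)" for x y z
      unfolding pt_def using e0[OF that] by (rule span_in_pg_points)
    show "pt x y z = pt x' y' z' \<longleftrightarrow> (\<exists>c. c \<noteq> 0 \<and> x' = c*x \<and> y' = c*y \<and> z' = c*z)"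
      if nz: "(x,y,z) \<noteq> (0,0,0)" "(x',y',z') \<noteq> (0,0,0)" for x y z x' y' z'
    proof
      assume "pt x y z = pt x' y' z'"
      then have "e x' y' z' \<in> vec.span {e x y z}" unfolding pt_def using vec.span_base by blast
      then obtain c where "e x' y' z' = c *s e x y z" by (auto simp: vec.span_singleton)
      then have c: "e x' y' z' = e (c*x) (c*y) (c*z)" by (simp add: escale)
      have "x' = c*x" "y' = c*y" "z' = c*z" using e[of x' y' z'] unfolding c by (simp_all add: e)
      then show "\<exists>c. c \<noteq> 0 \<and> x' = c*x \<and> y' = c*y \<and> z' = c*z" using nz(2) by auto
    next
      assume "\<exists>c. c \<noteq> 0 \<and> x' = c*x \<and> y' = c*y \<and> z' = c*z"
      then obtain c where c: "c \<noteq> 0" "x' = c*x" "y' = c*y" "z' = c*z" by blast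
      then have "e x' y' z' = c *s e x y z" by (simp add: escale)
      then have "vec.span {e x' y' z'} \<subseteq> vec.span {e x y z}"
        by (intro vec.span_minimal) (simp_all add: vec.span_scale vec.span_base)
      moreover have "vec.dim (vec.span {e x' y' z'}) = 1" "vec.dim (vec.span {e x y z}) = 1"
        using in_pts[OF nz(1)] in_pts[OF nz(2)] unfolding pt_def pg_points_def by auto
      ultimately have "vec.span {e x' y' z'} = vec.span {e x y z}"
        by (intro vec.subspace_dim_equal[OF vec.subspace_span vec.subspace_span]) simp_all
      then show "pt x y z = pt x' y' z'" unfolding pt_def ..
    qed
    show "T = {pt x y z | x y z. (x,y,z) \<noteq> (0,0,0) \<and> x*y*z = 0}"
    proof (intro equalityI subsetI)
      fix P assume P: "P \<in> T"
      then have "P \<in> pg_points" using l f1 f2 f3 by auto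
      then obtain x y z where "(x,y,z) \<noteq> (0,0,0)" "P = pt x y z" using surj by blast
      moreover then have "x*y*z = 0" using P unfolding l f1 f2 f3 pt_def by (auto simp: span_subset_kernel e)
      ultimately show "P \<in> {pt x y z | x y z. (x,y,z) \<noteq> (0,0,0) \<and> x*y*z = 0}" by blast
    next
      fix P assume "P \<in> {pt x y z | x y z. (x,y,z) \<noteq> (0,0,0) \<and> x*y*z = 0}"
      then obtain x y z where nz: "(x,y,z) \<noteq> (0,0,0)" and "P = pt x y z" "x*y*z = 0" by blast
      then show "P \<in> T" using in_pts[OF nz] unfolding l f1 f2 f3 pt_def by (auto simp: span_subset_kernel e)
    qed
  qed (rule surj)
  then interpret coordinates pt pg_points T .
  \<comment> \<open>The form \<open>g\<close> and its coefficients in the new coordinates define the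
    same line; both inclusions between the two families of lines rest on this.\<close>
  have line_eq: "line pt u v w = {P \<in> pg_points. P \<subseteq> {x. dotp g x = 0}}"
    if g: "\<And>x y z. dotp g (e x y z) = u*x + v * y + w*z" for u v w g
  proof (intro equalityI subsetI)
    fix P assume "P \<in> line pt u v w"
    then obtain x y z where nz: "(x,y,z) \<noteq> (0,0,0)" and P: "P = pt x y z" "u*x + v * y + w*z = 0"
      unfolding line_def by blast
    have "P \<subseteq> {x. dotp g x = 0}" unfolding P(1) pt_def span_subset_kernel g by (rule P(2))
    then show "P \<in> {P \<in> pg_points. P \<subseteq> {x. dotp g x = 0}}" using pt_in[OF nz] P(1) by simp
  next
    fix P assume P: "P \<in> {P \<in> pg_points. P \<subseteq> {x. dotp g x = 0}}"
    then obtain x y z where nz: "(x,y,z) \<noteq> (0,0,0)" and e: "P = pt x y z" using surj by blast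
    then have "u*x + v * y + w*z = 0" using P by (simp add: pt_def span_subset_kernel g)
    then show "P \<in> line pt u v w" unfolding line_def using nz e by blast
  qed
  have "pg_lines = {line pt u v w | u v w. (u,v,w) \<noteq> (0,0,0)}"
  proof (intro equalityI subsetI)
    fix l :: "('a ^ 3) set set" assume "l \<in> pg_lines"
    then obtain g where g: "g \<noteq> 0" "l = {P \<in> pg_points. P \<subseteq> {x. dotp g x = 0}}" unfolding pg_lines_kernel by blast
    define u v w where uvw: "u = dotp g (e 1 0 0)" "v = dotp g (e 0 1 0)" "w = dotp g (e 0 0 1)"
    have *: "dotp g (e x y z) = u*x + v * y + w*z" for x y z
      by (subst elin) (simp add: dotp_add dotp_scale uvw)
    have "(u,v,w) \<noteq> (0,0,0)"
    proof
      assume "(u,v,w) = (0,0,0)"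
      then have "dotp g (e x y z) = 0" for x y z using *[of x y z] by simp
      then have "dotp g p = 0" for p using ee[of p] by metis
      then have "g $ i = 0" for i using dotp_axis[of g i] by simp
      then show False using g(1) by (simp add: vec_eq_iff)
    qed
    moreover have "l = line pt u v w" using line_eq[OF *] g by simp
    ultimately show "l \<in> {line pt u v w | u v w. (u,v,w) \<noteq> (0,0,0)}" by blast
  next
    fix l assume "l \<in> {line pt u v w | u v w. (u,v,w) \<noteq> (0,0,0)}"
    then obtain u v w where nz: "(u,v,w) \<noteq> (0,0,0)" and l: "l = line pt u v w" by blast
    define g where "g = u *s f1 + v *s f2 + w *s f3"
    have *: "dotp g (e x y z) = u*x + v * y + w*z" for x y z
      by (simp add: g_def dotp_add_left dotp_scale_left e)
    have "g \<noteq> 0"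
    proof
      assume "g = 0"
      then have "u*x + v * y + w*z = 0" for x y z using *[of x y z] by (simp add: dotp_def)
      from this[of 1 0 0] this[of 0 1 0] this[of 0 0 1] show False using nz by simp
    qed
    then show "l \<in> pg_lines" unfolding pg_lines_kernel l line_eq[OF *] by blast
  qed
  then show thesis using that \<open>coordinates pt pg_points T\<close> by blast
qed

theorem theorem1:
  fixes T :: "('a::{field,finite} ^ 3) set set"
  assumes "is_triangle T"
  shows "\<not> (\<exists>H M. H \<subseteq> T \<and> card H = 6 \<and>
                 M \<subseteq> pg_points \<and> M \<inter> T = {} \<and> card M = 5 \<and>
                 double_blocking_set ((T - H) \<union> M))"
proof
  assume "\<exists>H M. H \<subseteq> T \<and> card H = 6 \<and> M \<subseteq> pg_points \<and> M \<inter> T = {} \<and> card M = 5 \<and>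
                 double_blocking_set ((T - H) \<union> M)"
  then obtain H M where HM: "H \<subseteq> T" "card H = 6" "M \<subseteq> pg_points" "M \<inter> T = {}" "card M = 5"
    and B: "double_blocking_set ((T - H) \<union> M)" by blast
  obtain pt :: "'a \<Rightarrow> 'a \<Rightarrow> 'a \<Rightarrow> ('a ^ 3) set" where pt: "coordinates pt pg_points T"
    and L: "pg_lines = {line pt u v w | u v w. (u,v,w) \<noteq> (0,0,0)}"
    using triangle_coordinates[OF assms] .
  interpret coordinates pt pg_points T by (rule pt)
  have meets: "2 \<le> card (((T - H) \<union> M) \<inter> l)" if "l \<in> pg_lines" for l
    using B that by (simp add: double_blocking_set_def)
  interpret modified_triangle pt pg_points T H M
  proof
    show "2 \<le> card (((T - H) \<union> M) \<inter> line pt u v w)" if "(u,v,w) \<noteq> (0,0,0)" for u v w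
      by (rule meets) (use that L in blast)
  qed (use HM in auto)
  have q: "CARD('a) = 4" by (rule order_eq_4)
  have "card ((T - H) \<union> M) = card (T - H) + card M"
    by (rule card_Un_disjoint) (use HM finite_T finite_M in auto)
  \<comment> \<open>For q = 4 the triangle has 3 * 4 = 12 points.\<close>
  also have "card (T - H) = 6" using card_T q HM finite_H by (simp add: card_Diff_subset)
  finally have c: "card ((T - H) \<union> M) = 11" using HM by simp
  have sub: "(T - H) \<union> M \<subseteq> pg_points" using T_Pts HM by blast
  show False by (rule double_blocking_order_4[OF q sub c L meets pg_join])
qed

end
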